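(* Let $n$ be even and $\mathbf X=\mathbf U+\mathbf E\in\mathbb R^{n\times p}$, where $\mathbf U_{1\cdot}=\dots=\mathbf U_{n/2\cdot}=\mathbf c_1$, $\mathbf U_{n/2+1\cdot}=\dots=\mathbf U_{n\cdot}=\mathbf c_2$, and the rows of $\mathbf E$ are independent, mean zero, with sub-Gaussian norm $\sigma_p$. Let $\boldsymbol\Phi\in\{0,1\}^{n\times n}$ be random, symmetric with zero diagonal, independent of $\mathbf E$, with entries $\Phi_{ij}$, $i<j$, independent Bernoulli random variables with $$p_w=P(\Phi_{ij}=1\mid\mathbf U_{i\cdot}=\mathbf U_{j\cdot}),\qquad p_b=P(\Phi_{ij}=1\mid\mathbf U_{i\cdot}\ne\mathbf U_{j\cdot}).$$ Let $G=(V,\mathcal E)$ be the corresponding graph with oriented edge-incidence matrix $\mathbf F$. If, as $n\to\infty$, $p_w=\omega(\log(n)/n)$, $p_b=\omega(\log(n)/n)$ and $\frac{np_b^2}{p_w+p_b}=\omega(\log n)$, then $$\frac{\|\mathbf F^\dagger\mathbf E\|_{\max}}{n}\sum_{(i,j)\in\mathcal E}\sqrt{\Phi_{ij}}\,\|\mathbf U_{i\cdot}-\mathbf U_{j\cdot}\|_2=O_p\Big(\sqrt{\log n}\Big(\frac{p_b}{p_w+p_b}+\frac{1}{\sqrt n(p_w+p_b)}\Big)\Big).$$ Consequently, if in addition $p_w=\omega\big(\sqrt{\log(n)/n}\big)$ and $p_w=\omega(p_b\sqrt{\log n})$, then the left-hand side converges to zero in probability.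
   Context: The sub-Gaussian norm of a random vector $\mathbf Y\in\mathbb R^p$ is $\sup_{\|\mathbf v\|_2=1}\inf\{K>0:\mathbb E[\exp((\mathbf v^\top\mathbf Y)^2/K^2)]\le2\}$. Here $p_w,p_b$ are sequences depending on $n$. Edges $(i,j)\in\mathcal E$ are indexed with $i<j$. An oriented edge-incidence matrix $\mathbf F\in\mathbb R^{n\times|\mathcal E|}$ has, for each edge $(j,k)$ with column index $\mathcal E(j,k)$, entries $\mathbf F_{j,\mathcal E(j,k)}=-\mathbf F_{k,\mathcal E(j,k)}=\sqrt{\Phi_{jk}}$ and zeros elsewhere. $\mathbf F^\dagger$ is the Moore–Penrose pseudoinverse and $\|\cdot\|_{\max}$ the maximum absolute entry. *)

theory Defs
  imports "HOL-Probability.Probability" "HOL-Library.Landau_Symbols" "Jordan_Normal_Form.Matrix"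
begin

definition mp_pinv :: "real mat \<Rightarrow> real mat" where
  "mp_pinv A = (THE B. B \<in> carrier_mat (dim_col A) (dim_row A) \<and>
      A * B * A = A \<and> B * A * B = B \<and>
      transpose_mat (A * B) = A * B \<and> transpose_mat (B * A) = B * A)"

text \<open>Maximum absolute entry (0 for an empty matrix).\<close>
definition max_abs_entry :: "real mat \<Rightarrow> real" where
  "max_abs_entry A = Max ({\<bar>A $$ (i, j)\<bar> | i j. i < dim_row A \<and> j < dim_col A} \<union> {0})"

text \<open>Sub-Gaussian norm of a random vector Y in R^p (coordinates 0..p-1):
  sup over unit v of inf {K>0. E exp((v^T Y)^2/K^2) <= 2}; the infimum of the empty set is \<infinity>.\<close>
definition subg_norm :: "'a measure \<Rightarrow> ('a \<Rightarrow> nat \<Rightarrow> real) \<Rightarrow> nat \<Rightarrow> ereal" where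
  "subg_norm M Y p = (SUP v \<in> {v :: nat \<Rightarrow> real. (\<Sum>k<p. (v k)\<^sup>2) = 1}.
      Inf {ereal K | K. K > 0 \<and>
        (\<integral>\<^sup>+ \<omega>. ennreal (exp ((\<Sum>k<p. v k * Y \<omega> k)\<^sup>2 / K\<^sup>2)) \<partial>M) \<le> 2})"

definition edge_list :: "nat \<Rightarrow> (nat \<Rightarrow> nat \<Rightarrow> real) \<Rightarrow> (nat \<times> nat) list" where
  "edge_list n Phi = filter (\<lambda>(i, j). i < j \<and> Phi i j = 1) (List.product [0..<n] [0..<n])"

definition incidence_mat :: "nat \<Rightarrow> (nat \<Rightarrow> nat \<Rightarrow> real) \<Rightarrow> real mat" where
  "incidence_mat n Phi = (let es = edge_list n Phi in
     mat n (length es) (\<lambda>(r, e). (case es ! e of (j, k) \<Rightarrow>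
        if r = j then sqrt (Phi j k) else if r = k then - sqrt (Phi j k) else 0)))"

definition even_at_top :: "nat filter" where
  "even_at_top = inf at_top (principal {n. even n})"

text \<open>O_p: Z_n = O_p(r_n) along F (with outer probability, so no measurability is presupposed).\<close>
definition bounded_in_prob :: "nat filter \<Rightarrow> (nat \<Rightarrow> 'a measure) \<Rightarrow> (nat \<Rightarrow> 'a \<Rightarrow> real) \<Rightarrow> (nat \<Rightarrow> real) \<Rightarrow> bool" where
  "bounded_in_prob F M Z r \<longleftrightarrow> (\<forall>\<epsilon>>0. \<exists>C. eventually (\<lambda>n. \<exists>A \<in> sets (M n).
      {\<omega> \<in> space (M n). \<bar>Z n \<omega>\<bar> > C * \<bar>r n\<bar>} \<subseteq> A \<and> measure (M n) A < \<epsilon>) F)"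

text \<open>Z_n \<rightarrow> 0 in probability along F (outer probability).\<close>
definition tendsto_zero_in_prob :: "nat filter \<Rightarrow> (nat \<Rightarrow> 'a measure) \<Rightarrow> (nat \<Rightarrow> 'a \<Rightarrow> real) \<Rightarrow> bool" where
  "tendsto_zero_in_prob F M Z \<longleftrightarrow> (\<forall>\<delta>>0. \<forall>\<epsilon>>0. eventually (\<lambda>n. \<exists>A \<in> sets (M n).
      {\<omega> \<in> space (M n). \<bar>Z n \<omega>\<bar> > \<delta>} \<subseteq> A \<and> measure (M n) A < \<epsilon>) F)"

end

theory Submission
  imports Defs "Jordan_Normal_Form.Determinant"
begin

text \<open>
  Write \<open>L = F F\<^sup>T\<close> for the graph Laplacian. The row of the pseudoinverse of \<open>F\<close> belonging to the edge
  \<open>(u, v)\<close> is the potential \<open>x\<close> with \<open>L x = e\<^sub>u - e\<^sub>v\<close> and zero sum, so conditionally on the graph the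
  maximum entry of \<open>F\<^sup>\<dagger> E\<close> is at most of order \<open>\<sigma> \<surd>(log n) max \<parallel>x\<parallel>\<close>, by sub-Gaussian tails and a union bound
  over edges and columns. With high probability every cut of the graph, and every cut inside a community,
  has at least half its expected size (Chernoff and a union bound over vertex sets), and all degrees are of
  the expected order. A Cheeger inequality turns the cut bounds into spectral gaps. If
  \<open>p\<^sub>w \<le> p\<^sub>b\<close>, the gap of the whole graph gives \<open>\<parallel>x\<parallel> = O(1 / (n (p\<^sub>w + p\<^sub>b)))\<close>. Otherwise split
  \<open>x = \<mu> t + y\<close> with \<open>t = \<plusminus>1\<close> the community indicator and \<open>y\<close> summing to zero on both communities: the
  energy inside the communities controls \<open>y\<close>, and pairing the equation with \<open>t\<close> controls \<open>\<mu>\<close>, whence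
  \<open>\<parallel>x\<parallel> = O(1 / (n (p\<^sub>w + p\<^sub>b)) + 1 / (n \<surd>n p\<^sub>b))\<close>. Finally at most \<open>O(n\<^sup>2 p\<^sub>b)\<close> edges join the two communities.
\<close>

section \<open>A Cheeger inequality\<close>

text \<open>The delicate regime is \<open>pw\<close> much larger than \<open>pb\<close>. Cheeger for
  the whole graph would pair cuts of order \<open>n * pb\<close> with degrees of order
  \<open>n * pw\<close> and yield a gap of order \<open>n * pb^2 / pw\<close>. Even the best
  conceivable gap, of order \<open>n * pb\<close>, would only give a norm O(1 / (n pb)), and the
  \<open>n^2 * pb\<close> cross edges divided by \<open>n\<close> would turn this into a constant
  where the claim has \<open>pb / (pw + pb)\<close>. But only one direction is that slow, the
  indicator \<open>t\<close>, and e_u - e_v has inner product at most 2 with it although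
  \<open>t\<close> has norm \<open>sqrt n\<close>. So \<open>\<mu>\<close> is of order
  \<open>1 / (n^2 * pb)\<close> up to feedback from \<open>y\<close> and adds
  \<open>sqrt n * |\<mu>|\<close> to the norm, while all other directions see a gap of order
  \<open>n * pw\<close>. Multiplied by \<open>n * pb\<close>, the bound becomes
  \<open>pb / (pw + pb) + 1 / sqrt n\<close>, and \<open>pw + pb \<le> 2\<close> brings the last
  term into the claimed form. Constants are not optimised: lower bounds keep half of a mean and
  upper bounds three times a mean, so that exponential moments at the fixed parameters -1 and 1
  suffice.\<close>

lemma coarea_bound:
  fixes w :: "'v \<Rightarrow> 'v \<Rightarrow> real" and g :: "'v \<Rightarrow> real" and \<kappa> :: real
  assumes fin: "finite V"
    and sym: "\<And>i j. i \<in> V \<Longrightarrow> j \<in> V \<Longrightarrow> w i j = w j i"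
    and cut: "\<And>S. S \<subseteq> V \<Longrightarrow> 2 * card S \<le> card V \<Longrightarrow> \<kappa> * card S \<le> (\<Sum>i\<in>S. \<Sum>j\<in>V - S. w i j)"
    and "\<And>i. i \<in> V \<Longrightarrow> 0 \<le> g i"
    and "2 * card {i\<in>V. 0 < g i} \<le> card V"
  shows "2 * \<kappa> * (\<Sum>i\<in>V. g i) \<le> (\<Sum>i\<in>V. \<Sum>j\<in>V. w i j * \<bar>g i - g j\<bar>)"
  using assms(4,5)
proof (induction "card {i\<in>V. 0 < g i}" arbitrary: g rule: less_induct)
  \<comment> \<open>Subtracting the least positive value from \<open>g\<close> on its support \<open>S\<close> lowers the right-hand side by
    twice that value times the size of the cut around \<open>S\<close>.\<close>
  case less
  define S where "S = {i\<in>V. 0 < g i}"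
  have S: "S \<subseteq> V" "finite S" using fin by (auto simp: S_def)
  show ?case
  proof (cases "S = {}")
    case True
    then have "g i = 0" if "i \<in> V" for i using less.prems(1)[OF that] that by (force simp: S_def)
    then show ?thesis by simp
  next
    case False
    define m where "m = Min (g ` S)"
    have m_in: "m \<in> g ` S" unfolding m_def using False S by (intro Min_in) auto
    have m_le: "m \<le> g i" if "i \<in> S" for i unfolding m_def using that S by auto
    have m_pos: "m > 0" using m_in by (auto simp: S_def)
    have g0: "g i = 0" if "i \<in> V - S" for i using less.prems(1)[of i] that by (force simp: S_def)
    define h where "h i = (if i \<in> S then g i - m else 0)" for i
    have sub: "{i\<in>V. 0 < h i} \<subset> S" using m_in S by (force simp: h_def)
    then have lt: "card {i\<in>V. 0 < h i} < card S" using S by (intro psubset_card_mono)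
    have IH: "2 * \<kappa> * (\<Sum>i\<in>V. h i) \<le> (\<Sum>i\<in>V. \<Sum>j\<in>V. w i j * \<bar>h i - h j\<bar>)"
      using lt less.prems(2) m_le by (intro less.hyps) (auto simp: S_def[symmetric] h_def)
    have diff: "\<bar>g i - g j\<bar> = \<bar>h i - h j\<bar> + m * (of_bool (i \<in> S \<and> j \<notin> S) + of_bool (i \<notin> S \<and> j \<in> S))"
      if "i \<in> V" "j \<in> V" for i j
      using that m_le[of i] m_le[of j] g0[of i] g0[of j] m_pos by (auto simp: h_def abs_if)
    have ofb: "(\<Sum>i\<in>V. \<Sum>j\<in>V. w i j * of_bool (i \<in> S \<and> j \<notin> S)) = (\<Sum>i\<in>S. \<Sum>j\<in>V - S. w i j)"
    proof -
      have "(\<Sum>i\<in>V. \<Sum>j\<in>V. w i j * of_bool (i \<in> S \<and> j \<notin> S)) = (\<Sum>i\<in>S. \<Sum>j\<in>V. w i j * of_bool (i \<in> S \<and> j \<notin> S))"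
        using S fin by (intro sum.mono_neutral_right) auto
      also have "\<dots> = (\<Sum>i\<in>S. \<Sum>j\<in>V - S. w i j * of_bool (i \<in> S \<and> j \<notin> S))"
        using S fin by (intro sum.cong refl sum.mono_neutral_right) auto
      also have "\<dots> = (\<Sum>i\<in>S. \<Sum>j\<in>V - S. w i j)" by (intro sum.cong refl) auto
      finally show ?thesis .
    qed
    have ofb': "(\<Sum>i\<in>V. \<Sum>j\<in>V. w i j * of_bool (i \<notin> S \<and> j \<in> S)) = (\<Sum>i\<in>S. \<Sum>j\<in>V - S. w i j)"
      unfolding ofb[symmetric] by (subst sum.swap, intro sum.cong refl) (auto simp: sym)
    have "(\<Sum>i\<in>V. g i) = (\<Sum>i\<in>V. h i + m * of_bool (i \<in> S))"
      using g0 by (intro sum.cong refl) (auto simp: h_def)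
    also have "\<dots> = (\<Sum>i\<in>V. h i) + m * card S"
      using S fin by (simp add: sum.distrib Int_absorb1 flip: sum_distrib_left)
    finally have sg: "(\<Sum>i\<in>V. g i) = (\<Sum>i\<in>V. h i) + m * card S" .
    have "(\<Sum>i\<in>V. \<Sum>j\<in>V. w i j * \<bar>g i - g j\<bar>) =
       (\<Sum>i\<in>V. \<Sum>j\<in>V. w i j * \<bar>h i - h j\<bar> +
          m * (w i j * of_bool (i \<in> S \<and> j \<notin> S)) + m * (w i j * of_bool (i \<notin> S \<and> j \<in> S)))"
      by (intro sum.cong refl) (simp only: diff, simp add: algebra_simps)
    also have "\<dots> = (\<Sum>i\<in>V. \<Sum>j\<in>V. w i j * \<bar>h i - h j\<bar>) + 2 * m * (\<Sum>i\<in>S. \<Sum>j\<in>V - S. w i j)"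
      by (simp only: sum.distrib flip: sum_distrib_left) (simp add: ofb ofb')
    finally have sw: "(\<Sum>i\<in>V. \<Sum>j\<in>V. w i j * \<bar>g i - g j\<bar>) =
      (\<Sum>i\<in>V. \<Sum>j\<in>V. w i j * \<bar>h i - h j\<bar>) + 2 * m * (\<Sum>i\<in>S. \<Sum>j\<in>V - S. w i j)" .
    have "\<kappa> * card S \<le> (\<Sum>i\<in>S. \<Sum>j\<in>V - S. w i j)"
      using S less.prems(2) by (intro cut) (auto simp: S_def)
    then have "2 * m * (\<kappa> * card S) \<le> 2 * m * (\<Sum>i\<in>S. \<Sum>j\<in>V - S. w i j)"
      using m_pos by (intro mult_left_mono) auto
    then show ?thesis using IH unfolding sg sw by (simp add: algebra_simps)
  qed
qed

text \<open>The least value with at most half of the points strictly above it is a median: if more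
  than half lay strictly below it, the largest value among those would have at most half above it as
  well.\<close>

lemma exists_median:
  fixes y :: "'v \<Rightarrow> real"
  assumes fin: "finite V"
  shows "\<exists>c. 2 * card {i\<in>V. c < y i} \<le> card V \<and> 2 * card {i\<in>V. y i < c} \<le> card V"
proof (cases "V = {}")
  case False
  define C where "C = {c \<in> y ` V. 2 * card {i\<in>V. c < y i} \<le> card V}"
  have "Max (y ` V) \<in> C"
  proof -
    have "y i \<le> Max (y ` V)" if "i \<in> V" for i using that fin by simp
    then have "{i\<in>V. Max (y ` V) < y i} = {}" by force
    then have "card {i\<in>V. Max (y ` V) < y i} = 0" by (simp only: card.empty)
    then show ?thesis using fin False unfolding C_def by (simp only: mem_Collect_eq) simp
  qed
  moreover have finC: "finite C" using fin by (auto simp: C_def)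
  ultimately have c: "Min C \<in> C" by (intro Min_in) auto
  have "2 * card {i\<in>V. y i < Min C} \<le> card V"
  proof (rule ccontr)
    assume neg: "\<not> ?thesis"
    define D where "D = {i\<in>V. y i < Min C}"
    have "D \<noteq> {}" using neg unfolding D_def by (metis card.empty mult_0_right zero_le)
    then have D: "finite D" "D \<noteq> {}" using fin by (auto simp: D_def)
    define c' where "c' = Max (y ` D)"
    have c': "c' \<in> y ` D" unfolding c'_def using D by (intro Max_in) auto
    have "{i\<in>V. c' < y i} \<subseteq> V - D" using D by (auto simp: c'_def)
    then have "card {i\<in>V. c' < y i} \<le> card (V - D)" using fin by (intro card_mono) auto
    also have "\<dots> = card V - card D" using fin by (intro card_Diff_subset) (auto simp: D_def)
    finally have "c' \<in> C" using c' neg by (auto simp: C_def D_def)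
    then have "Min C \<le> c'" using finC by simp
    then show False using c' by (auto simp: D_def)
  qed
  then show ?thesis using c by (auto simp: C_def)
qed auto

text \<open>Co-area applied to the square of \<open>f\<close>: its superlevel sets lie in the
  support, at most half of \<open>V\<close>, so the cut bound covers all of them. The difference of
  squares then factors as difference times sum, and a weighted arithmetic-geometric mean replaces
  Cauchy-Schwarz, which keeps every step linear in the energy and the squared norm.\<close>

lemma cheeger_half:
  fixes w :: "'v \<Rightarrow> 'v \<Rightarrow> real" and f :: "'v \<Rightarrow> real" and \<kappa> d :: real
  assumes fin: "finite V" and kpos: "0 < \<kappa>" and dpos: "0 < d"
    and sym: "\<And>i j. i \<in> V \<Longrightarrow> j \<in> V \<Longrightarrow> w i j = w j i"
    and w0: "\<And>i j. i \<in> V \<Longrightarrow> j \<in> V \<Longrightarrow> 0 \<le> w i j"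
    and cut: "\<And>S. S \<subseteq> V \<Longrightarrow> 2 * card S \<le> card V \<Longrightarrow> \<kappa> * card S \<le> (\<Sum>i\<in>S. \<Sum>j\<in>V - S. w i j)"
    and deg: "\<And>i. i \<in> V \<Longrightarrow> (\<Sum>j\<in>V. w i j) \<le> d"
    and f0: "\<And>i. i \<in> V \<Longrightarrow> 0 \<le> f i"
    and supp: "2 * card {i\<in>V. 0 < f i} \<le> card V"
  shows "\<kappa>\<^sup>2 / d * (\<Sum>i\<in>V. (f i)\<^sup>2) \<le> (\<Sum>i\<in>V. \<Sum>j\<in>V. w i j * (f i - f j)\<^sup>2)"
proof -
  \<comment> \<open>With this weight the term \<open>1/\<theta> * (d * N + d * N)\<close> equals
    \<open>\<kappa> * N\<close>, exactly half of the left side, and can be absorbed.\<close>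
  define \<theta> where "\<theta> = 2 * d / \<kappa>"
  have th: "\<theta> > 0" using kpos dpos by (simp add: \<theta>_def)
  define Q where "Q = (\<Sum>i\<in>V. \<Sum>j\<in>V. w i j * (f i - f j)\<^sup>2)"
  define N where "N = (\<Sum>i\<in>V. (f i)\<^sup>2)"
  have supp': "{i\<in>V. 0 < (f i)\<^sup>2} = {i\<in>V. 0 < f i}" using f0 by force
  have supp2: "2 * card {i\<in>V. 0 < (f i)\<^sup>2} \<le> card V" unfolding supp' by (rule supp)
  have "2 * \<kappa> * N \<le> (\<Sum>i\<in>V. \<Sum>j\<in>V. w i j * \<bar>(f i)\<^sup>2 - (f j)\<^sup>2\<bar>)"
    unfolding N_def by (rule coarea_bound[OF fin sym cut _ supp2]) auto
  also have "\<dots> \<le> (\<Sum>i\<in>V. \<Sum>j\<in>V. w i j * (\<theta>/2 * (f i - f j)\<^sup>2 + 1/\<theta> * ((f i)\<^sup>2 + (f j)\<^sup>2)))"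
  proof (intro sum_mono mult_left_mono w0)
    fix i j
    define u v where "u = \<bar>f i - f j\<bar>" and "v = \<bar>f i + f j\<bar>"
    have "\<bar>(f i)\<^sup>2 - (f j)\<^sup>2\<bar> = u * v"
      by (simp add: u_def v_def power2_eq_square square_diff_square_factored abs_mult)
    moreover have "0 \<le> (\<theta> * u - v)\<^sup>2 / (2 * \<theta>)" using th by simp
    then have "u * v \<le> \<theta>/2 * u\<^sup>2 + 1/(2*\<theta>) * v\<^sup>2"
      using th by (simp add: power2_diff field_simps power2_eq_square)
    then have "u * v \<le> \<theta>/2 * (f i - f j)\<^sup>2 + 1/(2*\<theta>) * v\<^sup>2" by (simp add: u_def)
    moreover have "v\<^sup>2 \<le> 2 * ((f i)\<^sup>2 + (f j)\<^sup>2)"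
      using zero_le_power2[of "f i - f j"] by (simp add: v_def power2_eq_square algebra_simps)
    then have "1/(2*\<theta>) * v\<^sup>2 \<le> 1/\<theta> * ((f i)\<^sup>2 + (f j)\<^sup>2)"
      using th by (simp add: field_simps)
    ultimately show "\<bar>(f i)\<^sup>2 - (f j)\<^sup>2\<bar> \<le> \<theta>/2 * (f i - f j)\<^sup>2 + 1/\<theta> * ((f i)\<^sup>2 + (f j)\<^sup>2)"
      by linarith
  qed
  also have "\<dots> = \<theta>/2 * Q + 1/\<theta> * ((\<Sum>i\<in>V. \<Sum>j\<in>V. w i j * (f i)\<^sup>2) + (\<Sum>i\<in>V. \<Sum>j\<in>V. w i j * (f j)\<^sup>2))"
    unfolding Q_def by (simp add: algebra_simps sum.distrib sum_distrib_left)
  also have "(\<Sum>i\<in>V. \<Sum>j\<in>V. w i j * (f j)\<^sup>2) = (\<Sum>i\<in>V. \<Sum>j\<in>V. w i j * (f i)\<^sup>2)"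
    by (subst sum.swap, intro sum.cong refl) (simp add: sym)
  also have "(\<Sum>i\<in>V. \<Sum>j\<in>V. w i j * (f i)\<^sup>2) \<le> d * N"
  proof -
    have "(\<Sum>i\<in>V. \<Sum>j\<in>V. w i j * (f i)\<^sup>2) = (\<Sum>i\<in>V. (\<Sum>j\<in>V. w i j) * (f i)\<^sup>2)"
      by (simp add: sum_distrib_right)
    also have "\<dots> \<le> (\<Sum>i\<in>V. d * (f i)\<^sup>2)" by (intro sum_mono mult_right_mono deg) auto
    finally show ?thesis by (simp add: N_def sum_distrib_left)
  qed
  finally have "2 * \<kappa> * N \<le> \<theta>/2 * Q + 1/\<theta> * (d * N + d * N)" using th by (simp add: divide_simps mult_ac)
  then have "\<kappa> * N \<le> d / \<kappa> * Q" using kpos dpos by (simp add: \<theta>_def field_simps)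
  then show ?thesis using kpos dpos unfolding Q_def[symmetric] N_def[symmetric]
    by (simp add: field_simps power2_eq_square)
qed

text \<open>Shifting by a median splits \<open>y\<close> into a positive and a negative part, each
  supported on at most half of \<open>V\<close>. The energy runs over ordered pairs, so each edge
  counts twice; this is where the customary factor 1/2 of the inequality has gone.\<close>

lemma cheeger:
  fixes w :: "'v \<Rightarrow> 'v \<Rightarrow> real" and y :: "'v \<Rightarrow> real" and \<kappa> d :: real
  assumes fin: "finite V" and kpos: "0 < \<kappa>" and dpos: "0 < d"
    and sym: "\<And>i j. i \<in> V \<Longrightarrow> j \<in> V \<Longrightarrow> w i j = w j i"
    and w0: "\<And>i j. i \<in> V \<Longrightarrow> j \<in> V \<Longrightarrow> 0 \<le> w i j"
    and cut: "\<And>S. S \<subseteq> V \<Longrightarrow> 2 * card S \<le> card V \<Longrightarrow> \<kappa> * card S \<le> (\<Sum>i\<in>S. \<Sum>j\<in>V - S. w i j)"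
    and deg: "\<And>i. i \<in> V \<Longrightarrow> (\<Sum>j\<in>V. w i j) \<le> d"
    and mean0: "(\<Sum>i\<in>V. y i) = 0"
  shows "\<kappa>\<^sup>2 / d * (\<Sum>i\<in>V. (y i)\<^sup>2) \<le> (\<Sum>i\<in>V. \<Sum>j\<in>V. w i j * (y i - y j)\<^sup>2)"
proof -
  obtain c where c: "2 * card {i\<in>V. c < y i} \<le> card V" "2 * card {i\<in>V. y i < c} \<le> card V"
    using exists_median[OF fin] by blast
  define f where "f i = max 0 (y i - c)" for i
  define g where "g i = max 0 (c - y i)" for i
  have sf: "{i\<in>V. 0 < f i} = {i\<in>V. c < y i}" and sg: "{i\<in>V. 0 < g i} = {i\<in>V. y i < c}"
    by (auto simp: f_def g_def)
  have F: "\<kappa>\<^sup>2 / d * (\<Sum>i\<in>V. (f i)\<^sup>2) \<le> (\<Sum>i\<in>V. \<Sum>j\<in>V. w i j * (f i - f j)\<^sup>2)"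
    by (rule cheeger_half[OF fin kpos dpos sym w0 cut deg _ c(1)[folded sf]]) (auto simp: f_def)
  have G: "\<kappa>\<^sup>2 / d * (\<Sum>i\<in>V. (g i)\<^sup>2) \<le> (\<Sum>i\<in>V. \<Sum>j\<in>V. w i j * (g i - g j)\<^sup>2)"
    by (rule cheeger_half[OF fin kpos dpos sym w0 cut deg _ c(2)[folded sg]]) (auto simp: g_def)
  \<comment> \<open>Among all shifts the mean minimises the squared norm, so moving from mean zero
    to the median can only increase it.\<close>
  have "(\<Sum>i\<in>V. (y i - c)\<^sup>2) = (\<Sum>i\<in>V. (y i)\<^sup>2) - 2 * c * (\<Sum>i\<in>V. y i) + c\<^sup>2 * card V"
    by (simp add: power2_diff sum.distrib sum_subtractf flip: sum_distrib_left sum_distrib_right)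
  then have "(\<Sum>i\<in>V. (y i)\<^sup>2) \<le> (\<Sum>i\<in>V. (y i - c)\<^sup>2)" using mean0 by simp
  also have "\<dots> = (\<Sum>i\<in>V. (f i)\<^sup>2 + (g i)\<^sup>2)"
    by (intro sum.cong refl) (auto simp: f_def g_def max_def power2_commute)
  finally have le: "(\<Sum>i\<in>V. (y i)\<^sup>2) \<le> (\<Sum>i\<in>V. (f i)\<^sup>2) + (\<Sum>i\<in>V. (g i)\<^sup>2)" by (simp add: sum.distrib)
  have pt: "(f i - f j)\<^sup>2 + (g i - g j)\<^sup>2 \<le> (y i - y j)\<^sup>2" for i j
  proof -
    have y: "y i - y j = (f i - f j) - (g i - g j)" by (auto simp: f_def g_def max_def)
    \<comment> \<open>\<open>f\<close> is nondecreasing and \<open>g\<close> nonincreasing in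
      \<open>y\<close>, so their increments have opposite signs.\<close>
    have "(f i - f j) * (g i - g j) \<le> 0"
      by (auto simp: f_def g_def max_def mult_le_0_iff)
    then show ?thesis unfolding y by (simp add: power2_eq_square algebra_simps)
  qed
  have "\<kappa>\<^sup>2 / d * (\<Sum>i\<in>V. (y i)\<^sup>2) \<le> \<kappa>\<^sup>2 / d * ((\<Sum>i\<in>V. (f i)\<^sup>2) + (\<Sum>i\<in>V. (g i)\<^sup>2))"
    using le kpos dpos by (intro mult_left_mono) auto
  also have "\<dots> \<le> (\<Sum>i\<in>V. \<Sum>j\<in>V. w i j * (f i - f j)\<^sup>2) + (\<Sum>i\<in>V. \<Sum>j\<in>V. w i j * (g i - g j)\<^sup>2)"
    using F G by (simp add: ring_distribs)
  also have "\<dots> = (\<Sum>i\<in>V. \<Sum>j\<in>V. w i j * ((f i - f j)\<^sup>2 + (g i - g j)\<^sup>2))"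
    by (simp add: sum.distrib ring_distribs)
  also have "\<dots> \<le> (\<Sum>i\<in>V. \<Sum>j\<in>V. w i j * (y i - y j)\<^sup>2)"
    by (intro sum_mono mult_left_mono pt w0)
  finally show ?thesis .
qed

section \<open>Potentials on block graphs with expansion\<close>

text \<open>The two communities are \<open>{..<h}\<close> and \<open>{h..<2 * h}\<close>; \<open>a\<close> and \<open>b\<close> stand for \<open>p\<^sub>w\<close> and \<open>p\<^sub>b\<close>.
  The cut bounds are half, and the degree bounds three times, what the means guarantee.\<close>

definition regular_graph :: "nat \<Rightarrow> real \<Rightarrow> real \<Rightarrow> (nat \<Rightarrow> nat \<Rightarrow> real) \<Rightarrow> bool" where
  "regular_graph h a b \<phi> \<longleftrightarrow>
     (\<forall>S\<subseteq>{..<2*h}. 2 * card S \<le> 2 * h \<longrightarrow>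
        real (2*h) * b / 8 * card S \<le> (\<Sum>i\<in>S. \<Sum>j\<in>{..<2*h} - S. \<phi> i j)) \<and>
     (\<forall>B\<in>{{..<h}, {h..<2*h}}.
        (\<forall>S\<subseteq>B. 2 * card S \<le> card B \<longrightarrow>
           real (2*h) * a / 8 * card S \<le> (\<Sum>i\<in>S. \<Sum>j\<in>B - S. \<phi> i j)) \<and>
        (\<forall>i\<in>B. (\<Sum>j\<in>B. \<phi> i j) \<le> 3/2 * (real (2*h) * a) \<and>
                (\<Sum>j\<in>{..<2*h} - B. \<phi> i j) \<le> 3/2 * (real (2*h) * b)))"

lemma regular_graphD:
  assumes "regular_graph h a b \<phi>"
  shows "S \<subseteq> {..<2*h} \<Longrightarrow> 2 * card S \<le> card {..<2*h} \<Longrightarrow>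
      real (2*h) * b / 8 * card S \<le> (\<Sum>i\<in>S. \<Sum>j\<in>{..<2*h} - S. \<phi> i j)"
    and "B \<in> {{..<h}, {h..<2*h}} \<Longrightarrow> S \<subseteq> B \<Longrightarrow> 2 * card S \<le> card B \<Longrightarrow>
      real (2*h) * a / 8 * card S \<le> (\<Sum>i\<in>S. \<Sum>j\<in>B - S. \<phi> i j)"
    and "B \<in> {{..<h}, {h..<2*h}} \<Longrightarrow> i \<in> B \<Longrightarrow> (\<Sum>j\<in>B. \<phi> i j) \<le> 3/2 * (real (2*h) * a)"
    and "B \<in> {{..<h}, {h..<2*h}} \<Longrightarrow> i \<in> B \<Longrightarrow>
      (\<Sum>j\<in>{..<2*h} - B. \<phi> i j) \<le> 3/2 * (real (2*h) * b)"
  using assms unfolding regular_graph_def card_lessThan by blast+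

text \<open>Swapping the two summations shows that the Laplacian is self-adjoint and that its
  quadratic form is the edge energy; the factor 2 again reflects ordered pairs.\<close>

lemma laplacian_energy:
  fixes \<phi> :: "'v \<Rightarrow> 'v \<Rightarrow> real"
  assumes sym: "\<And>i j. i \<in> V \<Longrightarrow> j \<in> V \<Longrightarrow> \<phi> i j = \<phi> j i"
  shows "(\<Sum>i\<in>V. t i * (\<Sum>j\<in>V. \<phi> i j * (x i - x j))) = (\<Sum>i\<in>V. x i * (\<Sum>j\<in>V. \<phi> i j * (t i - t j)))"
    and "(\<Sum>i\<in>V. \<Sum>j\<in>V. \<phi> i j * (x i - x j)\<^sup>2) = 2 * (\<Sum>i\<in>V. x i * (\<Sum>j\<in>V. \<phi> i j * (x i - x j)))"
proof -
  have sw: "(\<Sum>i\<in>V. \<Sum>j\<in>V. \<phi> i j * (f i * g j)) = (\<Sum>i\<in>V. \<Sum>j\<in>V. \<phi> i j * (f j * g i))"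
    for f g :: "'v \<Rightarrow> real"
    by (subst sum.swap, intro sum.cong refl) (simp add: sym)
  have ex: "(\<Sum>i\<in>V. f i * (\<Sum>j\<in>V. \<phi> i j * (g i - g j))) =
     (\<Sum>i\<in>V. \<Sum>j\<in>V. \<phi> i j * (f i * g i)) - (\<Sum>i\<in>V. \<Sum>j\<in>V. \<phi> i j * (f i * g j))"
    for f g :: "'v \<Rightarrow> real"
    by (simp add: sum_distrib_left sum_subtractf[symmetric] algebra_simps)
  show "(\<Sum>i\<in>V. t i * (\<Sum>j\<in>V. \<phi> i j * (x i - x j))) = (\<Sum>i\<in>V. x i * (\<Sum>j\<in>V. \<phi> i j * (t i - t j)))"
    unfolding ex using sw[of t x] by (simp add: mult.commute)
  have "(\<Sum>i\<in>V. \<Sum>j\<in>V. \<phi> i j * (x i - x j)\<^sup>2) =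
    (\<Sum>i\<in>V. \<Sum>j\<in>V. \<phi> i j * (x i * x i)) + (\<Sum>i\<in>V. \<Sum>j\<in>V. \<phi> i j * (1 * (x j * x j)))
      - 2 * (\<Sum>i\<in>V. \<Sum>j\<in>V. \<phi> i j * (x i * x j))"
    unfolding sum_distrib_left sum.distrib[symmetric] sum_subtractf[symmetric]
    by (intro sum.cong refl) (simp add: power2_eq_square algebra_simps)
  then show "(\<Sum>i\<in>V. \<Sum>j\<in>V. \<phi> i j * (x i - x j)\<^sup>2) = 2 * (\<Sum>i\<in>V. x i * (\<Sum>j\<in>V. \<phi> i j * (x i - x j)))"
    unfolding ex using sw[of "\<lambda>_. 1" "\<lambda>i. x i * x i"] by simp
qed

lemma sum_times_indicator_diff:
  fixes f :: "'v \<Rightarrow> real"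
  assumes "finite V" "u \<in> V" "v \<in> V"
  shows "(\<Sum>i\<in>V. f i * (of_bool (i = u) - of_bool (i = v))) = f u - f v"
proof -
  have "(\<Sum>i\<in>V. f i * of_bool (i = w)) = f w" if "w \<in> V" for w
    using that assms(1) by (subst sum.remove) (auto intro!: sum.neutral)
  then show ?thesis using assms by (simp only: right_diff_distrib sum_subtractf)
qed

lemma abs_diff_le_norm:
  fixes x :: "'v \<Rightarrow> real"
  assumes "finite V" "u \<in> V" "v \<in> V"
  shows "\<bar>x u - x v\<bar> \<le> 2 * sqrt (\<Sum>i\<in>V. (x i)\<^sup>2)"
proof -
  have le: "\<bar>x i\<bar> \<le> sqrt (\<Sum>i\<in>V. (x i)\<^sup>2)" if "i \<in> V" for i
    using member_le_sum[OF that, of "\<lambda>i. (x i)\<^sup>2"] assms(1)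
    by (intro real_le_rsqrt) simp
  show ?thesis using le[OF assms(2)] le[OF assms(3)] by linarith
qed

text \<open>Beyond the bound both \<open>L * Y > \<beta> + 1\<close> and \<open>Y > r\<close>, so
  \<open>L * Y^2\<close> exceeds \<open>\<beta> * Y + Y\<close>, hence
  \<open>\<beta> * Y + r\<close>. Cruder than solving the quadratic, but linear in \<open>r\<close>
  and free of roots.\<close>

lemma quadratic_bound:
  fixes Y :: real
  assumes "0 < L" "0 \<le> \<beta>" "0 \<le> r" "L * Y\<^sup>2 \<le> \<beta> * Y + r"
  shows "Y \<le> (\<beta> + 1) / L + r"
proof (rule ccontr)
  assume "\<not> ?thesis"
  then have neg: "(\<beta> + 1) / L + r < Y" by simp
  have div: "0 < (\<beta> + 1) / L" using assms by simp
  have Y: "r < Y" "0 < Y" using neg div assms(3) by linarith+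
  have "(\<beta> + 1) / L < Y" using neg assms(3) by linarith
  then have "\<beta> + 1 < L * Y" using assms(1) by (simp add: field_simps)
  then have "(\<beta> + 1) * Y < L * Y * Y" using Y by (intro mult_strict_right_mono)
  then show False using assms(4) Y by (simp add: power2_eq_square algebra_simps)
qed

text \<open>For \<open>a \<le> b\<close> the cut ratio \<open>n * b / 8\<close> and the degree bound
  \<open>3 * (n * b)\<close> have the same order, so Cheeger loses only a constant: the gap is
  \<open>n * b / 192\<close>.\<close>

lemma potential_bound_sparse_within:
  fixes \<phi> :: "nat \<Rightarrow> nat \<Rightarrow> real"
  assumes reg: "regular_graph h a b \<phi>" and h: "0 < h" and a: "0 < a" and ab: "a \<le> b"
    and sym: "\<And>i j. i < 2*h \<Longrightarrow> j < 2*h \<Longrightarrow> \<phi> i j = \<phi> j i"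
    and nonneg: "\<And>i j. i < 2*h \<Longrightarrow> j < 2*h \<Longrightarrow> 0 \<le> \<phi> i j"
    and energy: "(\<Sum>i<2*h. \<Sum>j<2*h. \<phi> i j * (x i - x j)\<^sup>2) \<le> 4 * sqrt (\<Sum>i<2*h. (x i)\<^sup>2)"
    and mean0: "(\<Sum>i<2*h. x i) = 0"
  shows "sqrt (\<Sum>i<2*h. (x i)\<^sup>2) \<le> 2000 / (real (2*h) * (a + b))"
proof -
  define n where "n = real (2*h)"
  have n: "n > 0" using h by (simp add: n_def)
  have b: "b > 0" using a ab by simp
  define N where "N = (\<Sum>i<2*h. (x i)\<^sup>2)"
  have N0: "N \<ge> 0" by (auto simp: N_def intro: sum_nonneg)
  have deg: "(\<Sum>j\<in>{..<2*h}. \<phi> i j) \<le> 3 * (n * b)" if i: "i \<in> {..<2*h}" for i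
  proof -
    define B where "B = (if i < h then {..<h} else {h..<2*h})"
    have B: "B \<in> {{..<h}, {h..<2*h}}" "i \<in> B" using i by (simp_all add: B_def)
    have sub: "B \<subseteq> {..<2*h}" by (auto simp: B_def)
    have "(\<Sum>j\<in>{..<2*h}. \<phi> i j) = (\<Sum>j\<in>B. \<phi> i j) + (\<Sum>j\<in>{..<2*h} - B. \<phi> i j)"
      using sum.subset_diff[OF sub, of "\<phi> i"] by simp
    also have "\<dots> \<le> 3/2 * (n * a) + 3/2 * (n * b)"
      unfolding n_def by (intro add_mono regular_graphD(3,4)[OF reg B])
    also have "\<dots> \<le> 3 * (n * b)" using mult_left_mono[OF ab less_imp_le[OF n]] by linarith
    finally show ?thesis .
  qed
  have "(n * b / 8)\<^sup>2 / (3 * (n * b)) * (\<Sum>i\<in>{..<2*h}. (x i)\<^sup>2)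
      \<le> (\<Sum>i\<in>{..<2*h}. \<Sum>j\<in>{..<2*h}. \<phi> i j * (x i - x j)\<^sup>2)"
    unfolding n_def
    by (rule cheeger[OF _ _ _ sym nonneg regular_graphD(1)[OF reg] deg[unfolded n_def] mean0])
      (use n b in \<open>auto simp: n_def\<close>)
  also have "\<dots> \<le> 4 * sqrt N" using energy by (simp add: N_def)
  finally have "n * b / 192 * N \<le> 4 * sqrt N"
    using n b by (simp add: N_def power2_eq_square field_simps)
  then have "n * b / 192 * (sqrt N)\<^sup>2 \<le> 4 * sqrt N + 0" using N0 by simp
  then have "sqrt N \<le> (4 + 1) / (n * b / 192) + 0" using n b by (intro quadratic_bound) auto
  also have "\<dots> = 1920 / (n * (b + b))" using n b by (simp add: field_simps)
  also have "\<dots> \<le> 2000 / (n * (a + b))"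
    using n a b ab by (intro frac_le mult_left_mono) auto
  finally show ?thesis by (simp add: N_def n_def)
qed

text \<open>Closes a system of two unknowns: \<open>Y\<close> is the norm of \<open>y\<close>,
  \<open>m\<close> is \<open>|\<mu>|\<close>, and \<open>X\<close> is the norm of \<open>x\<close>.
  Pairing with \<open>t\<close> bounds \<open>sqrt n * m\<close> by \<open>8 * r + 12 * Y\<close>;
  inserted into the energy bound, this leaves a quadratic inequality in \<open>Y\<close>
  alone.\<close>

lemma dense_within_arith:
  fixes n a b Y m X :: real
  assumes n: "1 \<le> n" and a: "0 < a" and b: "0 < b" and ba: "b \<le> a" and Y: "0 \<le> Y"
    and m: "m * (n\<^sup>2 * b / 4) \<le> 2 + 3 * (n * b) * (sqrt n * Y)"
    and energy: "n * a / 96 * Y\<^sup>2 \<le> 4 * Y + 4 * m"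
    and X: "X \<le> sqrt n * m + Y"
  shows "X \<le> 140000 / (n * (a + b)) + 500 / (n * sqrt n * b)"
proof -
  define w where "w = sqrt n"
  have w: "w \<ge> 1" and n_eq: "n = w\<^sup>2" using n by (simp_all add: w_def)
  define r where "r = 1 / (w ^ 3 * b)"
  have r: "r \<ge> 0" using w b by (simp add: r_def)
  have "w * (w ^ 3 * b) * m \<le> 8 + 12 * (w ^ 3 * b) * Y"
    using m unfolding w_def[symmetric] unfolding n_eq by (simp add: power2_eq_square power3_eq_cube algebra_simps)
  then have "(w * (w ^ 3 * b) * m) / (w ^ 3 * b) \<le> (8 + 12 * (w ^ 3 * b) * Y) / (w ^ 3 * b)"
    using w b by (intro divide_right_mono) auto
  then have wm: "w * m \<le> 8 * r + 12 * Y"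
    using w b by (simp add: r_def add_divide_distrib)
  \<comment> \<open>The energy bound contains \<open>m\<close> without the factor
    \<open>sqrt n\<close>, so the estimate of \<open>w * m\<close> is more than enough
    there.\<close>
  have mle: "m \<le> 8 * r + 12 * Y"
  proof (cases "0 \<le> m")
    case True
    then have "1 * m \<le> w * m" using w by (intro mult_right_mono)
    then show ?thesis using wm by simp
  next
    case False
    moreover have "0 \<le> 8 * r + 12 * Y" using r Y by simp
    ultimately show ?thesis by linarith
  qed
  have "n * a / 96 * Y\<^sup>2 \<le> 52 * Y + 32 * r" using energy mle by linarith
  then have "Y \<le> (52 + 1) / (n * a / 96) + 32 * r"
    using n a r by (intro quadratic_bound) auto
  also have "(52 + 1) / (n * a / 96) = 10176 / (n * (a + a))" using n a by (simp add: field_simps)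
  also have "10176 / (n * (a + a)) \<le> 10176 / (n * (a + b))"
    using n a b ba by (intro divide_left_mono mult_left_mono mult_pos_pos) auto
  finally have Yle: "Y \<le> 10176 / (n * (a + b)) + 32 * r" by simp
  define q where "q = 1 / (n * (a + b))"
  have q: "q \<ge> 0" using n a b by (simp add: q_def)
  have Yle': "Y \<le> 10176 * q + 32 * r" using Yle by (simp add: q_def)
  have "X \<le> w * m + Y" using X by (simp add: w_def)
  \<comment> \<open>Here \<open>X \<le> 8 * r + 13 * Y\<close>, with
    \<open>13 * 10176 = 132288\<close> and \<open>8 + 13 * 32 = 424\<close>.\<close>
  then have "X \<le> 140000 * q + 500 * r" using wm Yle' q r by linarith
  moreover have "r = 1 / (n * sqrt n * b)"
    unfolding r_def w_def[symmetric] by (simp add: n_eq power2_eq_square power3_eq_cube)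
  ultimately show ?thesis by (simp add: q_def)
qed

text \<open>The Rayleigh quotient of \<open>t\<close> is only of order \<open>n * b\<close>, while
  vectors with zero sum on each community have energy of order at least \<open>n * a\<close>.
  Cheeger is therefore used inside each community, where cuts and degrees are both of order
  \<open>n * a\<close>, and the single slow direction is treated by hand.\<close>

lemma potential_bound_dense_within:
  fixes \<phi> :: "nat \<Rightarrow> nat \<Rightarrow> real"
  assumes reg: "regular_graph h a b \<phi>" and h: "0 < h" and a: "0 < a" and b: "0 < b" and ba: "b \<le> a"
    and sym: "\<And>i j. i < 2*h \<Longrightarrow> j < 2*h \<Longrightarrow> \<phi> i j = \<phi> j i"
    and nonneg: "\<And>i j. i < 2*h \<Longrightarrow> j < 2*h \<Longrightarrow> 0 \<le> \<phi> i j"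
    and uv: "u < 2*h" "v < 2*h" "u \<noteq> v"
    and lap: "\<And>i. i < 2*h \<Longrightarrow> (\<Sum>j<2*h. \<phi> i j * (x i - x j)) = of_bool (i = u) - of_bool (i = v)"
    and mean0: "(\<Sum>i<2*h. x i) = 0"
  shows "sqrt (\<Sum>i<2*h. (x i)\<^sup>2) \<le>
     140000 / (real (2*h) * (a + b)) + 500 / (real (2*h) * sqrt (real (2*h)) * b)"
proof -
  define n where "n = real (2*h)"
  have n: "n > 0" "n \<ge> 1" using h by (auto simp: n_def)
  define B1 B2 where "B1 = {..<h}" and "B2 = {h..<2*h}"
  have V: "{..<2*h} = B1 \<union> B2" "B1 \<inter> B2 = {}" and fB: "finite B1" "finite B2"
    by (auto simp: B1_def B2_def)
  define t where "t i = (if i < h then 1 else - 1 :: real)" for i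
  \<comment> \<open>\<open>x\<close> sums to \<open>h * \<mu>\<close> on the first community and,
    having total zero, to \<open>- h * \<mu>\<close> on the second; subtracting
    \<open>\<mu> * t\<close> balances both.\<close>
  define \<mu> where "\<mu> = (\<Sum>i\<in>B1. x i) / h"
  define y where "y i = x i - \<mu> * t i" for i
  have split: "sum f {..<2*h} = sum f B1 + sum f B2" for f :: "nat \<Rightarrow> real"
    unfolding V(1) using V(2) fB by (intro sum.union_disjoint) auto
  have sB1: "(\<Sum>i\<in>B1. y i) = 0"
    using h by (simp add: y_def sum_subtractf \<mu>_def t_def B1_def)
  have "(\<Sum>i\<in>B2. x i) = - (\<Sum>i\<in>B1. x i)" using mean0 split[of x] by simp
  then have sB2: "(\<Sum>i\<in>B2. y i) = 0"
    using h by (simp add: y_def sum.distrib \<mu>_def t_def B2_def)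
  define Y where "Y = sqrt (\<Sum>i<2*h. (y i)\<^sup>2)"
  have Y2: "(\<Sum>i<2*h. (y i)\<^sup>2) = Y\<^sup>2" by (simp add: Y_def sum_nonneg)
  have Y0: "Y \<ge> 0" by (simp add: Y_def sum_nonneg)
  have lap': "(\<Sum>i<2*h. f i * (\<Sum>j<2*h. \<phi> i j * (x i - x j))) = f u - f v" for f
  proof -
    have "(\<Sum>i<2*h. f i * (\<Sum>j<2*h. \<phi> i j * (x i - x j))) =
      (\<Sum>i<2*h. f i * (of_bool (i = u) - of_bool (i = v)))"
      by (intro sum.cong refl) (subst lap, simp_all)
    then show ?thesis using uv by (simp add: sum_times_indicator_diff del: sum_mult_of_bool_eq)
  qed
  \<comment> \<open>The degree of \<open>i\<close> into the opposite community. The Laplacian sends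
    \<open>t\<close> to \<open>2 * t i * e i\<close>, since \<open>t\<close> changes only across
    communities.\<close>
  define e where "e i = (\<Sum>j\<in>(if i < h then B2 else B1). \<phi> i j)" for i
  have e_le: "0 \<le> e i \<and> e i \<le> 3/2 * (n * b)" if "i < 2*h" for i
  proof -
    have "{..<2*h} - B1 = B2" "{..<2*h} - B2 = B1" using V by auto
    then have "e i \<le> 3/2 * (n * b)"
      using that regular_graphD(4)[OF reg, of B1 i] regular_graphD(4)[OF reg, of B2 i]
      by (cases "i < h") (simp_all add: e_def n_def B1_def B2_def)
    moreover have "0 \<le> e i" unfolding e_def
      using that nonneg by (intro sum_nonneg) (auto simp: B1_def B2_def split: if_splits)
    ultimately show ?thesis by simp
  qed
  have e_sum: "n\<^sup>2 * b / 16 \<le> (\<Sum>i\<in>B1. e i)"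
  proof -
    \<comment> \<open>The cut bound is applied to a whole community, which has exactly half of the
      vertices and so is still admissible.\<close>
    have "real (2*h) * b / 8 * card B1 \<le> (\<Sum>i\<in>B1. \<Sum>j\<in>{..<2*h} - B1. \<phi> i j)"
      unfolding B1_def by (intro regular_graphD(1)[OF reg]) auto
    moreover have "{..<2*h} - B1 = B2" using V by auto
    ultimately show ?thesis by (simp add: e_def B1_def n_def power2_eq_square)
  qed
  have e_sum2: "n\<^sup>2 * b / 8 \<le> (\<Sum>i<2*h. e i)"
  proof -
    have "(\<Sum>i\<in>B2. e i) = (\<Sum>i\<in>B2. \<Sum>j\<in>B1. \<phi> i j)" by (auto simp: e_def B2_def intro!: sum.cong)
    also have "\<dots> = (\<Sum>i\<in>B1. \<Sum>j\<in>B2. \<phi> i j)"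
      by (subst sum.swap) (auto simp: B1_def B2_def sym intro!: sum.cong)
    also have "\<dots> = (\<Sum>i\<in>B1. e i)" by (auto simp: e_def B1_def intro!: sum.cong)
    finally show ?thesis using e_sum split[of e] by simp
  qed
  have Lt: "(\<Sum>j<2*h. \<phi> i j * (t i - t j)) = 2 * t i * e i" if "i < 2*h" for i
    unfolding split by (auto simp: t_def e_def B1_def B2_def sum_distrib_left mult.commute)
  have tt: "t i * t i = 1" for i by (simp add: t_def)
  \<comment> \<open>Pairing the equation with \<open>t\<close> and moving the Laplacian onto
    \<open>t\<close> isolates \<open>\<mu>\<close>. The mixed term with \<open>y\<close> would
    vanish if all cross degrees \<open>e i\<close> were equal; as they fluctuate, it is bounded by
    Cauchy-Schwarz.\<close>
  have "t u - t v = (\<Sum>i<2*h. x i * (\<Sum>j<2*h. \<phi> i j * (t i - t j)))"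
    unfolding lap'[symmetric] using sym by (intro laplacian_energy(1)) auto
  also have "\<dots> = (\<Sum>i<2*h. (\<mu> * t i + y i) * (2 * t i * e i))"
    by (intro sum.cong refl) (simp add: Lt y_def)
  also have "\<dots> = (\<Sum>i<2*h. 2 * \<mu> * (t i * t i) * e i + 2 * t i * e i * y i)"
    by (intro sum.cong refl) (simp add: algebra_simps)
  also have "\<dots> = 2 * \<mu> * (\<Sum>i<2*h. e i) + (\<Sum>i<2*h. 2 * t i * e i * y i)"
    by (simp add: tt sum.distrib sum_distrib_left)
  finally have teq: "t u - t v = 2 * \<mu> * (\<Sum>i<2*h. e i) + (\<Sum>i<2*h. 2 * t i * e i * y i)" .
  have "\<bar>\<Sum>i<2*h. 2 * t i * e i * y i\<bar> \<le> (\<Sum>i<2*h. \<bar>2 * t i * e i * y i\<bar>)" by (rule sum_abs)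
  also have "\<dots> \<le> (\<Sum>i<2*h. 3 * (n * b) * \<bar>y i\<bar>)"
  proof (intro sum_mono)
    fix i assume "i \<in> {..<2*h}"
    then have "0 \<le> e i" "e i \<le> 3/2 * (n * b)" using e_le[of i] by auto
    then have "2 * e i * \<bar>y i\<bar> \<le> 3 * (n * b) * \<bar>y i\<bar>" by (intro mult_right_mono) auto
    then show "\<bar>2 * t i * e i * y i\<bar> \<le> 3 * (n * b) * \<bar>y i\<bar>"
      using \<open>0 \<le> e i\<close> by (simp add: abs_mult t_def)
  qed
  also have "\<dots> = 3 * (n * b) * (\<Sum>i<2*h. 1 * \<bar>y i\<bar>)" by (simp add: sum_distrib_left)
  also have "\<dots> \<le> 3 * (n * b) * (sqrt n * Y)"
  proof (intro mult_left_mono)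
    have "(\<Sum>i<2*h. 1 * \<bar>y i\<bar>)\<^sup>2 \<le> (\<Sum>i<2*h. 1\<^sup>2) * (\<Sum>i<2*h. \<bar>y i\<bar>\<^sup>2)"
      by (rule Cauchy_Schwarz_ineq_sum)
    also have "(\<Sum>i<2*h. 1\<^sup>2) = n" by (simp add: n_def)
    also have "(\<Sum>i<2*h. \<bar>y i\<bar>\<^sup>2) = Y\<^sup>2" by (simp add: Y2)
    also have "n * Y\<^sup>2 = (sqrt n * Y)\<^sup>2" using n(1) by (simp add: power_mult_distrib)
    finally have sq: "(\<Sum>i<2*h. 1 * \<bar>y i\<bar>)\<^sup>2 \<le> (sqrt n * Y)\<^sup>2" .
    have "0 \<le> sqrt n * Y" using Y0 n(1) by simp
    with sq show "(\<Sum>i<2*h. 1 * \<bar>y i\<bar>) \<le> sqrt n * Y" by (rule power2_le_imp_le)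
  qed (use n b in auto)
  finally have cross: "\<bar>\<Sum>i<2*h. 2 * t i * e i * y i\<bar> \<le> 3 * (n * b) * (sqrt n * Y)" .
  have "\<bar>2 * \<mu> * (\<Sum>i<2*h. e i)\<bar> \<le> 2 + 3 * (n * b) * (sqrt n * Y)"
  proof -
    have "\<bar>t u - t v\<bar> \<le> 2" by (simp add: t_def)
    then show ?thesis using teq cross by linarith
  qed
  moreover have "\<bar>\<mu>\<bar> * (n\<^sup>2 * b / 4) \<le> \<bar>2 * \<mu> * (\<Sum>i<2*h. e i)\<bar>"
  proof -
    have "\<bar>\<mu>\<bar> * (2 * (n\<^sup>2 * b / 8)) \<le> \<bar>\<mu>\<bar> * (2 * (\<Sum>i<2*h. e i))"
      using e_sum2 by (intro mult_left_mono) auto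
    also have "\<dots> = \<bar>2 * \<mu> * (\<Sum>i<2*h. e i)\<bar>"
    proof -
      have "0 \<le> n\<^sup>2 * b / 8" using b by simp
      then have "0 \<le> (\<Sum>i<2*h. e i)" using e_sum2 by linarith
      then show ?thesis by (simp add: abs_mult)
    qed
    finally show ?thesis by (simp add: algebra_simps)
  qed
  ultimately have mu: "\<bar>\<mu>\<bar> * (n\<^sup>2 * b / 4) \<le> 2 + 3 * (n * b) * (sqrt n * Y)" by linarith
  have block: "n * a / 96 * (\<Sum>i\<in>B. (y i)\<^sup>2) \<le> (\<Sum>i\<in>B. \<Sum>j\<in>B. \<phi> i j * (x i - x j)\<^sup>2)"
    if B: "B \<in> {B1, B2}" for B
  proof -
    have "(n * a / 8)\<^sup>2 / (3/2 * (n * a)) * (\<Sum>i\<in>B. (y i)\<^sup>2)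
        \<le> (\<Sum>i\<in>B. \<Sum>j\<in>B. \<phi> i j * (y i - y j)\<^sup>2)"
    proof (rule cheeger)
      fix S assume "S \<subseteq> B" "2 * card S \<le> card B"
      then show "n * a / 8 * card S \<le> (\<Sum>i\<in>S. \<Sum>j\<in>B - S. \<phi> i j)"
        using regular_graphD(2)[OF reg, of B S] B unfolding n_def B1_def B2_def by blast
    next
      fix i assume "i \<in> B"
      then show "(\<Sum>j\<in>B. \<phi> i j) \<le> 3/2 * (n * a)"
        using regular_graphD(3)[OF reg, of B i] B unfolding n_def B1_def B2_def by blast
    qed (use n a B sB1 sB2 sym nonneg in \<open>auto simp: B1_def B2_def\<close>)
    \<comment> \<open>\<open>t\<close> is constant on a community, so \<open>x\<close> and
      \<open>y\<close> have the same differences there.\<close>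
    also have "(\<Sum>i\<in>B. \<Sum>j\<in>B. \<phi> i j * (y i - y j)\<^sup>2) = (\<Sum>i\<in>B. \<Sum>j\<in>B. \<phi> i j * (x i - x j)\<^sup>2)"
      using B by (intro sum.cong refl) (auto simp: y_def t_def B1_def B2_def)
    finally show ?thesis using n a by (simp add: power2_eq_square field_simps)
  qed
  \<comment> \<open>The energy inside the communities is at most the full energy, which the equation
    evaluates as \<open>2 * (x u - x v)\<close>; writing \<open>x\<close> as
    \<open>\<mu> * t + y\<close> expresses this in the two unknowns.\<close>
  have "n * a / 96 * Y\<^sup>2 = n * a / 96 * (\<Sum>i\<in>B1. (y i)\<^sup>2) + n * a / 96 * (\<Sum>i\<in>B2. (y i)\<^sup>2)"
    unfolding Y2[symmetric] split by (simp add: algebra_simps)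
  also have "\<dots> \<le> (\<Sum>i\<in>B1. \<Sum>j\<in>B1. \<phi> i j * (x i - x j)\<^sup>2) + (\<Sum>i\<in>B2. \<Sum>j\<in>B2. \<phi> i j * (x i - x j)\<^sup>2)"
    by (intro add_mono block) auto
  also have "\<dots> \<le> (\<Sum>i\<in>B1. \<Sum>j<2*h. \<phi> i j * (x i - x j)\<^sup>2) + (\<Sum>i\<in>B2. \<Sum>j<2*h. \<phi> i j * (x i - x j)\<^sup>2)"
    by (intro add_mono sum_mono sum_mono2) (auto simp: B1_def B2_def nonneg)
  also have "\<dots> = (\<Sum>i<2*h. \<Sum>j<2*h. \<phi> i j * (x i - x j)\<^sup>2)" by (rule split[symmetric])
  also have "\<dots> = 2 * (x u - x v)"
    unfolding lap'[symmetric, of x] using sym by (intro laplacian_energy(2)) auto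
  also have "x u - x v = (y u - y v) + \<mu> * (t u - t v)" by (simp add: y_def algebra_simps)
  also have "2 * \<dots> \<le> 2 * (2 * Y + 2 * \<bar>\<mu>\<bar>)"
  proof -
    have "\<bar>y u - y v\<bar> \<le> 2 * Y" unfolding Y_def using uv by (intro abs_diff_le_norm) auto
    moreover have "\<mu> * (t u - t v) \<le> 2 * \<bar>\<mu>\<bar>"
    proof -
      have "\<bar>\<mu>\<bar> * \<bar>t u - t v\<bar> \<le> \<bar>\<mu>\<bar> * 2" by (intro mult_left_mono) (simp_all add: t_def)
      moreover have "\<mu> * (t u - t v) \<le> \<bar>\<mu>\<bar> * \<bar>t u - t v\<bar>"
        by (metis abs_ge_self abs_mult)
      ultimately show ?thesis by linarith
    qed
    moreover have "y u - y v \<le> \<bar>y u - y v\<bar>" by simp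
    ultimately have "y u - y v + \<mu> * (t u - t v) \<le> 2 * Y + 2 * \<bar>\<mu>\<bar>" by linarith
    then show ?thesis by (rule mult_left_mono) simp
  qed
  finally have energy: "n * a / 96 * Y\<^sup>2 \<le> 4 * Y + 4 * \<bar>\<mu>\<bar>" by simp
  have norm: "sqrt (\<Sum>i<2*h. (x i)\<^sup>2) \<le> sqrt n * \<bar>\<mu>\<bar> + Y"
  proof -
    \<comment> \<open>\<open>y\<close> is orthogonal to \<open>t\<close>, and \<open>t\<close> has
      squared norm \<open>n\<close>.\<close>
    have "(\<Sum>i<2*h. (x i)\<^sup>2) = (\<Sum>i<2*h. (y i)\<^sup>2) + 2 * \<mu> * (\<Sum>i<2*h. t i * y i) + \<mu>\<^sup>2 * n"
    proof -
      have "(x i)\<^sup>2 = (y i)\<^sup>2 + 2 * \<mu> * (t i * y i) + \<mu>\<^sup>2 * (t i * t i)" for i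
        by (simp add: y_def power2_eq_square algebra_simps)
      then show ?thesis by (simp add: tt sum.distrib sum_distrib_left n_def)
    qed
    also have "(\<Sum>i<2*h. t i * y i) = (\<Sum>i\<in>B1. y i) - (\<Sum>i\<in>B2. y i)"
      unfolding split by (simp add: t_def B1_def B2_def sum_negf)
    finally have "(\<Sum>i<2*h. (x i)\<^sup>2) = Y\<^sup>2 + \<mu>\<^sup>2 * n" by (simp add: sB1 sB2 Y2)
    also have "\<dots> \<le> (sqrt n * \<bar>\<mu>\<bar> + Y)\<^sup>2"
      using n Y0 by (simp add: power2_sum power_mult_distrib)
    finally show ?thesis using n Y0 by (simp add: real_le_lsqrt sum_nonneg)
  qed
  show ?thesis using dense_within_arith[OF n(2) a b ba Y0 mu energy norm] by (simp only: n_def)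
qed

lemma potential_bound:
  fixes \<phi> :: "nat \<Rightarrow> nat \<Rightarrow> real"
  assumes reg: "regular_graph h a b \<phi>" and h: "0 < h" and a: "0 < a" and b: "0 < b"
    and sym: "\<And>i j. i < 2*h \<Longrightarrow> j < 2*h \<Longrightarrow> \<phi> i j = \<phi> j i"
    and nonneg: "\<And>i j. i < 2*h \<Longrightarrow> j < 2*h \<Longrightarrow> 0 \<le> \<phi> i j"
    and uv: "u < 2*h" "v < 2*h" "u \<noteq> v"
    and lap: "\<And>i. i < 2*h \<Longrightarrow> (\<Sum>j<2*h. \<phi> i j * (x i - x j)) = of_bool (i = u) - of_bool (i = v)"
    and mean0: "(\<Sum>i<2*h. x i) = 0"
  shows "sqrt (\<Sum>i<2*h. (x i)\<^sup>2) \<le>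
     140000 * (1 / (real (2*h) * (a + b)) + 1 / (real (2*h) * sqrt (real (2*h)) * b))"
proof (cases "a \<le> b")
  case True
  have "(\<Sum>i<2*h. \<Sum>j<2*h. \<phi> i j * (x i - x j)\<^sup>2) = 2 * (\<Sum>i<2*h. x i * (\<Sum>j<2*h. \<phi> i j * (x i - x j)))"
    using sym by (intro laplacian_energy(2)) auto
  also have "(\<Sum>i<2*h. x i * (\<Sum>j<2*h. \<phi> i j * (x i - x j))) =
      (\<Sum>i<2*h. x i * (of_bool (i = u) - of_bool (i = v)))"
    by (intro sum.cong refl) (subst lap, simp_all)
  also have "\<dots> = x u - x v"
    using uv by (simp add: sum_times_indicator_diff del: sum_mult_of_bool_eq)
  also have "2 * (x u - x v) \<le> 4 * sqrt (\<Sum>i<2*h. (x i)\<^sup>2)"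
    using abs_diff_le_norm[of "{..<2*h}" u v x] uv by simp
  finally have "sqrt (\<Sum>i<2*h. (x i)\<^sup>2) \<le> 2000 / (real (2*h) * (a + b))"
    by (intro potential_bound_sparse_within[OF reg h a True sym nonneg _ mean0]) auto
  also have "\<dots> \<le> 140000 / (real (2*h) * (a + b))"
    using h a b by (intro divide_right_mono) auto
  also have "\<dots> \<le> \<dots> + 140000 * (1 / (real (2*h) * sqrt (real (2*h)) * b))" using b by simp
  finally show ?thesis by (simp add: algebra_simps)
next
  case False
  have "sqrt (\<Sum>i<2*h. (x i)\<^sup>2) \<le>
     140000 / (real (2*h) * (a + b)) + 500 / (real (2*h) * sqrt (real (2*h)) * b)"
    by (rule potential_bound_dense_within[OF reg h a b _ sym nonneg uv lap mean0]) (use False in auto)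
  also have "500 / (real (2*h) * sqrt (real (2*h)) * b) \<le> 140000 / (real (2*h) * sqrt (real (2*h)) * b)"
    using h b by (intro divide_right_mono) auto
  finally show ?thesis by (simp add: algebra_simps)
qed

text \<open>Any positive gap makes the kernel of the Laplacian on zero-sum vectors trivial, so the
  total weight serves as degree bound \<open>d\<close>; the summand 1 keeps it positive.\<close>

lemma regular_graph_connected:
  fixes \<phi> :: "nat \<Rightarrow> nat \<Rightarrow> real"
  assumes reg: "regular_graph h a b \<phi>" and h: "0 < h" and b: "0 < b"
    and sym: "\<And>i j. i < 2*h \<Longrightarrow> j < 2*h \<Longrightarrow> \<phi> i j = \<phi> j i"
    and nonneg: "\<And>i j. i < 2*h \<Longrightarrow> j < 2*h \<Longrightarrow> 0 \<le> \<phi> i j"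
    and lap: "\<And>i. i < 2*h \<Longrightarrow> (\<Sum>j<2*h. \<phi> i j * (x i - x j)) = 0"
    and mean0: "(\<Sum>i<2*h. x i) = 0" and i: "i < 2*h"
  shows "x i = 0"
proof -
  define d where "d = 1 + (\<Sum>i<2*h. \<Sum>j<2*h. \<phi> i j)"
  have d: "d > 0" unfolding d_def using nonneg by (intro add_pos_nonneg sum_nonneg) auto
  have deg: "(\<Sum>j\<in>{..<2*h}. \<phi> i j) \<le> d" if "i \<in> {..<2*h}" for i
  proof -
    have "(\<Sum>j\<in>{..<2*h}. \<phi> i j) \<le> (\<Sum>i<2*h. \<Sum>j<2*h. \<phi> i j)"
      using that nonneg by (intro member_le_sum[where f = "\<lambda>i. \<Sum>j<2*h. \<phi> i j"] sum_nonneg) auto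
    then show ?thesis by (simp add: d_def)
  qed
  have "(real (2*h) * b / 8)\<^sup>2 / d * (\<Sum>i\<in>{..<2*h}. (x i)\<^sup>2)
      \<le> (\<Sum>i\<in>{..<2*h}. \<Sum>j\<in>{..<2*h}. \<phi> i j * (x i - x j)\<^sup>2)"
    by (rule cheeger[OF _ _ d sym nonneg regular_graphD(1)[OF reg] deg mean0]) (use h b in auto)
  also have "\<dots> = 2 * (\<Sum>i\<in>{..<2*h}. x i * (\<Sum>j\<in>{..<2*h}. \<phi> i j * (x i - x j)))"
    using sym by (intro laplacian_energy(2)) auto
  also have "\<dots> = 0" using lap by simp
  finally have le: "(real (2*h) * b / 8)\<^sup>2 / d * (\<Sum>i\<in>{..<2*h}. (x i)\<^sup>2) \<le> 0" .
  have "0 < (real (2*h) * b / 8)\<^sup>2 / d" using h b d by (intro divide_pos_pos zero_less_power mult_pos_pos) auto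
  with le have "(\<Sum>i\<in>{..<2*h}. (x i)\<^sup>2) \<le> 0" by (metis mult_pos_pos not_le)
  then have "(\<Sum>i\<in>{..<2*h}. (x i)\<^sup>2) = 0" by (rule antisym) (intro sum_nonneg, simp)
  then show ?thesis using i by (simp add: sum_nonneg_eq_0_iff)
qed

section \<open>The pseudoinverse of an incidence matrix\<close>

definition is_mp_pinv :: "real mat \<Rightarrow> real mat \<Rightarrow> bool" where
  "is_mp_pinv A B \<longleftrightarrow> B \<in> carrier_mat (dim_col A) (dim_row A) \<and>
      A * B * A = A \<and> B * A * B = B \<and>
      transpose_mat (A * B) = A * B \<and> transpose_mat (B * A) = B * A"

text \<open>\<open>A * B\<close> and \<open>A * C\<close> are orthogonal projections onto the same
  range, hence equal, and likewise \<open>B * A\<close> and \<open>C * A\<close>; then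
  \<open>B = B * A * B = C * A * C = C\<close>. This is what allows the \<open>THE\<close> in
  \<open>mp_pinv\<close> to be evaluated.\<close>

lemma is_mp_pinv_unique:
  assumes B: "is_mp_pinv A B" and C: "is_mp_pinv A C"
  shows "B = C"
proof -
  define m n where "m = dim_row A" and "n = dim_col A"
  have cA: "A \<in> carrier_mat m n" by (simp add: m_def n_def)
  have cB: "B \<in> carrier_mat n m" and cC: "C \<in> carrier_mat n m"
    using B C by (auto simp: is_mp_pinv_def m_def n_def)
  have B': "A * B * A = A" "B * A * B = B" "transpose_mat (A * B) = A * B" "transpose_mat (B * A) = B * A"
    and C': "A * C * A = A" "C * A * C = C" "transpose_mat (A * C) = A * C" "transpose_mat (C * A) = C * A"
    using B C by (auto simp: is_mp_pinv_def)
  note carr = cA cB cC mult_carrier_mat[OF cA cB] mult_carrier_mat[OF cA cC]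
    mult_carrier_mat[OF cB cA] mult_carrier_mat[OF cC cA]
  have "A * B = (A * C * A) * B" by (simp add: C')
  also have "\<dots> = (A * C) * (A * B)" using carr by (intro assoc_mult_mat) auto
  also have "\<dots> = transpose_mat (A * C) * transpose_mat (A * B)" by (simp add: B' C')
  also have "\<dots> = transpose_mat ((A * B) * (A * C))"
    using carr by (intro transpose_mult[symmetric]) auto
  also have "(A * B) * (A * C) = (A * B * A) * C"
    using carr by (intro assoc_mult_mat[symmetric]) auto
  finally have AB: "A * B = A * C" by (simp add: B' C')
  have "B * A = B * (A * C * A)" by (simp add: C')
  also have "A * C * A = A * (C * A)" using carr by (intro assoc_mult_mat) auto
  also have "B * (A * (C * A)) = (B * A) * (C * A)" using carr by (intro assoc_mult_mat[symmetric]) auto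
  also have "\<dots> = transpose_mat (B * A) * transpose_mat (C * A)" by (simp add: B' C')
  also have "\<dots> = transpose_mat ((C * A) * (B * A))"
    using carr by (intro transpose_mult[symmetric]) auto
  also have "(C * A) * (B * A) = C * (A * (B * A))" using carr by (intro assoc_mult_mat) auto
  also have "A * (B * A) = A * B * A" using carr by (intro assoc_mult_mat[symmetric]) auto
  finally have BA: "B * A = C * A" by (simp add: B' C')
  have "B = C * A * B" using B'(2) BA by simp
  also have "\<dots> = C * (A * B)" using carr by (intro assoc_mult_mat) auto
  also have "\<dots> = C * A * C" unfolding AB using carr by (intro assoc_mult_mat[symmetric]) auto
  finally show ?thesis by (simp add: C')
qed

lemma mp_pinv_eqI: "is_mp_pinv A B \<Longrightarrow> mp_pinv A = B"
  unfolding mp_pinv_def is_mp_pinv_def[symmetric]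
  by (rule the_equality) (auto intro: is_mp_pinv_unique)

text \<open>For an incidence matrix of a connected graph, \<open>F F\<^sup>T + J\<close> with \<open>J\<close> the averaging matrix is
  invertible, and \<open>F\<^sup>T (F F\<^sup>T + J)\<^sup>-\<^sup>1\<close> satisfies the Penrose equations.\<close>

lemma mp_pinv_zero_column_sums:
  fixes F :: "real mat"
  assumes F: "F \<in> carrier_mat n m" and n: "0 < n"
    and colsum: "\<And>e. e < m \<Longrightarrow> (\<Sum>i<n. F $$ (i, e)) = 0"
    and inj: "\<And>x. x \<in> carrier_vec n \<Longrightarrow> (F * transpose_mat F) *\<^sub>v x = 0\<^sub>v n \<Longrightarrow>
        (\<Sum>i<n. x $ i) = 0 \<Longrightarrow> x = 0\<^sub>v n"
  shows "mp_pinv F \<in> carrier_mat m n"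
    and "F * transpose_mat F * transpose_mat (mp_pinv F) = F"
    and "e < m \<Longrightarrow> (\<Sum>i<n. mp_pinv F $$ (e, i)) = 0"
proof -
  define J where "J = mat n n (\<lambda>_. 1 / real n)"
  define L where "L = F * transpose_mat F"
  define N where "N = L + J"
  have cFt: "transpose_mat F \<in> carrier_mat m n" using F by simp
  have cJ: "J \<in> carrier_mat n n" by (simp add: J_def)
  have cL: "L \<in> carrier_mat n n" unfolding L_def using F by (intro mult_carrier_mat) auto
  have cN: "N \<in> carrier_mat n n" unfolding N_def using cL cJ by simp
  have Jt: "transpose_mat J = J" by (rule eq_matI) (auto simp: J_def)
  have Lt: "transpose_mat L = L" unfolding L_def using transpose_mult[OF F cFt] by simp
  have Nt: "transpose_mat N = N" unfolding N_def using transpose_add[OF cL cJ] by (simp add: Jt Lt)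
  have JF: "J * F = 0\<^sub>m n m"
  proof (rule eq_matI)
    fix i e assume ie: "i < dim_row (0\<^sub>m n m)" "e < dim_col (0\<^sub>m n m)"
    have "(J * F) $$ (i, e) = (\<Sum>k<n. 1 / real n * F $$ (k, e))"
      using ie F by (simp add: J_def scalar_prod_def atLeast0LessThan)
    also have "\<dots> = 0" using colsum[of e] ie by (simp flip: sum_divide_distrib)
    finally show "(J * F) $$ (i, e) = 0\<^sub>m n m $$ (i, e)" using ie by simp
  qed (use F in \<open>auto simp: J_def\<close>)
  have FtJ: "transpose_mat F * J = 0\<^sub>m m n"
    using arg_cong[OF JF, of transpose_mat] transpose_mult[OF cJ F] by (simp add: Jt)
  have JJ: "J * J = J"
    by (rule eq_matI) (use n in \<open>auto simp: J_def scalar_prod_def\<close>)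
  have JL: "J * L = 0\<^sub>m n n"
    unfolding L_def using assoc_mult_mat[OF cJ F cFt] cFt by (simp add: JF)
  have LJ: "L * J = 0\<^sub>m n n"
    unfolding L_def using assoc_mult_mat[OF F cFt cJ] F by (simp add: FtJ)
  have JN: "J * N = J" unfolding N_def using mult_add_distrib_mat[OF cJ cL cJ] cJ by (simp add: JL JJ)
  have NJ: "N * J = J" unfolding N_def using add_mult_distrib_mat[OF cL cJ cJ] cJ by (simp add: LJ JJ)
  \<comment> \<open>For \<open>x\<close> in the kernel of \<open>N\<close>, \<open>J * N = J\<close>
    gives \<open>J *\<^sub>v x = 0\<close>, so \<open>x\<close> has zero sum and \<open>L\<close>
    kills it too; then \<open>inj\<close> applies.\<close>
  have "det N \<noteq> 0"
  proof
    assume "det N = 0"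
    then obtain x where x: "x \<in> carrier_vec n" "x \<noteq> 0\<^sub>v n" "N *\<^sub>v x = 0\<^sub>v n"
      using det_0_iff_vec_prod_zero_field[OF cN] by auto
    have Jx: "J *\<^sub>v x = 0\<^sub>v n"
    proof -
      have "J *\<^sub>v x = (J * N) *\<^sub>v x" by (simp add: JN)
      also have "\<dots> = J *\<^sub>v (N *\<^sub>v x)" by (rule assoc_mult_mat_vec[OF cJ cN x(1)])
      finally show ?thesis using cJ by (simp only: x(3)) (intro eq_vecI, auto)
    qed
    have "(\<Sum>i<n. x $ i) / real n = (J *\<^sub>v x) $ 0"
      using n x(1) by (simp add: J_def scalar_prod_def atLeast0LessThan sum_divide_distrib)
    then have sum0: "(\<Sum>i<n. x $ i) = 0" using n by (simp add: Jx)
    have "L *\<^sub>v x = L *\<^sub>v x + J *\<^sub>v x"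
      using cL x(1) by (subst Jx) (simp add: mult_mat_vec_carrier)
    also have "\<dots> = N *\<^sub>v x" unfolding N_def using add_mult_distrib_mat_vec[OF cL cJ x(1)] by simp
    finally have "L *\<^sub>v x = 0\<^sub>v n" by (simp add: x(3))
    then show False using inj[OF x(1) _ sum0] x(2) by (simp add: L_def)
  qed
  define G where "G = (1 / det N) \<cdot>\<^sub>m adj_mat N"
  have cG: "G \<in> carrier_mat n n" using adj_mat(1)[OF cN] by (simp add: G_def)
  have inv: "(1 / det N) \<cdot>\<^sub>m (det N \<cdot>\<^sub>m 1\<^sub>m n) = 1\<^sub>m n"
    using \<open>det N \<noteq> 0\<close> by (intro eq_matI) auto
  have NG: "N * G = 1\<^sub>m n"
    unfolding G_def using mult_smult_distrib[OF cN adj_mat(1)[OF cN]] adj_mat(2)[OF cN] inv by simp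
  have GN: "G * N = 1\<^sub>m n"
    unfolding G_def using mult_smult_assoc_mat[OF adj_mat(1)[OF cN] cN] adj_mat(3)[OF cN] inv by simp
  have cGt: "transpose_mat G \<in> carrier_mat n n" using cG by simp
  have "transpose_mat G = transpose_mat G * (N * G)" using cGt by (simp add: NG)
  also have "\<dots> = (transpose_mat G * N) * G" by (rule assoc_mult_mat[symmetric, OF cGt cN cG])
  also have "transpose_mat G * N = transpose_mat (N * G)" using transpose_mult[OF cN cG] by (simp add: Nt)
  finally have Gt: "transpose_mat G = G" using cG by (simp add: NG)
  have JG: "J * G = J"
  proof -
    have "J * G = (J * N) * G" by (simp add: JN)
    also have "\<dots> = J * (N * G)" by (rule assoc_mult_mat[OF cJ cN cG])
    finally show ?thesis using cJ by (simp add: NG)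
  qed
  have GJ: "G * J = J"
  proof -
    have "G * J = G * (N * J)" by (simp add: NJ)
    also have "\<dots> = (G * N) * J" by (rule assoc_mult_mat[symmetric, OF cG cN cJ])
    finally show ?thesis using cJ by (simp add: GN)
  qed
  have cLG: "L * G \<in> carrier_mat n n" using cL cG by simp
  \<comment> \<open>\<open>L * G\<close> is thus the projection onto zero-sum vectors. It fixes the
    columns of \<open>F\<close>, and the Penrose equations follow from this.\<close>
  have LG: "L * G = 1\<^sub>m n - J"
  proof -
    have "1\<^sub>m n = L * G + J"
      using add_mult_distrib_mat[OF cL cJ cG] NG by (simp add: N_def JG)
    moreover have "L * G = L * G + J - J" by (rule eq_matI) (use cLG cJ in auto)
    ultimately show ?thesis by simp
  qed
  define B where "B = transpose_mat F * G"
  have cB: "B \<in> carrier_mat m n" unfolding B_def using cFt cG by simp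
  have FB: "F * B = 1\<^sub>m n - J"
    unfolding B_def using assoc_mult_mat[OF F cFt cG] LG by (simp add: L_def)
  have one: "1\<^sub>m n \<in> carrier_mat n n" by simp
  have F0: "F - 0\<^sub>m n m = F" and B0: "B - 0\<^sub>m m n = B" using F cB by (auto intro!: eq_matI)
  have "is_mp_pinv F B"
    unfolding is_mp_pinv_def
  proof (intro conjI)
    show "B \<in> carrier_mat (dim_col F) (dim_row F)" using cB F by simp
    show "F * B * F = F"
      unfolding FB using minus_mult_distrib_mat[OF one cJ F] F by (simp add: JF F0)
    have "B * F * B = B * (F * B)" by (rule assoc_mult_mat[OF cB F cB])
    also have "\<dots> = B - B * J" unfolding FB using mult_minus_distrib_mat[OF cB one cJ] cB by simp
    also have "B * J = 0\<^sub>m m n" unfolding B_def using assoc_mult_mat[OF cFt cG cJ] by (simp add: GJ FtJ)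
    finally show "B * F * B = B" by (simp add: B0)
    show "transpose_mat (F * B) = F * B"
      unfolding FB by (rule eq_matI) (auto simp: J_def)
    have "transpose_mat (B * F) = transpose_mat F * transpose_mat B" by (rule transpose_mult[OF cB F])
    also have "transpose_mat B = G * F"
      unfolding B_def using transpose_mult[OF cFt cG] by (simp add: Gt)
    also have "transpose_mat F * (G * F) = B * F"
      unfolding B_def by (rule assoc_mult_mat[symmetric, OF cFt cG F])
    finally show "transpose_mat (B * F) = B * F" .
  qed
  then have eq: "mp_pinv F = B" by (rule mp_pinv_eqI)
  have Bt: "transpose_mat B = G * F"
    unfolding B_def using transpose_mult[OF cFt cG] by (simp add: Gt)
  have cBt: "transpose_mat B \<in> carrier_mat n m" using cB by simp
  show "mp_pinv F \<in> carrier_mat m n" using cB by (simp add: eq)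
  have "F * transpose_mat F * transpose_mat B = L * G * F"
    unfolding Bt L_def[symmetric] by (rule assoc_mult_mat[symmetric, OF cL cG F])
  also have "\<dots> = F" unfolding LG using minus_mult_distrib_mat[OF one cJ F] F by (simp add: JF F0)
  finally show "F * transpose_mat F * transpose_mat (mp_pinv F) = F" by (simp add: eq)
  have JB: "J * transpose_mat B = 0\<^sub>m n m"
    unfolding Bt using assoc_mult_mat[OF cJ cG F] by (simp add: JG JF)
  show "(\<Sum>i<n. mp_pinv F $$ (e, i)) = 0" if e: "e < m"
  proof -
    have "(\<Sum>i<n. B $$ (e, i)) / real n = (J * transpose_mat B) $$ (0, e)"
      using n e cB by (simp add: J_def scalar_prod_def atLeast0LessThan sum_divide_distrib)
    then show ?thesis using n e by (simp add: JB eq)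
  qed
qed

section \<open>Edge lists and the Laplacian of an incidence matrix\<close>

lemma distinct_edge_list: "distinct (edge_list n \<phi>)"
  by (simp add: edge_list_def distinct_product)

lemma set_edge_list: "set (edge_list n \<phi>) = {(i, j). i < j \<and> j < n \<and> \<phi> i j = 1}"
  by (auto simp: edge_list_def)

lemma sum_over_edges:
  fixes f :: "nat \<Rightarrow> nat \<Rightarrow> real"
  assumes phi: "\<And>i j. i < n \<Longrightarrow> j < n \<Longrightarrow> \<phi> i j \<in> {0, 1}"
  shows "(\<Sum>(i, j)\<in>set (edge_list n \<phi>). f i j) = (\<Sum>i<n. \<Sum>j<n. of_bool (i < j) * \<phi> i j * f i j)"
proof -
  have "(\<Sum>(i, j)\<in>set (edge_list n \<phi>). f i j) =
      (\<Sum>(i, j)\<in>set (edge_list n \<phi>). of_bool (i < j) * \<phi> i j * f i j)"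
    by (intro sum.cong refl) (auto simp: set_edge_list)
  also have "\<dots> = (\<Sum>(i, j)\<in>{..<n} \<times> {..<n}. of_bool (i < j) * \<phi> i j * f i j)"
    using phi by (intro sum.mono_neutral_left) (fastforce simp: set_edge_list)+
  finally show ?thesis by (simp add: sum.cartesian_product)
qed

lemma sum_edge_index:
  "(\<Sum>e<length (edge_list n \<phi>). g (edge_list n \<phi> ! e)) = (\<Sum>e\<in>set (edge_list n \<phi>). g e)"
  using sum.distinct_set_conv_list[OF distinct_edge_list, of g n \<phi>]
  by (simp add: sum_list_sum_nth atLeast0LessThan)

text \<open>On an edge \<open>\<phi>\<close> is 1, so the root disappears and each column is a
  difference of two unit vectors. Every column meeting vertex \<open>i\<close> yields one term
  \<open>x i - x j\<close>, whatever its orientation, because the sign enters twice.\<close>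

lemma incidence_laplacian:
  fixes x :: "nat \<Rightarrow> real"
  assumes phi: "\<And>i j. i < n \<Longrightarrow> j < n \<Longrightarrow> \<phi> i j \<in> {0, 1}"
    and sym: "\<And>i j. i < n \<Longrightarrow> j < n \<Longrightarrow> \<phi> i j = \<phi> j i"
    and i: "i < n"
  defines "F \<equiv> incidence_mat n \<phi>"
  shows "(\<Sum>e<length (edge_list n \<phi>). F $$ (i, e) * (\<Sum>k<n. F $$ (k, e) * x k)) =
     (\<Sum>j<n. \<phi> i j * (x i - x j))"
proof -
  define es where "es = edge_list n \<phi>"
  have es: "fst (es ! e) < snd (es ! e) \<and> snd (es ! e) < n \<and> \<phi> (fst (es ! e)) (snd (es ! e)) = 1"
    if "e < length es" for e
    using nth_mem[OF that] by (auto simp: es_def set_edge_list)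
  have F: "F $$ (k, e) = of_bool (k = fst (es ! e)) - of_bool (k = snd (es ! e))"
    if "k < n" "e < length es" for k e
    using es[OF that(2)] that by (auto simp: F_def incidence_mat_def es_def[symmetric] Let_def case_prod_beta)
  have single: "(\<Sum>j<n. of_bool (i = j) * f j) = f i" for f :: "nat \<Rightarrow> real"
    using i by (subst sum.remove[of _ i]) (auto intro!: sum.neutral)
  have "(\<Sum>e<length es. F $$ (i, e) * (\<Sum>k<n. F $$ (k, e) * x k)) =
    (\<Sum>e<length es. (\<lambda>(j, k). (of_bool (i = j) - of_bool (i = k)) * (x j - x k)) (es ! e))"
  proof (intro sum.cong refl)
    fix e assume e: "e \<in> {..<length es}"
    have "(\<Sum>k<n. F $$ (k, e) * x k) =
      (\<Sum>k<n. x k * (of_bool (k = fst (es ! e)) - of_bool (k = snd (es ! e))))"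
      using e by (intro sum.cong refl) (simp add: F)
    also have "\<dots> = x (fst (es ! e)) - x (snd (es ! e))"
      using es[of e] e by (intro sum_times_indicator_diff) auto
    finally show "F $$ (i, e) * (\<Sum>k<n. F $$ (k, e) * x k) =
      (\<lambda>(j, k). (of_bool (i = j) - of_bool (i = k)) * (x j - x k)) (es ! e)"
      using F[OF i, of e] e by (simp add: case_prod_beta)
  qed
  also have "\<dots> = (\<Sum>(j, k)\<in>set es. (of_bool (i = j) - of_bool (i = k)) * (x j - x k))"
    unfolding es_def by (rule sum_edge_index)
  also have "\<dots> = (\<Sum>j<n. \<Sum>k<n. of_bool (j < k) * \<phi> j k * ((of_bool (i = j) - of_bool (i = k)) * (x j - x k)))"
    unfolding es_def by (rule sum_over_edges[OF phi])
  \<comment> \<open>Edges at \<open>i\<close> are split according to whether \<open>i\<close> is the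
    smaller or the larger endpoint. Each other vertex occurs in exactly one of the two sums, and
    \<open>j = i\<close> adds \<open>x i - x i = 0\<close>.\<close>
  also have "\<dots> = (\<Sum>j<n. \<Sum>k<n. of_bool (i = j) * (of_bool (j < k) * \<phi> j k * (x j - x k)))
     + (\<Sum>j<n. \<Sum>k<n. of_bool (i = k) * (of_bool (j < k) * \<phi> j k * (x k - x j)))"
    unfolding sum.distrib[symmetric] by (intro sum.cong refl) (simp add: algebra_simps)
  also have "(\<Sum>j<n. \<Sum>k<n. of_bool (i = j) * (of_bool (j < k) * \<phi> j k * (x j - x k))) =
      (\<Sum>k<n. of_bool (i < k) * \<phi> i k * (x i - x k))"
    unfolding sum_distrib_left[symmetric] by (rule single)
  also have "(\<Sum>j<n. \<Sum>k<n. of_bool (i = k) * (of_bool (j < k) * \<phi> j k * (x k - x j))) =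
      (\<Sum>j<n. of_bool (j < i) * \<phi> j i * (x i - x j))"
    by (subst sum.swap, unfold sum_distrib_left[symmetric]) (rule single)
  also have "(\<Sum>k<n. of_bool (i < k) * \<phi> i k * (x i - x k)) +
      (\<Sum>j<n. of_bool (j < i) * \<phi> j i * (x i - x j)) = (\<Sum>j<n. \<phi> i j * (x i - x j))"
    unfolding sum.distrib[symmetric]
  proof (intro sum.cong refl)
    fix j assume "j \<in> {..<n}"
    then show "of_bool (i < j) * \<phi> i j * (x i - x j) + of_bool (j < i) * \<phi> j i * (x i - x j)
      = \<phi> i j * (x i - x j)"
      using sym[of i j] i by (cases i j rule: linorder_cases) auto
  qed
  finally show ?thesis by (simp add: es_def)
qed

text \<open>Read off column by column from \<open>F * transpose_mat F * transpose_mat P = F\<close>.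
  Connectedness enters as triviality of the Laplacian's kernel on zero-sum vectors, the form in
  which a spectral gap delivers it.\<close>

lemma pinv_incidence_row:
  assumes phi: "\<And>i j. i < n \<Longrightarrow> j < n \<Longrightarrow> \<phi> i j \<in> {0, 1}"
    and sym: "\<And>i j. i < n \<Longrightarrow> j < n \<Longrightarrow> \<phi> i j = \<phi> j i"
    and n: "0 < n"
    and conn: "\<forall>x. (\<forall>i<n. (\<Sum>j<n. \<phi> i j * (x i - x j)) = 0) \<longrightarrow> (\<Sum>i<n. x i) = 0 \<longrightarrow>
        (\<forall>i<n. x i = 0)"
  defines "P \<equiv> mp_pinv (incidence_mat n \<phi>)"
  shows "P \<in> carrier_mat (length (edge_list n \<phi>)) n"
    and "e < length (edge_list n \<phi>) \<Longrightarrow> edge_list n \<phi> ! e = (u, v) \<Longrightarrow> i < n \<Longrightarrow>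
       (\<Sum>j<n. \<phi> i j * (P $$ (e, i) - P $$ (e, j))) = of_bool (i = u) - of_bool (i = v)"
    and "e < length (edge_list n \<phi>) \<Longrightarrow> (\<Sum>i<n. P $$ (e, i)) = 0"
proof -
  define es where "es = edge_list n \<phi>"
  define F where "F = incidence_mat n \<phi>"
  define m where "m = length es"
  have cF: "F \<in> carrier_mat n m"
    by (simp add: F_def incidence_mat_def m_def es_def Let_def)
  have es: "fst (es ! e) < snd (es ! e) \<and> snd (es ! e) < n \<and> \<phi> (fst (es ! e)) (snd (es ! e)) = 1"
    if "e < m" for e
    using nth_mem[of e es] that by (auto simp: es_def m_def set_edge_list)
  have F: "F $$ (k, e) = of_bool (k = fst (es ! e)) - of_bool (k = snd (es ! e))"
    if "k < n" "e < m" for k e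
    using es[OF that(2)] that
    by (auto simp: F_def incidence_mat_def es_def[symmetric] m_def Let_def case_prod_beta)
  have colsum: "(\<Sum>i<n. F $$ (i, e)) = 0" if "e < m" for e
  proof -
    have "(\<Sum>i<n. F $$ (i, e)) = (\<Sum>i<n. 1 * (of_bool (i = fst (es ! e)) - of_bool (i = snd (es ! e))))"
      using that by (intro sum.cong refl) (simp add: F)
    also have "\<dots> = 1 - 1" using es[OF that] by (intro sum_times_indicator_diff) auto
    finally show ?thesis by simp
  qed
  have lapF: "(F * transpose_mat F * X) $$ (i, c) = (\<Sum>j<n. \<phi> i j * (X $$ (i, c) - X $$ (j, c)))"
    if X: "X \<in> carrier_mat n l" and ic: "i < n" "c < l" for X l i c
  proof -
    have "F * transpose_mat F * X = F * (transpose_mat F * X)"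
      using cF X by (intro assoc_mult_mat[OF cF _ X]) simp
    then have "(F * transpose_mat F * X) $$ (i, c) =
      (\<Sum>e<m. F $$ (i, e) * (\<Sum>k<n. F $$ (k, e) * X $$ (k, c)))"
      using cF X ic by (simp add: scalar_prod_def atLeast0LessThan)
    also have "\<dots> = (\<Sum>j<n. \<phi> i j * (X $$ (i, c) - X $$ (j, c)))"
      unfolding m_def F_def es_def by (rule incidence_laplacian[OF phi sym ic(1)])
    finally show ?thesis .
  qed
  have inj: "x = 0\<^sub>v n" if x: "x \<in> carrier_vec n" "(F * transpose_mat F) *\<^sub>v x = 0\<^sub>v n" "(\<Sum>i<n. x $ i) = 0"
    for x
  proof -
    \<comment> \<open>The vector becomes a one-column matrix so that \<open>lapF\<close> covers it
      as well.\<close>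
    define X where "X = mat n 1 (\<lambda>(i, _). x $ i)"
    have cX: "X \<in> carrier_mat n 1" by (simp add: X_def)
    have "(\<Sum>j<n. \<phi> i j * (x $ i - x $ j)) = 0" if i: "i < n" for i
    proof -
      have "(\<Sum>j<n. \<phi> i j * (x $ i - x $ j)) = (F * transpose_mat F * X) $$ (i, 0)"
        using lapF[OF cX i, of 0] i by (simp add: X_def)
      also have "\<dots> = ((F * transpose_mat F) *\<^sub>v x) $ i"
      proof -
        have "col X 0 = x" using x(1) by (intro eq_vecI) (auto simp: X_def)
        then show ?thesis using cF cX i by (simp del: assoc_mult_mat assoc_mult_mat_vec)
      qed
      finally show ?thesis using i by (simp add: x(2))
    qed
    then have "\<forall>i<n. x $ i = 0" using conn[rule_format, of "\<lambda>i. x $ i"] x(3) by blast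
    then show ?thesis using x(1) by (intro eq_vecI) auto
  qed
  have mp: "mp_pinv F \<in> carrier_mat m n" "F * transpose_mat F * transpose_mat (mp_pinv F) = F"
    "\<And>e. e < m \<Longrightarrow> (\<Sum>i<n. mp_pinv F $$ (e, i)) = 0"
    by (rule mp_pinv_zero_column_sums[OF cF n colsum inj]; assumption)+
  show "P \<in> carrier_mat (length (edge_list n \<phi>)) n"
    using mp(1) by (simp add: P_def F_def m_def es_def)
  show "(\<Sum>i<n. P $$ (e, i)) = 0" if "e < length (edge_list n \<phi>)"
    using mp(3)[of e] that by (simp add: P_def F_def m_def es_def)
  show "(\<Sum>j<n. \<phi> i j * (P $$ (e, i) - P $$ (e, j))) = of_bool (i = u) - of_bool (i = v)"
    if "e < length (edge_list n \<phi>)" "edge_list n \<phi> ! e = (u, v)" "i < n"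
  proof -
    have e: "e < m" using that by (simp add: m_def es_def)
    have cP: "P \<in> carrier_mat m n" using mp(1) by (simp add: P_def F_def)
    then have cPt: "transpose_mat P \<in> carrier_mat n m" by simp
    have "(\<Sum>j<n. \<phi> i j * (P $$ (e, i) - P $$ (e, j))) =
      (\<Sum>j<n. \<phi> i j * (transpose_mat P $$ (i, e) - transpose_mat P $$ (j, e)))"
      using cP e that by (intro sum.cong refl) auto
    also have "\<dots> = (F * transpose_mat F * transpose_mat P) $$ (i, e)"
      by (rule lapF[OF cPt that(3) e, symmetric])
    also have "F * transpose_mat F * transpose_mat P = F" using mp(2) by (simp add: P_def F_def)
    also have "F $$ (i, e) = of_bool (i = u) - of_bool (i = v)"
      using F[OF that(3) e] that by (simp add: es_def)
    finally show ?thesis .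
  qed
qed

section \<open>Concentration of cuts and degrees\<close>

lemma (in prob_space) exp_Markov:
  fixes Y :: "'a \<Rightarrow> real"
  assumes [measurable]: "random_variable borel Y"
    and le: "(\<integral>\<^sup>+\<omega>. ennreal (exp (Y \<omega>)) \<partial>M) \<le> ennreal K" and K: "0 \<le> K"
  shows "prob {\<omega>\<in>space M. a \<le> Y \<omega>} \<le> exp (- a) * K"
proof -
  have "emeasure M {\<omega>\<in>space M. a \<le> Y \<omega>} \<le>
      ennreal (exp (- 1 * a)) * (\<integral>\<^sup>+\<omega>. ennreal (exp (1 * Y \<omega>)) * indicator (space M) \<omega> \<partial>M)"
    by (rule Chernoff_ineq_nn_integral_ge) auto
  also have "(\<integral>\<^sup>+\<omega>. ennreal (exp (1 * Y \<omega>)) * indicator (space M) \<omega> \<partial>M) = (\<integral>\<^sup>+\<omega>. ennreal (exp (Y \<omega>)) \<partial>M)"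
    by (intro nn_integral_cong) auto
  also have "ennreal (exp (- 1 * a)) * \<dots> \<le> ennreal (exp (- 1 * a)) * ennreal K"
    using le by (intro mult_left_mono) auto
  also have "\<dots> = ennreal (exp (- a) * K)" using K by (simp add: ennreal_mult)
  finally show ?thesis using K by (simp add: emeasure_eq_measure)
qed

text \<open>Shared by the Bernoulli and the sub-Gaussian tails. Nonnegative integrals avoid any
  integrability question for the exponentials.\<close>

lemma (in prob_space) nn_integral_exp_sum:
  fixes Y :: "'i \<Rightarrow> 'a \<Rightarrow> real"
  assumes I: "finite I" and ind: "indep_vars (\<lambda>_. borel) Y I"
    and le: "\<And>i. i \<in> I \<Longrightarrow> (\<integral>\<^sup>+\<omega>. ennreal (exp (c i * Y i \<omega>)) \<partial>M) \<le> ennreal (exp (b i))"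
  shows "(\<integral>\<^sup>+\<omega>. ennreal (exp (\<Sum>i\<in>I. c i * Y i \<omega>)) \<partial>M) \<le> ennreal (exp (\<Sum>i\<in>I. b i))"
proof -
  have "indep_vars (\<lambda>_. borel) (\<lambda>i \<omega>. ennreal (exp (c i * Y i \<omega>))) I"
    using ind by (rule indep_vars_compose2[where Y = "\<lambda>i x. ennreal (exp (c i * x))"]) measurable
  then have "(\<integral>\<^sup>+\<omega>. (\<Prod>i\<in>I. ennreal (exp (c i * Y i \<omega>))) \<partial>M) =
      (\<Prod>i\<in>I. \<integral>\<^sup>+\<omega>. ennreal (exp (c i * Y i \<omega>)) \<partial>M)"
    by (intro indep_vars_nn_integral[OF I]) auto
  also have "\<dots> \<le> (\<Prod>i\<in>I. ennreal (exp (b i)))" by (intro prod_mono_ennreal le)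
  finally show ?thesis using I by (simp add: prod_ennreal exp_sum)
qed

lemma (in prob_space) nn_integral_exp_bernoulli:
  fixes X :: "'a \<Rightarrow> real"
  assumes [measurable]: "random_variable borel X"
    and X01: "\<And>\<omega>. \<omega> \<in> space M \<Longrightarrow> X \<omega> \<in> {0, 1}"
  shows "(\<integral>\<^sup>+\<omega>. ennreal (exp (t * X \<omega>)) \<partial>M) \<le>
      ennreal (exp ((exp t - 1) * prob {\<omega>\<in>space M. X \<omega> = 1}))"
proof -
  define A where "A = {\<omega>\<in>space M. X \<omega> = 1}"
  have A[measurable]: "A \<in> events" unfolding A_def by measurable
  have eq: "exp (t * X \<omega>) = 1 + (exp t - 1) * indicator A \<omega>" if "\<omega> \<in> space M" for \<omega>
    using X01[OF that] that by (auto simp: A_def)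
  have int: "integrable M (\<lambda>\<omega>. 1 + (exp t - 1) * indicator A \<omega> :: real)"
    by (intro Bochner_Integration.integrable_add integrable_mult_right integrable_const integrable_real_indicator)
      (auto simp: emeasure_eq_measure)
  have "(\<integral>\<^sup>+\<omega>. ennreal (exp (t * X \<omega>)) \<partial>M) = (\<integral>\<^sup>+\<omega>. ennreal (1 + (exp t - 1) * indicator A \<omega>) \<partial>M)"
    by (intro nn_integral_cong) (simp add: eq)
  also have "\<dots> = ennreal (\<integral>\<omega>. 1 + (exp t - 1) * indicator A \<omega> \<partial>M)"
    by (intro nn_integral_eq_integral int AE_I2) (auto simp: indicator_def)
  also have "(\<integral>\<omega>. 1 + (exp t - 1) * indicator A \<omega> \<partial>M) = 1 + (exp t - 1) * prob A"
    by (subst Bochner_Integration.integral_add) (auto simp: prob_space emeasure_eq_measure)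
  also have "ennreal \<dots> \<le> ennreal (exp ((exp t - 1) * prob A))"
    by (intro ennreal_leI exp_ge_add_one_self)
  finally show ?thesis by (simp add: A_def)
qed

text \<open>The exponential parameter is fixed at -1 and 1. Below:
  \<open>m / 2 + (exp (-1) - 1) * \<mu>\<close> is at most \<open>m / 2 - 3/5 * m\<close>, that is
  \<open>- m / 10\<close>, as \<open>exp (-1) \<le> 2/5\<close>. Above:
  \<open>- 3 * m + (exp 1 - 1) * \<mu> \<le> - m\<close>, as \<open>exp 1 \<le> 3\<close>. Only a
  bound \<open>m\<close> on the mean has to be known.\<close>

lemma (in prob_space) chernoff_bernoulli:
  fixes X :: "'i \<Rightarrow> 'a \<Rightarrow> real"
  assumes I: "finite I" and ind: "indep_vars (\<lambda>_. borel) X I"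
    and X01: "\<And>i \<omega>. i \<in> I \<Longrightarrow> \<omega> \<in> space M \<Longrightarrow> X i \<omega> \<in> {0, 1}"
  defines "\<mu> \<equiv> (\<Sum>i\<in>I. prob {\<omega>\<in>space M. X i \<omega> = 1})"
  shows "m \<le> \<mu> \<Longrightarrow> prob {\<omega>\<in>space M. (\<Sum>i\<in>I. X i \<omega>) \<le> m / 2} \<le> exp (- (m / 10))"
    and "\<mu> \<le> m \<Longrightarrow> prob {\<omega>\<in>space M. 3 * m \<le> (\<Sum>i\<in>I. X i \<omega>)} \<le> exp (- m)"
proof -
  have rv[measurable]: "random_variable borel (X i)" if "i \<in> I" for i
    using ind that by (auto simp: indep_vars_def)
  have mu0: "\<mu> \<ge> 0" unfolding \<mu>_def by (intro sum_nonneg) auto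
  have mgf: "(\<integral>\<^sup>+\<omega>. ennreal (exp (\<Sum>i\<in>I. t * X i \<omega>)) \<partial>M) \<le> ennreal (exp ((exp t - 1) * \<mu>))" for t
    unfolding \<mu>_def sum_distrib_left
    by (intro nn_integral_exp_sum[OF I ind] nn_integral_exp_bernoulli rv X01)
  have rvs: "random_variable borel (\<lambda>\<omega>. \<Sum>i\<in>I. t * X i \<omega>)" for t
    by (intro borel_measurable_sum borel_measurable_times borel_measurable_const rv)
  have tail: "prob {\<omega>\<in>space M. a \<le> (\<Sum>i\<in>I. t * X i \<omega>)} \<le> exp (- a + (exp t - 1) * \<mu>)" for a t
    unfolding exp_add by (rule exp_Markov[OF rvs mgf]) simp
  show "prob {\<omega>\<in>space M. (\<Sum>i\<in>I. X i \<omega>) \<le> m / 2} \<le> exp (- (m / 10))" if m: "m \<le> \<mu>"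
  proof -
    have "(5/2 :: real) \<le> exp 1" using exp_lower_Taylor_quadratic[of 1] by simp
    then have "exp (-1) \<le> (2/5 :: real)" by (simp add: exp_minus field_simps)
    then have "(exp (-1) - 1) * \<mu> \<le> (2/5 - 1) * \<mu>" using mu0 by (intro mult_right_mono) auto
    then have "- (- (m / 2)) + (exp (-1) - 1) * \<mu> \<le> - (m / 10)" using m by simp
    then have "prob {\<omega>\<in>space M. - (m / 2) \<le> (\<Sum>i\<in>I. (-1) * X i \<omega>)} \<le> exp (- (m / 10))"
      by (intro order.trans[OF tail]) simp
    then show ?thesis by (simp add: sum_negf)
  qed
  show "prob {\<omega>\<in>space M. 3 * m \<le> (\<Sum>i\<in>I. X i \<omega>)} \<le> exp (- m)" if m: "\<mu> \<le> m"
  proof -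
    have "(exp 1 - 1) * \<mu> \<le> (3 - 1) * \<mu>" using mu0 exp_le by (intro mult_right_mono) auto
    then have "- (3 * m) + (exp 1 - 1) * \<mu> \<le> - m" using m by simp
    then have "prob {\<omega>\<in>space M. 3 * m \<le> (\<Sum>i\<in>I. 1 * X i \<omega>)} \<le> exp (- m)"
      by (intro order.trans[OF tail]) simp
    then show ?thesis by simp
  qed
qed

locale random_graph = prob_space +
  fixes n :: nat and X :: "'a \<Rightarrow> nat \<Rightarrow> nat \<Rightarrow> real" and q :: "nat \<Rightarrow> nat \<Rightarrow> real"
  assumes X_01: "\<And>\<omega> i j. \<omega> \<in> space M \<Longrightarrow> i < n \<Longrightarrow> j < n \<Longrightarrow> X \<omega> i j \<in> {0, 1}"
    and X_sym: "\<And>\<omega> i j. \<omega> \<in> space M \<Longrightarrow> i < n \<Longrightarrow> j < n \<Longrightarrow> X \<omega> i j = X \<omega> j i"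
    and X_diag: "\<And>\<omega> i. \<omega> \<in> space M \<Longrightarrow> i < n \<Longrightarrow> X \<omega> i i = 0"
    and X_indep: "indep_vars (\<lambda>_. borel) (\<lambda>e \<omega>. X \<omega> (fst e) (snd e)) {(i, j). i < j \<and> j < n}"
    and X_prob: "\<And>i j. i < n \<Longrightarrow> j < n \<Longrightarrow> i \<noteq> j \<Longrightarrow> prob {\<omega>\<in>space M. X \<omega> i j = 1} = q i j"
begin

definition edge_count :: "nat set \<Rightarrow> nat set \<Rightarrow> 'a \<Rightarrow> real" where
  "edge_count S T \<omega> = (\<Sum>i\<in>S. \<Sum>j\<in>T. X \<omega> i j)"

text \<open>For disjoint \<open>S\<close> and \<open>T\<close>, sorting the two endpoints is
  injective on \<open>S \<times> T\<close>, so the count is a sum of distinct members of the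
  independent family indexed by \<open>i < j\<close>.\<close>

lemma edge_count_chernoff:
  assumes S: "S \<subseteq> {..<n}" and T: "T \<subseteq> {..<n}" and disj: "S \<inter> T = {}"
  defines "\<mu> \<equiv> (\<Sum>i\<in>S. \<Sum>j\<in>T. q i j)"
  shows "random_variable borel (edge_count S T)"
    and "m \<le> \<mu> \<Longrightarrow> prob {\<omega>\<in>space M. edge_count S T \<omega> \<le> m / 2} \<le> exp (- (m / 10))"
    and "\<mu> \<le> m \<Longrightarrow> prob {\<omega>\<in>space M. 3 * m \<le> edge_count S T \<omega>} \<le> exp (- m)"
proof -
  define f where "f = (\<lambda>(i, j). (min i j, max i j :: nat))"
  define I where "I = f ` (S \<times> T)"
  have fin: "finite S" "finite T" using S T finite_subset by auto
  have inj: "inj_on f (S \<times> T)"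
    using disj by (auto simp: inj_on_def f_def min_def max_def split: if_splits)
  have I: "finite I" "I \<subseteq> {(i, j). i < j \<and> j < n}"
    using fin S T disj by (auto simp: I_def f_def min_def max_def)
      (metis IntI empty_iff le_neq_implies_less lessThan_iff subsetD linorder_not_le)+
  have ind: "indep_vars (\<lambda>_. borel) (\<lambda>e \<omega>. X \<omega> (fst e) (snd e)) I"
    using X_indep I(2) by (rule indep_vars_subset)
  have rv: "random_variable borel (\<lambda>\<omega>. X \<omega> (fst e) (snd e))" if "e \<in> I" for e
    using ind that by (auto simp: indep_vars_def)
  have ij: "i < n" "j < n" "i \<noteq> j" if "(i, j) \<in> S \<times> T" for i j
    using that S T disj by auto
  have sum_eq: "edge_count S T \<omega> = (\<Sum>e\<in>I. X \<omega> (fst e) (snd e))" if w: "\<omega> \<in> space M" for \<omega>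
  proof -
    have "edge_count S T \<omega> = (\<Sum>(i, j)\<in>S \<times> T. X \<omega> i j)"
      by (simp add: edge_count_def sum.cartesian_product)
    also have "\<dots> = (\<Sum>e\<in>S \<times> T. X \<omega> (fst (f e)) (snd (f e)))"
    proof (intro sum.cong refl)
      fix e assume "e \<in> S \<times> T"
      then show "(case e of (i, j) \<Rightarrow> X \<omega> i j) = X \<omega> (fst (f e)) (snd (f e))"
        using ij[of "fst e" "snd e"] X_sym[OF w, of "fst e" "snd e"]
        by (auto simp: f_def min_def max_def case_prod_beta)
    qed
    finally show ?thesis by (simp add: I_def sum.reindex[OF inj])
  qed
  have mu_eq: "\<mu> = (\<Sum>e\<in>I. prob {\<omega>\<in>space M. X \<omega> (fst e) (snd e) = 1})"
  proof -
    have "\<mu> = (\<Sum>(i, j)\<in>S \<times> T. prob {\<omega>\<in>space M. X \<omega> i j = 1})"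
      unfolding \<mu>_def sum.cartesian_product
    proof (intro sum.cong refl)
      fix e assume "e \<in> S \<times> T"
      then show "(case e of (i, j) \<Rightarrow> q i j) = (case e of (i, j) \<Rightarrow> prob {\<omega>\<in>space M. X \<omega> i j = 1})"
        using X_prob[OF ij[of "fst e" "snd e"]] by (simp add: case_prod_beta)
    qed
    also have "\<dots> = (\<Sum>e\<in>S \<times> T. prob {\<omega>\<in>space M. X \<omega> (fst (f e)) (snd (f e)) = 1})"
    proof (intro sum.cong refl)
      fix e assume e: "e \<in> S \<times> T"
      obtain i j where [simp]: "e = (i, j)" by (cases e)
      have "{\<omega>\<in>space M. X \<omega> i j = 1} = {\<omega>\<in>space M. X \<omega> (fst (f e)) (snd (f e)) = 1}"
        using ij[of i j] e by (auto simp: f_def min_def max_def X_sym)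
      then show "(case e of (i, j) \<Rightarrow> prob {\<omega>\<in>space M. X \<omega> i j = 1}) =
          prob {\<omega>\<in>space M. X \<omega> (fst (f e)) (snd (f e)) = 1}" by simp
    qed
    finally show ?thesis by (simp add: I_def sum.reindex[OF inj])
  qed
  have 01: "X \<omega> (fst e) (snd e) \<in> {0, 1}" if "e \<in> I" "\<omega> \<in> space M" for e \<omega>
    using that I(2) by (intro X_01) auto
  have ev: "{\<omega>\<in>space M. P (edge_count S T \<omega>)} = {\<omega>\<in>space M. P (\<Sum>e\<in>I. X \<omega> (fst e) (snd e))}" for P
    using sum_eq by auto
  show "random_variable borel (edge_count S T)"
    by (subst measurable_cong[OF sum_eq]) (auto intro!: borel_measurable_sum rv)
  show "prob {\<omega>\<in>space M. edge_count S T \<omega> \<le> m / 2} \<le> exp (- (m / 10))" if "m \<le> \<mu>"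
    unfolding ev[of "\<lambda>z. z \<le> m / 2"] using that unfolding mu_eq by (intro chernoff_bernoulli[OF I(1) ind 01])
  show "prob {\<omega>\<in>space M. 3 * m \<le> edge_count S T \<omega>} \<le> exp (- m)" if "\<mu> \<le> m"
    unfolding ev[of "\<lambda>z. 3 * m \<le> z"] using that unfolding mu_eq by (intro chernoff_bernoulli[OF I(1) ind 01])
qed

text \<open>The expected cut is linear in \<open>card S\<close>, so the cut of \<open>S\<close>
  fails with probability at most \<open>z ^ card S\<close>, and the binomial theorem sums this over
  all nonempty sets to \<open>(1 + z) ^ card V - 1\<close>.\<close>

lemma all_cuts_large:
  fixes \<kappa> :: real
  assumes V: "V \<subseteq> {..<n}"
    and cut: "\<And>S. S \<subseteq> V \<Longrightarrow> 2 * card S \<le> card V \<Longrightarrow> \<kappa> * card S \<le> (\<Sum>i\<in>S. \<Sum>j\<in>V - S. q i j)"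
  obtains A where "A \<in> events" "prob A \<le> (1 + exp (- (\<kappa> / 10))) ^ card V - 1"
    "\<And>\<omega> S. \<omega> \<in> space M - A \<Longrightarrow> S \<subseteq> V \<Longrightarrow> 2 * card S \<le> card V \<Longrightarrow>
        \<kappa> / 2 * card S \<le> edge_count S (V - S) \<omega>"
proof -
  define z where "z = exp (- (\<kappa> / 10))"
  \<comment> \<open>The empty set is left out: its bound is trivial, but its term
    \<open>z ^ 0 = 1\<close> would spoil the union bound.\<close>
  define \<S> where "\<S> = {S \<in> Pow V - {{}}. 2 * card S \<le> card V}"
  define bad where "bad S = {\<omega>\<in>space M. edge_count S (V - S) \<omega> \<le> \<kappa> * card S / 2}" for S
  have finV: "finite V" using V finite_subset by blast
  have fin: "finite \<S>" using finV by (simp add: \<S>_def)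
  have S: "S \<subseteq> {..<n}" "V - S \<subseteq> {..<n}" "S \<inter> (V - S) = {}" if "S \<in> \<S>" for S
    using that V by (auto simp: \<S>_def)
  have ev: "bad S \<in> events" if "S \<in> \<S>" for S
    using edge_count_chernoff(1)[OF S[OF that]] unfolding bad_def by measurable
  have pr: "prob (bad S) \<le> z ^ card S" if "S \<in> \<S>" for S
  proof -
    have "prob (bad S) \<le> exp (- (\<kappa> * card S / 10))"
      unfolding bad_def using that by (intro edge_count_chernoff(2)[OF S[OF that]] cut) (auto simp: \<S>_def)
    also have "\<dots> = z ^ card S" by (simp add: z_def algebra_simps flip: exp_of_nat_mult)
    finally show ?thesis .
  qed
  have "prob (\<Union>S\<in>\<S>. bad S) \<le> (\<Sum>S\<in>\<S>. prob (bad S))"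
    using fin ev by (intro finite_measure_subadditive_finite) auto
  also have "\<dots> \<le> (\<Sum>S\<in>\<S>. z ^ card S)" by (intro sum_mono pr)
  also have "\<dots> \<le> (\<Sum>S\<in>Pow V - {{}}. z ^ card S)"
    using finV by (intro sum_mono2) (auto simp: \<S>_def z_def)
  also have "\<dots> = (\<Sum>S\<in>Pow V. z ^ card S) - 1" using finV by (simp add: sum_diff1)
  also have "(\<Sum>S\<in>Pow V. z ^ card S) = (1 + z) ^ card V"
    using prod_add[OF finV, of "\<lambda>_. z" "\<lambda>_. 1"] by (simp add: add.commute)
  finally have p: "prob (\<Union>S\<in>\<S>. bad S) \<le> (1 + z) ^ card V - 1" .
  show thesis
  proof (rule that[of "\<Union>S\<in>\<S>. bad S"])
    show "(\<Union>S\<in>\<S>. bad S) \<in> events" using fin ev by auto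
    show "prob (\<Union>S\<in>\<S>. bad S) \<le> (1 + exp (- (\<kappa> / 10))) ^ card V - 1" using p by (simp add: z_def)
    fix \<omega> S assume *: "\<omega> \<in> space M - (\<Union>S\<in>\<S>. bad S)" "S \<subseteq> V" "2 * card S \<le> card V"
    show "\<kappa> / 2 * card S \<le> edge_count S (V - S) \<omega>"
    proof (cases "S = {}")
      case False
      then have "S \<in> \<S>" using * by (simp add: \<S>_def)
      then have "\<omega> \<notin> bad S" using *(1) by auto
      then show ?thesis using *(1) by (simp add: bad_def)
    qed (simp add: edge_count_def)
  qed
qed

end


section \<open>Expected cuts of the two-community model\<close>

definition block_prob :: "nat \<Rightarrow> real \<Rightarrow> real \<Rightarrow> nat \<Rightarrow> nat \<Rightarrow> real" where
  "block_prob h a b i j = (if (i < h) = (j < h) then a else b)"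

text \<open>Only pairs across the communities are kept. If \<open>S\<close> has \<open>s1\<close>
  and \<open>s2\<close> points in them, their number is \<open>h * (s1 + s2) - 2 * s1 * s2\<close>,
  at least \<open>h * (s1 + s2) - (s1 + s2)^2 / 2\<close>, hence at least
  \<open>h * (s1 + s2) / 2\<close> because \<open>s1 + s2 \<le> h\<close>.\<close>

lemma block_prob_cut_all:
  assumes b: "0 \<le> b" and a: "0 \<le> a" and S: "S \<subseteq> {..<2*h}" "2 * card S \<le> card {..<2*h}"
  shows "real (2*h) * b / 4 * card S \<le> (\<Sum>i\<in>S. \<Sum>j\<in>{..<2*h} - S. block_prob h a b i j)"
proof -
  define S1 S2 where "S1 = S \<inter> {..<h}" and "S2 = S \<inter> {h..<2*h}"
  have fS: "finite S" using S finite_subset by blast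
  then have fin: "finite S1" "finite S2" by (auto simp: S1_def S2_def)
  have S12: "S = S1 \<union> S2" "S1 \<inter> S2 = {}" using S(1) by (auto simp: S1_def S2_def)
  have cS: "card S = card S1 + card S2" unfolding S12(1) using fin S12(2) by (rule card_Un_disjoint)
  have diff: "real (card ({h..<2*h} - S2)) = real h - card S2" "real (card ({..<h} - S1)) = real h - card S1"
    using card_mono[of "{h..<2*h}" S2] card_mono[of "{..<h}" S1] fin
    by (auto simp: S1_def S2_def card_Diff_subset of_nat_diff)
  have half: "(\<Sum>j\<in>B. b) \<le> (\<Sum>j\<in>{..<2*h} - S. block_prob h a b i j)"
    if "B \<subseteq> {..<2*h} - S" "\<And>j. j \<in> B \<Longrightarrow> (i < h) \<noteq> (j < h)" for i B
  proof -
    have "(\<Sum>j\<in>B. b) = (\<Sum>j\<in>B. block_prob h a b i j)"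
      using that(2) by (intro sum.cong refl) (simp add: block_prob_def)
    also have "\<dots> \<le> (\<Sum>j\<in>{..<2*h} - S. block_prob h a b i j)"
      using that(1) a b by (intro sum_mono2) (auto simp: block_prob_def)
    finally show ?thesis .
  qed
  define s1 s2 where "s1 = real (card S1)" and "s2 = real (card S2)"
  have le: "s1 + s2 \<le> h" using S(2) cS by (simp add: s1_def s2_def)
  have "(s1 + s2)\<^sup>2 \<le> h * (s1 + s2)"
    using le unfolding power2_eq_square by (intro mult_right_mono) (auto simp: s1_def s2_def)
  moreover have "4 * (s1 * s2) \<le> (s1 + s2)\<^sup>2"
    using zero_le_power2[of "s1 - s2"] by (simp add: power2_eq_square algebra_simps)
  moreover have "s1 * (h - s2) + s2 * (h - s1) = h * (s1 + s2) - 2 * (s1 * s2)" by (simp add: algebra_simps)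
  ultimately have "h * (s1 + s2) / 2 \<le> s1 * (h - s2) + s2 * (h - s1)" by linarith
  then have "b * (h * (s1 + s2) / 2) \<le> b * (s1 * (h - s2) + s2 * (h - s1))"
    using b by (rule mult_left_mono)
  also have "\<dots> = (\<Sum>i\<in>S1. \<Sum>j\<in>{h..<2*h} - S2. b) + (\<Sum>i\<in>S2. \<Sum>j\<in>{..<h} - S1. b)"
  proof -
    have "(\<Sum>i\<in>S1. \<Sum>j\<in>{h..<2*h} - S2. b) = s1 * ((h - s2) * b)"
      "(\<Sum>i\<in>S2. \<Sum>j\<in>{..<h} - S1. b) = s2 * ((h - s1) * b)"
      by (simp_all only: sum_constant diff s1_def s2_def)
    then show ?thesis by (simp only:) (simp add: algebra_simps)
  qed
  also have "\<dots> \<le> (\<Sum>i\<in>S1. \<Sum>j\<in>{..<2*h} - S. block_prob h a b i j) +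
      (\<Sum>i\<in>S2. \<Sum>j\<in>{..<2*h} - S. block_prob h a b i j)"
    by (intro add_mono sum_mono half) (auto simp: S1_def S2_def)
  also have "\<dots> = (\<Sum>i\<in>S. \<Sum>j\<in>{..<2*h} - S. block_prob h a b i j)"
    unfolding S12(1) using fin S12(2) by (intro sum.union_disjoint[symmetric])
  finally show ?thesis by (simp add: cS s1_def s2_def algebra_simps)
qed

lemma block_prob_cut_block:
  assumes a: "0 \<le> a" and B: "B \<in> {{..<h}, {h..<2*h}}" and S: "S \<subseteq> B" "2 * card S \<le> card B"
  shows "real (2*h) * a / 4 * card S \<le> (\<Sum>i\<in>S. \<Sum>j\<in>B - S. block_prob h a b i j)"
proof -
  have fin: "finite B" "finite S" and cB: "card B = h" using B S(1) by (auto intro: finite_subset)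
  have "(\<Sum>i\<in>S. \<Sum>j\<in>B - S. block_prob h a b i j) = (\<Sum>i\<in>S. \<Sum>j\<in>B - S. a)"
    using B S(1) by (intro sum.cong refl) (auto simp: block_prob_def)
  also have "\<dots> = a * card S * (real h - card S)"
    using fin S card_mono[OF fin(1) S(1)] by (simp add: card_Diff_subset cB of_nat_diff)
  also have "\<dots> \<ge> a * card S * (real h / 2)"
    using a S(2) cB by (intro mult_left_mono) auto
  finally show ?thesis by (simp add: algebra_simps)
qed

lemma power_one_plus_le:
  fixes x :: real and m n :: nat
  assumes x: "0 \<le> x" "n * x \<le> 1" and m: "m \<le> n"
  shows "(1 + x) ^ m - 1 \<le> 2 * n * x"
proof -
  have "(1 + x) ^ m \<le> exp x ^ m" using x by (intro power_mono exp_ge_add_one_self) auto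
  also have "\<dots> = exp (m * x)" by (simp add: exp_of_nat_mult)
  also have "\<dots> \<le> exp (n * x)" using m x by (simp add: mult_right_mono)
  also have "\<dots> \<le> 1 + n * x + (n * x)\<^sup>2" using x by (intro exp_bound) auto
  also have "(n * x)\<^sup>2 \<le> n * x" using x by (simp add: power2_eq_square mult_left_le)
  finally show ?thesis by (simp add: algebra_simps)
qed

text \<open>The 120 is 3 times 40: expected cuts are at least \<open>n * p / 4\<close> per vertex,
  so \<open>z = exp (- (n * p / 40))\<close> is at most \<open>n^-3\<close>, and the union bound
  costs at most \<open>2 * n * z \<le> 2 / n\<close>. There are three such events, for the whole
  graph and each community; the degrees contribute another \<open>2 / n\<close>.\<close>

lemma (in random_graph) regular_whp:
  fixes a b :: real and h :: nat
  assumes n: "n = 2 * h" and h: "0 < h" and q: "q = block_prob h a b"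
    and a: "120 * ln n \<le> real n * a" and b: "120 * ln n \<le> real n * b"
  obtains A where "A \<in> events" "prob A \<le> 8 / n"
    "\<And>\<omega>. \<omega> \<in> space M - A \<Longrightarrow> regular_graph h a b (X \<omega>)"
proof -
  have npos: "0 < n" and n1: "1 < n" using n h by auto
  have ln0: "0 < ln (real n)" using n1 by simp
  have a0: "0 < a" and b0: "0 < b"
  proof -
    have "0 < p" if "120 * ln n \<le> real n * p" for p :: real
    proof -
      have "0 < real n * p" using that ln0 by linarith
      then show ?thesis using npos by (simp add: zero_less_mult_iff)
    qed
    then show "0 < a" "0 < b" using a b by auto
  qed
  have small: "exp (- (real n * p / 4 / 10)) \<le> 1 / n ^ 3" if "120 * ln n \<le> real n * p" for p :: real
  proof -
    have "exp (- (real n * p / 4 / 10)) \<le> exp (- (3 * ln n))" using that by simp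
    also have "\<dots> = 1 / n ^ 3" using npos by (simp add: exp_minus exp_of_nat_mult[of 3, simplified] inverse_eq_divide)
    finally show ?thesis .
  qed
  have cut_prob: "(1 + exp (- (real n * p / 4 / 10))) ^ card V - 1 \<le> 2 / n"
    if "120 * ln n \<le> real n * p" "V \<subseteq> {..<n}" for p :: real and V
  proof -
    have cV: "card V \<le> n" using card_mono[OF _ that(2)] by simp
    have "n * exp (- (real n * p / 4 / 10)) \<le> n * (1 / n ^ 3)"
      using small[OF that(1)] by (intro mult_left_mono) auto
    also have "\<dots> \<le> 1 / n" using n1 by (simp add: field_simps power3_eq_cube power2_eq_square mult_ge1_I)
    finally have nz: "n * exp (- (real n * p / 4 / 10)) \<le> 1 / n" .
    also have "1 / n \<le> (1 :: real)" using npos by simp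
    finally have nz1: "n * exp (- (real n * p / 4 / 10)) \<le> 1" .
    show ?thesis using power_one_plus_le[OF _ nz1 cV] nz by simp
  qed
  define B1 B2 where "B1 = {..<h}" and "B2 = {h..<2*h}"
  have B: "B1 \<subseteq> {..<n}" "B2 \<subseteq> {..<n}" by (auto simp: B1_def B2_def n)
  obtain A0 where A0: "A0 \<in> events" "prob A0 \<le> (1 + exp (- (real n * b / 4 / 10))) ^ card {..<n} - 1"
    "\<And>\<omega> S. \<omega> \<in> space M - A0 \<Longrightarrow> S \<subseteq> {..<n} \<Longrightarrow> 2 * card S \<le> card {..<n} \<Longrightarrow>
        real n * b / 4 / 2 * card S \<le> edge_count S ({..<n} - S) \<omega>"
    by (rule all_cuts_large[of "{..<n}" "real n * b / 4"])
      (use block_prob_cut_all[of b a _ h] a0 b0 in \<open>auto simp: n q\<close>)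
  have block: "\<exists>A\<in>events. prob A \<le> 2 / n \<and> (\<forall>\<omega>\<in>space M - A. \<forall>S\<subseteq>B. 2 * card S \<le> card B \<longrightarrow>
        real n * a / 4 / 2 * card S \<le> edge_count S (B - S) \<omega>)" if B12: "B \<in> {B1, B2}" for B
  proof -
    have sub: "B \<subseteq> {..<n}" using B12 B by auto
    obtain A where A: "A \<in> events" "prob A \<le> (1 + exp (- (real n * a / 4 / 10))) ^ card B - 1"
      "\<And>\<omega> S. \<omega> \<in> space M - A \<Longrightarrow> S \<subseteq> B \<Longrightarrow> 2 * card S \<le> card B \<Longrightarrow>
          real n * a / 4 / 2 * card S \<le> edge_count S (B - S) \<omega>"
    proof (rule all_cuts_large[OF sub, of "real n * a / 4"])
      fix S assume "S \<subseteq> B" "2 * card S \<le> card B"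
      then show "real n * a / 4 * card S \<le> (\<Sum>i\<in>S. \<Sum>j\<in>B - S. q i j)"
        using block_prob_cut_block[of a B h S b] B12 a0 by (simp add: n q B1_def B2_def)
    qed (rule that)
    then show ?thesis using cut_prob[OF a sub] by (intro bexI[of _ A]) auto
  qed
  obtain A1 where A1: "A1 \<in> events" "prob A1 \<le> 2 / n"
    "\<forall>\<omega>\<in>space M - A1. \<forall>S\<subseteq>B1. 2 * card S \<le> card B1 \<longrightarrow> real n * a / 4 / 2 * card S \<le> edge_count S (B1 - S) \<omega>"
    using block[of B1] by auto
  obtain A2 where A2: "A2 \<in> events" "prob A2 \<le> 2 / n"
    "\<forall>\<omega>\<in>space M - A2. \<forall>S\<subseteq>B2. 2 * card S \<le> card B2 \<longrightarrow> real n * a / 4 / 2 * card S \<le> edge_count S (B2 - S) \<omega>"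
    using block[of B2] by auto
  define blk where "blk i = (if i < h then B1 else B2)" for i
  \<comment> \<open>Both mean degrees are at most \<open>h\<close> times the edge probability, that
    is \<open>n * a / 2\<close> or \<open>n * b / 2\<close>. The vertex \<open>i\<close> is removed
    from its own block because the Chernoff bound needs disjoint sets; the zero diagonal restores it
    later.\<close>
  define Dw where "Dw i = {\<omega>\<in>space M. 3 * (real n * a / 2) \<le> edge_count {i} (blk i - {i}) \<omega>}" for i
  define Db where "Db i = {\<omega>\<in>space M. 3 * (real n * b / 2) \<le> edge_count {i} ({..<n} - blk i) \<omega>}" for i
  have blk: "i \<in> blk i" "blk i \<subseteq> {..<n}" if "i < n" for i
    using that by (auto simp: blk_def B1_def B2_def n)
  have card_blk: "card (blk i) = h" "card ({..<n} - blk i) = h" for i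
  proof -
    have "{..<n} - blk i = (if i < h then B2 else B1)" by (auto simp: blk_def B1_def B2_def n)
    then show "card (blk i) = h" "card ({..<n} - blk i) = h" by (auto simp: blk_def B1_def B2_def)
  qed
  have exp_small: "exp (- (real n * p / 2)) \<le> 1 / n ^ 2" if "120 * ln n \<le> real n * p" for p :: real
  proof -
    have "exp (- (real n * p / 2)) \<le> exp (- (2 * ln n))" using that ln0 by simp
    also have "\<dots> = 1 / n ^ 2" using npos by (simp add: exp_minus exp_of_nat_mult[of 2, simplified] inverse_eq_divide)
    finally show ?thesis .
  qed
  have Dw: "Dw i \<in> events \<and> prob (Dw i) \<le> 1 / n ^ 2" if i: "i < n" for i
  proof -
    note ch = edge_count_chernoff[of "{i}" "blk i - {i}"]
    have m: "(\<Sum>i'\<in>{i}. \<Sum>j\<in>blk i - {i}. q i' j) \<le> real n * a / 2"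
    proof -
      have "(\<Sum>i'\<in>{i}. \<Sum>j\<in>blk i - {i}. q i' j) = (\<Sum>j\<in>blk i - {i}. q i j)" by simp
      also have "\<dots> = (\<Sum>j\<in>blk i - {i}. a)"
        using i by (intro sum.cong refl) (auto simp: q block_prob_def blk_def B1_def B2_def split: if_splits)
      also have "\<dots> \<le> real (card (blk i)) * a"
        using a0 by (simp add: card_Diff1_le)
      finally show ?thesis by (simp add: card_blk n)
    qed
    have "random_variable borel (edge_count {i} (blk i - {i}))" using blk[OF i] i by (intro ch(1)) auto
    then have "Dw i \<in> events" unfolding Dw_def by measurable
    moreover have "prob (Dw i) \<le> exp (- (real n * a / 2))"
      unfolding Dw_def using blk[OF i] i m by (intro ch(3)) auto
    ultimately show ?thesis using exp_small[OF a] by auto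
  qed
  have Db: "Db i \<in> events \<and> prob (Db i) \<le> 1 / n ^ 2" if i: "i < n" for i
  proof -
    note ch = edge_count_chernoff[of "{i}" "{..<n} - blk i"]
    have m: "(\<Sum>i'\<in>{i}. \<Sum>j\<in>{..<n} - blk i. q i' j) \<le> real n * b / 2"
    proof -
      have "(\<Sum>i'\<in>{i}. \<Sum>j\<in>{..<n} - blk i. q i' j) = (\<Sum>j\<in>{..<n} - blk i. q i j)" by simp
      also have "\<dots> = (\<Sum>j\<in>{..<n} - blk i. b)"
        using i by (intro sum.cong refl) (auto simp: q block_prob_def blk_def B1_def B2_def n split: if_splits)
      also have "\<dots> = real h * b" by (simp only: sum_constant card_blk)
      finally show ?thesis by (simp only: n)
    qed
    have "random_variable borel (edge_count {i} ({..<n} - blk i))" using blk[OF i] i by (intro ch(1)) auto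
    then have "Db i \<in> events" unfolding Db_def by measurable
    moreover have "prob (Db i) \<le> exp (- (real n * b / 2))"
      unfolding Db_def using blk[OF i] i m by (intro ch(3)) auto
    ultimately show ?thesis using exp_small[OF b] by auto
  qed
  define D where "D = (\<Union>i<n. Dw i \<union> Db i)"
  have D: "D \<in> events" "prob D \<le> 2 / n"
  proof -
    show "D \<in> events" unfolding D_def using Dw Db by auto
    have "prob D \<le> (\<Sum>i<n. prob (Dw i \<union> Db i))"
      unfolding D_def using Dw Db by (intro finite_measure_subadditive_finite) auto
    also have "\<dots> \<le> (\<Sum>i<n. 1 / n ^ 2 + 1 / n ^ 2)"
    proof (intro sum_mono)
      fix i assume "i \<in> {..<n}"
      then have "prob (Dw i \<union> Db i) \<le> prob (Dw i) + prob (Db i)"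
        using Dw Db by (intro measure_Un_le) auto
      also have "\<dots> \<le> 1 / n ^ 2 + 1 / n ^ 2" using Dw[of i] Db[of i] \<open>i \<in> {..<n}\<close> by (intro add_mono) auto
      finally show "prob (Dw i \<union> Db i) \<le> 1 / n ^ 2 + 1 / n ^ 2" .
    qed
    also have "\<dots> = 2 / n" using npos by (simp add: power2_eq_square)
    finally show "prob D \<le> 2 / n" .
  qed
  define A where "A = A0 \<union> A1 \<union> A2 \<union> D"
  show thesis
  proof (rule that[of A])
    show "A \<in> events" using A0 A1 A2 D by (auto simp: A_def)
    have "prob A0 \<le> 2 / n" using A0(2) cut_prob[OF b, of "{..<n}"] by simp
    moreover have "prob A \<le> prob A0 + prob A1 + prob A2 + prob D"
      using measure_Un_le[of "A0 \<union> A1 \<union> A2" M D] measure_Un_le[of "A0 \<union> A1" M A2] measure_Un_le[of A0 M A1]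
        A0(1) A1(1) A2(1) D(1) unfolding A_def by (simp add: sets.Un)
    ultimately show "prob A \<le> 8 / n" using A1(2) A2(2) D(2) by simp
    fix \<omega> assume w: "\<omega> \<in> space M - A"
    have wM: "\<omega> \<in> space M" using w by simp
    show "regular_graph h a b (X \<omega>)"
      unfolding regular_graph_def n[symmetric] B1_def[symmetric] B2_def[unfolded n[symmetric], symmetric]
    proof (intro conjI ballI allI impI)
      fix S assume "S \<subseteq> {..<n}" "2 * card S \<le> n"
      then show "real n * b / 8 * card S \<le> (\<Sum>i\<in>S. \<Sum>j\<in>{..<n} - S. X \<omega> i j)"
        using A0(3)[of \<omega> S] w by (simp add: A_def edge_count_def)
    next
      fix B S assume "B \<in> {B1, B2}" "S \<subseteq> B" "2 * card S \<le> card B"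
      then show "real n * a / 8 * card S \<le> (\<Sum>i\<in>S. \<Sum>j\<in>B - S. X \<omega> i j)"
        using A1(3) A2(3) w by (auto simp: A_def edge_count_def)
    next
      fix B i assume B: "B \<in> {B1, B2}" "i \<in> B"
      then have Bi: "B = blk i" and i: "i < n" by (auto simp: blk_def B1_def B2_def n)
      have notD: "\<omega> \<notin> Dw i" "\<omega> \<notin> Db i" using w i by (auto simp: A_def D_def)
      have "(\<Sum>j\<in>B. X \<omega> i j) = (\<Sum>j\<in>B - {i}. X \<omega> i j)"
        using X_diag[OF wM i] B by (intro sum.mono_neutral_right) (auto simp: B1_def B2_def)
      then show "(\<Sum>j\<in>B. X \<omega> i j) \<le> 3/2 * (real n * a)"
        using notD(1) wM by (simp add: Dw_def edge_count_def Bi)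
      show "(\<Sum>j\<in>{..<n} - B. X \<omega> i j) \<le> 3/2 * (real n * b)"
        using notD(2) wM by (simp add: Db_def edge_count_def Bi)
    qed
  qed
qed

section \<open>Sub-Gaussian tails\<close>

text \<open>Made for centred variables: the linear term has expectation zero and only the square
  remains. Up to \<open>x = 1\<close> one has \<open>exp x \<le> 1 + x + x^2\<close>; beyond it,
  \<open>x \<le> x^2\<close>.\<close>

lemma exp_le_add_exp_square:
  fixes x :: real
  shows "exp x \<le> x + exp (x\<^sup>2)"
proof -
  have sq: "1 + x\<^sup>2 \<le> exp (x\<^sup>2)" by (rule exp_ge_add_one_self)
  consider "0 \<le> x" "x \<le> 1" | "x > 1" | "x < 0" by linarith
  then show ?thesis
  proof cases
    case 1
    then have "exp x \<le> 1 + x + x\<^sup>2" by (rule exp_bound)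
    then show ?thesis using sq by linarith
  next
    case 2
    then have "x * 1 \<le> x * x" by (intro mult_left_mono) auto
    then have "exp x \<le> exp (x\<^sup>2)" by (simp add: power2_eq_square)
    then show ?thesis using 2 by linarith
  next
    case 3
    define u where "u = - x"
    have u: "u > 0" using 3 by (simp add: u_def)
    \<comment> \<open>The product equals \<open>1 + u^3\<close>.\<close>
    have "1 \<le> (1 - u + u\<^sup>2) * (1 + u)" using u by (simp add: power2_eq_square algebra_simps)
    also have "\<dots> \<le> (1 - u + u\<^sup>2) * exp u"
    proof (intro mult_left_mono exp_ge_add_one_self)
      have "0 \<le> (1 - u)\<^sup>2 + u" using u by simp
      then show "0 \<le> 1 - u + u\<^sup>2" by (simp add: power2_eq_square algebra_simps)
    qed
    finally have "exp (- u) \<le> 1 - u + u\<^sup>2" by (simp add: exp_minus field_simps)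
    then have "exp x \<le> 1 + x + x\<^sup>2" by (simp add: u_def)
    then show ?thesis using sq by linarith
  qed
qed

lemma exp_scaled_le:
  fixes t z :: real
  assumes "0 \<le> t" "t \<le> 1"
  shows "exp (t * z) \<le> 1 + t * (exp z - 1)"
  using convex_onD[OF convex_on_exp[of 1], of t 0 z] assms by (simp add: algebra_simps)

text \<open>Two regimes of \<open>s = t^2 * K^2\<close>. For \<open>s \<le> 1\<close> centring
  removes the linear term, and convexity gives \<open>exp ((t * X)^2) \<le> 1 + s * (g - 1)\<close>,
  with expectation at most \<open>1 + s\<close>. For \<open>s > 1\<close> centring is dispensable:
  \<open>t * X \<le> s / 2 + X^2 / K^2\<close>, and the factor 2 from the moment of \<open>g\<close>
  is at most \<open>exp s\<close>.\<close>

lemma (in prob_space) subgaussian_mgf: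
  fixes X :: "'a \<Rightarrow> real"
  assumes int: "integrable M X" and mean0: "expectation X = 0" and K: "0 < K"
    and psi2: "(\<integral>\<^sup>+\<omega>. ennreal (exp ((X \<omega>)\<^sup>2 / K\<^sup>2)) \<partial>M) \<le> 2"
  shows "(\<integral>\<^sup>+\<omega>. ennreal (exp (t * X \<omega>)) \<partial>M) \<le> ennreal (exp (2 * t\<^sup>2 * K\<^sup>2))"
proof -
  have [measurable]: "random_variable borel X" using int by auto
  define g where "g \<omega> = exp ((X \<omega>)\<^sup>2 / K\<^sup>2)" for \<omega>
  have g0: "g \<omega> \<ge> 0" for \<omega> by (simp add: g_def)
  have [measurable]: "random_variable borel g" unfolding g_def by measurable
  have int_g: "integrable M g"
  proof (rule integrableI_nonneg)
    have "(\<integral>\<^sup>+\<omega>. ennreal (g \<omega>) \<partial>M) \<le> 2" using psi2 by (simp add: g_def)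
    also have "(2 :: ennreal) < \<infinity>" by simp
    finally show "(\<integral>\<^sup>+\<omega>. ennreal (g \<omega>) \<partial>M) < \<infinity>" .
  qed (auto simp: g_def)
  have Eg: "expectation g \<le> 2"
  proof -
    have "ennreal (expectation g) = (\<integral>\<^sup>+\<omega>. ennreal (g \<omega>) \<partial>M)"
      using int_g g0 by (intro nn_integral_eq_integral[symmetric]) auto
    also have "\<dots> \<le> ennreal 2" using psi2 by (simp add: g_def)
    finally show ?thesis by (subst (asm) ennreal_le_iff) auto
  qed
  have bound: "(\<integral>\<^sup>+\<omega>. ennreal (exp (t * X \<omega>)) \<partial>M) \<le> ennreal B"
    if f: "integrable M f" "\<And>\<omega>. exp (t * X \<omega>) \<le> f \<omega>" "expectation f \<le> B" for f B
  proof -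
    have "0 \<le> f \<omega>" for \<omega> using f(2)[of \<omega>] exp_ge_zero[of "t * X \<omega>"] by linarith
    then have "(\<integral>\<^sup>+\<omega>. ennreal (f \<omega>) \<partial>M) = ennreal (expectation f)"
      using f(1) by (intro nn_integral_eq_integral) auto
    moreover have "(\<integral>\<^sup>+\<omega>. ennreal (exp (t * X \<omega>)) \<partial>M) \<le> (\<integral>\<^sup>+\<omega>. ennreal (f \<omega>) \<partial>M)"
      by (intro nn_integral_mono ennreal_leI f)
    ultimately show ?thesis using f(3) by (auto intro: order.trans ennreal_leI)
  qed
  define s where "s = t\<^sup>2 * K\<^sup>2"
  have s0: "s \<ge> 0" by (simp add: s_def)
  show ?thesis
  proof (cases "s \<le> 1")
    case True
    define f where "f \<omega> = t * X \<omega> + (1 + s * (g \<omega> - 1))" for \<omega>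
    have "(\<integral>\<^sup>+\<omega>. ennreal (exp (t * X \<omega>)) \<partial>M) \<le> ennreal (exp (2 * s))"
    proof (rule bound[of f])
      show "integrable M f" unfolding f_def using int int_g by auto
      have "expectation f = t * expectation X + (1 + s * (expectation g - 1))"
        unfolding f_def using int int_g by (simp add: prob_space)
      also have "\<dots> \<le> 1 + s * (2 - 1)" using Eg s0 mean0 by (simp add: mult_left_le)
      also have "\<dots> \<le> exp s" using exp_ge_add_one_self[of s] by simp
      also have "\<dots> \<le> exp (2 * s)" using s0 by simp
      finally show "expectation f \<le> exp (2 * s)" .
      fix \<omega>
      have "(t * X \<omega>)\<^sup>2 = s * ((X \<omega>)\<^sup>2 / K\<^sup>2)" using K by (simp add: s_def power_mult_distrib)
      then have "exp ((t * X \<omega>)\<^sup>2) \<le> 1 + s * (g \<omega> - 1)"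
        unfolding g_def using exp_scaled_le[OF s0 True, of "(X \<omega>)\<^sup>2 / K\<^sup>2"] by simp
      then show "exp (t * X \<omega>) \<le> f \<omega>"
        using exp_le_add_exp_square[of "t * X \<omega>"] by (simp add: f_def)
    qed
    then show ?thesis by (simp add: s_def mult.assoc)
  next
    case False
    have "(\<integral>\<^sup>+\<omega>. ennreal (exp (t * X \<omega>)) \<partial>M) \<le> ennreal (exp (2 * s))"
    proof (rule bound[of "\<lambda>\<omega>. exp (s / 2) * g \<omega>"])
      show "integrable M (\<lambda>\<omega>. exp (s / 2) * g \<omega>)" using int_g by auto
      have "expectation (\<lambda>\<omega>. exp (s / 2) * g \<omega>) = exp (s / 2) * expectation g" by simp
      also have "\<dots> \<le> exp (s / 2) * exp s"
      proof (intro mult_left_mono)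
        have "2 \<le> 1 + s" using False by simp
        then show "expectation g \<le> exp s" using exp_ge_add_one_self[of s] Eg by linarith
      qed simp
      also have "\<dots> = exp (3 / 2 * s)" by (simp flip: exp_add)
      also have "\<dots> \<le> exp (2 * s)" using s0 by simp
      finally show "expectation (\<lambda>\<omega>. exp (s / 2) * g \<omega>) \<le> exp (2 * s)" .
      fix \<omega>
      define r where "r = X \<omega> / K"
      have "0 \<le> (t * K - r)\<^sup>2" by simp
      then have "2 * (t * K * r) \<le> s + r\<^sup>2" by (simp add: s_def power2_eq_square algebra_simps)
      moreover have "t * K * r = t * X \<omega>" using K by (simp add: r_def)
      ultimately have "t * X \<omega> \<le> s / 2 + r\<^sup>2" using zero_le_power2[of r] by linarith
      then have "exp (t * X \<omega>) \<le> exp (s / 2 + r\<^sup>2)" by simp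
      also have "\<dots> = exp (s / 2) * g \<omega>" by (simp add: exp_add g_def r_def power_divide)
      finally show "exp (t * X \<omega>) \<le> exp (s / 2) * g \<omega>" .
    qed
    then show ?thesis by (simp add: s_def mult.assoc)
  qed
qed

text \<open>Tests the supremum with the \<open>k\<close>-th unit vector. Doubling
  \<open>\<sigma>\<close> makes the comparison with the infimum strict, so an admissible
  \<open>K\<close> below \<open>2 * \<sigma>\<close> exists without showing that the infimum is
  attained.\<close>

lemma subg_norm_coordinate:
  assumes le: "subg_norm M Y p \<le> ereal \<sigma>" and \<sigma>: "0 < \<sigma>" and k: "k < p"
  shows "(\<integral>\<^sup>+\<omega>. ennreal (exp ((Y \<omega> k)\<^sup>2 / (2 * \<sigma>)\<^sup>2)) \<partial>M) \<le> 2"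
proof -
  define v :: "nat \<Rightarrow> real" where "v i = of_bool (i = k)" for i
  have v1: "(\<Sum>i<p. (v i)\<^sup>2) = 1" and vY: "(\<Sum>i<p. v i * Y \<omega> i) = Y \<omega> k" for \<omega>
  proof -
    have "(\<Sum>i<p. v i * f i) = f k" for f :: "nat \<Rightarrow> real"
      using k by (subst sum.remove[of _ k]) (auto simp: v_def intro!: sum.neutral)
    from this[of v] this[of "Y \<omega>"] show "(\<Sum>i<p. (v i)\<^sup>2) = 1" "(\<Sum>i<p. v i * Y \<omega> i) = Y \<omega> k"
      by (simp_all add: power2_eq_square v_def)
  qed
  define \<K> where "\<K> = {ereal K |K. K > 0 \<and> (\<integral>\<^sup>+\<omega>. ennreal (exp ((Y \<omega> k)\<^sup>2 / K\<^sup>2)) \<partial>M) \<le> 2}"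
  have "Inf \<K> \<le> subg_norm M Y p"
    unfolding subg_norm_def \<K>_def by (rule SUP_upper2[of v]) (simp_all add: v1 vY)
  also have "\<dots> < ereal (2 * \<sigma>)" using le \<sigma> by (auto intro: le_less_trans)
  finally obtain K where K: "0 < K" "K < 2 * \<sigma>" "(\<integral>\<^sup>+\<omega>. ennreal (exp ((Y \<omega> k)\<^sup>2 / K\<^sup>2)) \<partial>M) \<le> 2"
    by (auto simp: Inf_less_iff \<K>_def)
  have "(\<integral>\<^sup>+\<omega>. ennreal (exp ((Y \<omega> k)\<^sup>2 / (2 * \<sigma>)\<^sup>2)) \<partial>M) \<le> (\<integral>\<^sup>+\<omega>. ennreal (exp ((Y \<omega> k)\<^sup>2 / K\<^sup>2)) \<partial>M)"
  proof (intro nn_integral_mono ennreal_leI exp_le_cancel_iff[THEN iffD2] divide_left_mono)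
    show "K\<^sup>2 \<le> (2 * \<sigma>)\<^sup>2" using K by (intro power_mono) auto
  qed (use K \<sigma> in auto)
  with K(3) show ?thesis by (rule order.trans[rotated])
qed

lemma (in prob_space) subgaussian_linear_tail:
  fixes Y :: "nat \<Rightarrow> 'a \<Rightarrow> real" and x :: "nat \<Rightarrow> real"
  assumes ind: "indep_vars (\<lambda>_. borel) Y {..<n}"
    and int: "\<And>i. i < n \<Longrightarrow> integrable M (Y i)" and mean0: "\<And>i. i < n \<Longrightarrow> expectation (Y i) = 0"
    and \<sigma>: "0 < \<sigma>"
    and psi2: "\<And>i. i < n \<Longrightarrow> (\<integral>\<^sup>+\<omega>. ennreal (exp ((Y i \<omega>)\<^sup>2 / (2 * \<sigma>)\<^sup>2)) \<partial>M) \<le> 2"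
    and x: "sqrt (\<Sum>i<n. (x i)\<^sup>2) \<le> \<rho>" and \<rho>: "0 < \<rho>" and l: "0 \<le> l"
  shows "prob {\<omega>\<in>space M. 12 * \<sigma> * sqrt l * \<rho> < \<bar>\<Sum>i<n. x i * Y i \<omega>\<bar>} \<le> 2 * exp (- (4 * l))"
proof -
  define a where "a = 12 * \<sigma> * sqrt l * \<rho>"
  have rv: "random_variable borel (Y i)" if "i < n" for i using int[OF that] by auto
  have tail: "prob {\<omega>\<in>space M. a \<le> (\<Sum>i<n. y i * Y i \<omega>)} \<le> exp (- (4 * l))"
    if y: "(\<Sum>i<n. (y i)\<^sup>2) \<le> \<rho>\<^sup>2" for y
  proof -
    \<comment> \<open>The minimiser of \<open>- t * a + 8 * t^2 * \<sigma>^2 * \<rho>^2\<close>. The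
      minimum is \<open>- a^2 / (32 * \<sigma>^2 * \<rho>^2)\<close>, and the 12 in \<open>a\<close>
      makes it \<open>- 144 / 32 * l\<close>, below \<open>- 4 * l\<close>.\<close>
    define t where "t = a / (16 * \<sigma>\<^sup>2 * \<rho>\<^sup>2)"
    have t0: "t \<ge> 0" using \<sigma> \<rho> l by (simp add: t_def a_def)
    have "(\<integral>\<^sup>+\<omega>. ennreal (exp (\<Sum>i<n. (t * y i) * Y i \<omega>)) \<partial>M) \<le>
        ennreal (exp (\<Sum>i<n. 2 * (t * y i)\<^sup>2 * (2 * \<sigma>)\<^sup>2))"
      using \<sigma> by (intro nn_integral_exp_sum ind subgaussian_mgf int mean0 psi2) auto
    also have "(\<Sum>i<n. 2 * (t * y i)\<^sup>2 * (2 * \<sigma>)\<^sup>2) = 8 * t\<^sup>2 * \<sigma>\<^sup>2 * (\<Sum>i<n. (y i)\<^sup>2)"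
      by (simp add: sum_distrib_left power_mult_distrib algebra_simps)
    also have "ennreal (exp \<dots>) \<le> ennreal (exp (8 * t\<^sup>2 * \<sigma>\<^sup>2 * \<rho>\<^sup>2))"
      using y by (intro ennreal_leI) (auto intro!: mult_left_mono)
    finally have mgf: "(\<integral>\<^sup>+\<omega>. ennreal (exp (\<Sum>i<n. (t * y i) * Y i \<omega>)) \<partial>M) \<le> \<dots>" .
    have "prob {\<omega>\<in>space M. a \<le> (\<Sum>i<n. y i * Y i \<omega>)} \<le> prob {\<omega>\<in>space M. t * a \<le> (\<Sum>i<n. (t * y i) * Y i \<omega>)}"
    proof (intro finite_measure_mono)
      show "{\<omega>\<in>space M. t * a \<le> (\<Sum>i<n. (t * y i) * Y i \<omega>)} \<in> events" using rv by measurable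
      show "{\<omega>\<in>space M. a \<le> (\<Sum>i<n. y i * Y i \<omega>)} \<subseteq> {\<omega>\<in>space M. t * a \<le> (\<Sum>i<n. (t * y i) * Y i \<omega>)}"
        using t0 by (auto simp: mult.assoc mult_left_mono simp flip: sum_distrib_left)
    qed
    also have "\<dots> \<le> exp (- (t * a)) * exp (8 * t\<^sup>2 * \<sigma>\<^sup>2 * \<rho>\<^sup>2)"
      using rv by (intro exp_Markov mgf) auto
    also have "\<dots> = exp (- (9 / 2 * l))"
    proof -
      have "- (t * a) + 8 * t\<^sup>2 * \<sigma>\<^sup>2 * \<rho>\<^sup>2 = - (a\<^sup>2 / (32 * \<sigma>\<^sup>2 * \<rho>\<^sup>2))"
        using \<sigma> \<rho> by (simp add: t_def power2_eq_square field_simps)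
      also have "\<dots> = - (9 / 2 * l)"
        using \<sigma> \<rho> l by (simp add: a_def power_mult_distrib)
      finally show ?thesis by (simp flip: exp_add)
    qed
    also have "\<dots> \<le> exp (- (4 * l))" using l by simp
    finally show ?thesis .
  qed
  have x2: "(\<Sum>i<n. (x i)\<^sup>2) \<le> \<rho>\<^sup>2" using x \<rho> by (simp add: real_sqrt_le_iff sqrt_le_D)
  have ev: "{\<omega>\<in>space M. a \<le> (\<Sum>i<n. y i * Y i \<omega>)} \<in> events" for y using rv by measurable
  have "prob {\<omega>\<in>space M. a < \<bar>\<Sum>i<n. x i * Y i \<omega>\<bar>} \<le>
      prob ({\<omega>\<in>space M. a \<le> (\<Sum>i<n. x i * Y i \<omega>)} \<union> {\<omega>\<in>space M. a \<le> (\<Sum>i<n. - x i * Y i \<omega>)})"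
    using ev[of x] ev[of "\<lambda>i. - x i"] by (intro finite_measure_mono sets.Un) (auto simp: sum_negf)
  also have "\<dots> \<le> prob {\<omega>\<in>space M. a \<le> (\<Sum>i<n. x i * Y i \<omega>)} + prob {\<omega>\<in>space M. a \<le> (\<Sum>i<n. - x i * Y i \<omega>)}"
    using ev[of x] ev[of "\<lambda>i. - x i"] by (intro measure_Un_le) auto
  also have "\<dots> \<le> exp (- (4 * l)) + exp (- (4 * l))"
    using x2 by (intro add_mono tail) auto
  finally show ?thesis by (simp add: a_def)
qed

section \<open>The noisy block model\<close>

lemma max_abs_entry_le:
  assumes "0 \<le> t" "\<And>i j. i < dim_row A \<Longrightarrow> j < dim_col A \<Longrightarrow> \<bar>A $$ (i, j)\<bar> \<le> t"
  shows "max_abs_entry A \<le> t"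
proof -
  have "{\<bar>A $$ (i, j)\<bar> | i j. i < dim_row A \<and> j < dim_col A} =
      (\<lambda>(i, j). \<bar>A $$ (i, j)\<bar>) ` ({..<dim_row A} \<times> {..<dim_col A})" by force
  then have "finite {\<bar>A $$ (i, j)\<bar> | i j. i < dim_row A \<and> j < dim_col A}" by simp
  then show ?thesis unfolding max_abs_entry_def using assms by (subst Max_le_iff) auto
qed

lemma max_abs_entry_nonneg: "0 \<le> max_abs_entry A"
proof -
  have "{\<bar>A $$ (i, j)\<bar> | i j. i < dim_row A \<and> j < dim_col A} =
      (\<lambda>(i, j). \<bar>A $$ (i, j)\<bar>) ` ({..<dim_row A} \<times> {..<dim_col A})" by force
  then have "finite {\<bar>A $$ (i, j)\<bar> | i j. i < dim_row A \<and> j < dim_col A}" by simp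
  then show ?thesis unfolding max_abs_entry_def by (intro Max_ge) auto
qed

lemma edge_list_cong:
  assumes "\<And>i j. i < j \<Longrightarrow> j < n \<Longrightarrow> \<phi> i j = \<psi> i j"
  shows "edge_list n \<phi> = edge_list n \<psi>"
  unfolding edge_list_def using assms by (intro filter_cong refl) auto

text \<open>Only entries above the diagonal are read, so the random matrix may be replaced by the
  indicator of its edge set.\<close>

lemma incidence_mat_cong:
  assumes eq: "\<And>i j. i < j \<Longrightarrow> j < n \<Longrightarrow> \<phi> i j = \<psi> i j"
  shows "incidence_mat n \<phi> = incidence_mat n \<psi>"
proof -
  have "edge_list n \<phi> = edge_list n \<psi>" using eq by (rule edge_list_cong)
  moreover have "\<phi> i j = \<psi> i j" if "e < length (edge_list n \<psi>)" "edge_list n \<psi> ! e = (i, j)" for e i j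
    using nth_mem[OF that(1)] that(2) eq by (auto simp: set_edge_list)
  ultimately show ?thesis
    unfolding incidence_mat_def Let_def by (intro eq_matI) (auto split: prod.splits)
qed

lemma length_edge_list_le: "length (edge_list n \<phi>) \<le> n\<^sup>2"
  unfolding edge_list_def by (rule order.trans[OF length_filter_le]) (simp add: power2_eq_square)

text \<open>An edge with \<open>i < j\<close> between communities must have
  \<open>i < h \<le> j\<close>, so the cross degrees of the \<open>h\<close> vertices in the first
  community count all of them.\<close>

lemma edge_jump_sum_le:
  fixes \<phi> :: "nat \<Rightarrow> nat \<Rightarrow> real"
  assumes reg: "regular_graph h a b \<phi>" and n: "n = 2 * h" and d: "0 \<le> d"
    and phi: "\<And>i j. i < n \<Longrightarrow> j < n \<Longrightarrow> \<phi> i j \<in> {0, 1}"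
  shows "(\<Sum>(i, j)\<in>set (edge_list n \<phi>). sqrt (\<phi> i j) * (if (i < h) = (j < h) then 0 else d)) \<le>
      3/4 * (real n)\<^sup>2 * b * d"
proof -
  have "(\<Sum>(i, j)\<in>set (edge_list n \<phi>). sqrt (\<phi> i j) * (if (i < h) = (j < h) then 0 else d)) =
      (\<Sum>i<n. \<Sum>j<n. of_bool (i < j) * \<phi> i j * (sqrt (\<phi> i j) * (if (i < h) = (j < h) then 0 else d)))"
    by (rule sum_over_edges[OF phi])
  also have "\<dots> \<le> (\<Sum>i<n. \<Sum>j<n. of_bool (i < h \<and> h \<le> j) * (\<phi> i j * d))"
  proof (intro sum_mono)
    fix i j assume "i \<in> {..<n}" "j \<in> {..<n}"
    then have "\<phi> i j \<in> {0, 1}" by (intro phi) auto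
    then show "of_bool (i < j) * \<phi> i j * (sqrt (\<phi> i j) * (if (i < h) = (j < h) then 0 else d)) \<le>
        of_bool (i < h \<and> h \<le> j) * (\<phi> i j * d)" using d by auto
  qed
  also have "\<dots> = (\<Sum>i<h. \<Sum>j<n. of_bool (i < h \<and> h \<le> j) * (\<phi> i j * d))"
    using n by (intro sum.mono_neutral_right) auto
  also have "\<dots> = (\<Sum>i<h. (\<Sum>j\<in>{..<n} - {..<h}. \<phi> i j) * d)"
    unfolding sum_distrib_right by (intro sum.cong refl sum.mono_neutral_cong_right) auto
  also have "\<dots> \<le> (\<Sum>i<h. 3/2 * (real n * b) * d)"
    using regular_graphD(4)[OF reg, of "{..<h}"] d unfolding n[symmetric]
    by (intro sum_mono mult_right_mono) auto
  also have "\<dots> = 3/4 * (real n)\<^sup>2 * b * d" by (simp add: n power2_eq_square)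
  finally show ?thesis .
qed

lemma pinv_row_norm_le:
  fixes \<phi> :: "nat \<Rightarrow> nat \<Rightarrow> real"
  assumes reg: "regular_graph h a b \<phi>" and n: "n = 2 * h" and h: "0 < h" and a: "0 < a" and b: "0 < b"
    and phi: "\<And>i j. i < n \<Longrightarrow> j < n \<Longrightarrow> \<phi> i j \<in> {0, 1}"
    and sym: "\<And>i j. i < n \<Longrightarrow> j < n \<Longrightarrow> \<phi> i j = \<phi> j i"
  defines "P \<equiv> mp_pinv (incidence_mat n \<phi>)"
  shows "P \<in> carrier_mat (length (edge_list n \<phi>)) n"
    and "e < length (edge_list n \<phi>) \<Longrightarrow> sqrt (\<Sum>i<n. (P $$ (e, i))\<^sup>2) \<le>
      140000 * (1 / (real n * (a + b)) + 1 / (real n * sqrt (real n) * b))"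
proof -
  have nonneg: "0 \<le> \<phi> i j" if "i < n" "j < n" for i j using phi[OF that] by auto
  have n0: "0 < n" using n h by simp
  have conn: "\<forall>x. (\<forall>i<n. (\<Sum>j<n. \<phi> i j * (x i - x j)) = 0) \<longrightarrow> (\<Sum>i<n. x i) = 0 \<longrightarrow>
      (\<forall>i<n. x i = 0)"
  proof (intro allI impI)
    fix x :: "nat \<Rightarrow> real" and i
    assume lap: "\<forall>i<n. (\<Sum>j<n. \<phi> i j * (x i - x j)) = 0" and mean0: "(\<Sum>i<n. x i) = 0" and i: "i < n"
    show "x i = 0"
    proof (rule regular_graph_connected[OF reg h b])
      show "(\<Sum>j<2*h. \<phi> i j * (x i - x j)) = 0" if "i < 2 * h" for i using lap that n by auto
    qed (use sym nonneg mean0 i in \<open>auto simp only: n\<close>)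
  qed
  show "P \<in> carrier_mat (length (edge_list n \<phi>)) n"
    unfolding P_def by (rule pinv_incidence_row(1)[where \<phi> = \<phi> and n = n, OF phi sym n0 conn])
  assume e: "e < length (edge_list n \<phi>)"
  obtain u v where uv: "edge_list n \<phi> ! e = (u, v)" by (cases "edge_list n \<phi> ! e")
  then have "(u, v) \<in> set (edge_list n \<phi>)" using nth_mem[OF e] by simp
  then have uvn: "u < n" "v < n" "u \<noteq> v" by (auto simp: set_edge_list)
  have lap: "(\<Sum>j<n. \<phi> i j * (P $$ (e, i) - P $$ (e, j))) = of_bool (i = u) - of_bool (i = v)" if "i < n" for i
    unfolding P_def by (rule pinv_incidence_row(2)[where \<phi> = \<phi> and n = n, OF phi sym n0 conn e uv that])
  have mean0: "(\<Sum>i<n. P $$ (e, i)) = 0"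
    unfolding P_def by (rule pinv_incidence_row(3)[where \<phi> = \<phi> and n = n, OF phi sym n0 conn e])
  show "sqrt (\<Sum>i<n. (P $$ (e, i))\<^sup>2) \<le>
      140000 * (1 / (real n * (a + b)) + 1 / (real n * sqrt (real n) * b))"
    unfolding n by (rule potential_bound[OF reg h a b])
      (use sym nonneg uvn lap mean0 in \<open>auto simp: n\<close>)
qed

text \<open>Total probability: the disjoint events \<open>C T\<close> have total mass at most 1, so
  the union costs nothing for the number of configurations, which is exponential in the
  application.\<close>

lemma (in prob_space) prob_config_union_le:
  assumes fin: "finite G" and disj: "disjoint_family_on C G" and eps: "0 \<le> \<epsilon>"
    and ev: "\<And>T. T \<in> G \<Longrightarrow> C T \<in> events" "\<And>T. T \<in> G \<Longrightarrow> N T \<in> events"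
    and ind: "\<And>T. T \<in> G \<Longrightarrow> prob (C T \<inter> N T) = prob (C T) * prob (N T)"
    and le: "\<And>T. T \<in> G \<Longrightarrow> prob (N T) \<le> \<epsilon>"
  shows "prob (\<Union>T\<in>G. C T \<inter> N T) \<le> \<epsilon>"
proof -
  have "prob (\<Union>T\<in>G. C T \<inter> N T) \<le> (\<Sum>T\<in>G. prob (C T \<inter> N T))"
    using fin ev by (intro finite_measure_subadditive_finite) auto
  also have "\<dots> \<le> (\<Sum>T\<in>G. prob (C T) * \<epsilon>)"
    by (intro sum_mono) (simp add: ind le mult_left_mono)
  also have "\<dots> = prob (\<Union>T\<in>G. C T) * \<epsilon>"
    using fin disj ev by (subst finite_measure_finite_Union) (auto simp: sum_distrib_right)
  also have "\<dots> \<le> \<epsilon>" using eps by (simp add: mult_left_le_one_le)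
  finally show ?thesis .
qed

section \<open>The model at a fixed size, conditioned on the graph\<close>

locale subgaussian_noise = prob_space +
  fixes n p :: nat and E :: "'a \<Rightarrow> nat \<Rightarrow> nat \<Rightarrow> real" and \<sigma> :: real
  assumes sigma_pos: "0 < \<sigma>"
    and E_rows: "indep_vars (\<lambda>_. PiM {..<p} (\<lambda>_. borel)) (\<lambda>i \<omega>. \<lambda>k\<in>{..<p}. E \<omega> i k) {..<n}"
    and E_mean: "\<And>i k. i < n \<Longrightarrow> k < p \<Longrightarrow>
        integrable M (\<lambda>\<omega>. E \<omega> i k) \<and> expectation (\<lambda>\<omega>. E \<omega> i k) = 0"
    and E_norm: "\<And>i. i < n \<Longrightarrow> subg_norm M (\<lambda>\<omega>. E \<omega> i) p \<le> ereal \<sigma>"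
begin

lemma noise_tail:
  assumes k: "k < p" and x: "sqrt (\<Sum>i<n. (x i)\<^sup>2) \<le> \<rho>" and \<rho>: "0 < \<rho>" and l: "0 \<le> l"
  shows "prob {\<omega>\<in>space M. 12 * \<sigma> * sqrt l * \<rho> < \<bar>\<Sum>i<n. x i * E \<omega> i k\<bar>} \<le> 2 * exp (- (4 * l))"
proof (rule subgaussian_linear_tail[where Y = "\<lambda>i \<omega>. E \<omega> i k", OF _ _ _ sigma_pos _ x \<rho> l])
  have "(\<lambda>f. f k) \<in> measurable (PiM {..<p} (\<lambda>_. borel)) (borel :: real measure)"
    using k by (intro measurable_component_singleton) simp
  from indep_vars_compose2[where Y = "\<lambda>_ f. f k" and N = "\<lambda>_. borel", OF E_rows this]
  show "indep_vars (\<lambda>_. borel) (\<lambda>i \<omega>. E \<omega> i k) {..<n}" using k by simp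
  show "(\<integral>\<^sup>+\<omega>. ennreal (exp ((E \<omega> i k)\<^sup>2 / (2 * \<sigma>)\<^sup>2)) \<partial>M) \<le> 2" if "i < n" for i
    by (rule subg_norm_coordinate[OF E_norm[OF that] sigma_pos k])
qed (use E_mean k in auto)

end

text \<open>The asymptotic rates enter only through the last two assumptions, the thresholds of
  \<open>regular_whp\<close>.\<close>

locale noisy_block_model =
  random_graph M "2 * h" \<Phi> "block_prob h a b" + subgaussian_noise M "2 * h" p E \<sigma>
  for M :: "'a measure" and h p :: nat and \<Phi> E :: "'a \<Rightarrow> nat \<Rightarrow> nat \<Rightarrow> real" and a b \<sigma> :: real +
  assumes h: "0 < h"
    and indep: "indep_var
          (PiM ({..<2*h} \<times> {..<p}) (\<lambda>_. borel)) (\<lambda>\<omega>. \<lambda>ik\<in>{..<2*h} \<times> {..<p}. E \<omega> (fst ik) (snd ik))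
          (PiM {(i, j). i < j \<and> j < 2*h} (\<lambda>_. borel))
          (\<lambda>\<omega>. \<lambda>e\<in>{(i, j). i < j \<and> j < 2*h}. \<Phi> \<omega> (fst e) (snd e))"
    and a: "120 * ln (real (2 * h)) \<le> real (2 * h) * a" and b: "120 * ln (real (2 * h)) \<le> real (2 * h) * b"
begin

abbreviation n :: nat where "n \<equiv> 2 * h"

definition pairs :: "(nat \<times> nat) set" where "pairs = {(i, j). i < j \<and> j < n}"

text \<open>The graph takes finitely many values, so conditioning on it amounts to a finite union of events
  \<open>config \<omega> = T\<close>, each independent of \<open>noisy T\<close>.\<close>

definition config :: "'a \<Rightarrow> (nat \<times> nat) set" where
  "config \<omega> = {e\<in>pairs. \<Phi> \<omega> (fst e) (snd e) = 1}"

text \<open>A function of the edge set alone, so that for fixed \<open>T\<close> the coefficients in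
  \<open>noisy T\<close> are deterministic and the event depends on the noise only.\<close>

definition pinv :: "(nat \<times> nat) set \<Rightarrow> real mat" where
  "pinv T = mp_pinv (incidence_mat n (\<lambda>i j. of_bool ((i, j) \<in> T)))"

definition \<rho> :: real where "\<rho> = 140000 * (1 / (real n * (a + b)) + 1 / (real n * sqrt (real n) * b))"

definition noise_level :: real where "noise_level = 12 * \<sigma> * sqrt (ln n) * \<rho>"

definition noisy :: "(nat \<times> nat) set \<Rightarrow> 'a set" where
  "noisy T = {\<omega>\<in>space M. \<exists>e<dim_row (pinv T). \<exists>k<p. noise_level < \<bar>\<Sum>i<n. pinv T $$ (e, i) * E \<omega> i k\<bar>}"

lemma ab_pos: "0 < a" "0 < b"
proof -
  have "0 < x" if "120 * ln (real (2 * h)) \<le> real (2 * h) * x" for x :: real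
  proof -
    have "0 < ln (real (2 * h))" using h by (intro ln_gt_zero) simp
    then have "0 < real (2 * h) * x" using that by simp
    then show ?thesis using h by (simp add: zero_less_mult_iff)
  qed
  then show "0 < a" "0 < b" using a b by auto
qed

lemma rho_pos: "0 < \<rho>"
  unfolding \<rho>_def using h ab_pos by (intro mult_pos_pos add_pos_pos divide_pos_pos) auto

lemma finite_pairs: "finite pairs"
  by (rule finite_subset[of _ "{..<n} \<times> {..<n}"]) (auto simp: pairs_def)

lemma config_agrees:
  assumes "\<omega> \<in> space M" "i < j" "j < n"
  shows "\<Phi> \<omega> i j = of_bool ((i, j) \<in> config \<omega>)"
  using X_01[OF assms(1), of i j] assms by (auto simp: config_def pairs_def)

lemma pinv_config:
  assumes w: "\<omega> \<in> space M"
  shows "mp_pinv (incidence_mat n (\<Phi> \<omega>)) = pinv (config \<omega>)"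
  unfolding pinv_def using config_agrees[OF w]
  by (auto intro!: arg_cong[of _ _ mp_pinv] incidence_mat_cong)

lemma noisy_event: "noisy T \<in> events"
proof -
  have "random_variable borel (\<lambda>\<omega>. E \<omega> i k)" if "i < n" "k < p" for i k using E_mean[OF that] by auto
  then have "random_variable borel (\<lambda>\<omega>. \<bar>\<Sum>i<n. pinv T $$ (e, i) * E \<omega> i k\<bar>)" if "k < p" for e k
    using that by (intro borel_measurable_abs borel_measurable_sum) auto
  then have "(\<Union>e\<in>{..<dim_row (pinv T)}. \<Union>k\<in>{..<p}.
      {\<omega>\<in>space M. noise_level < \<bar>\<Sum>i<n. pinv T $$ (e, i) * E \<omega> i k\<bar>}) \<in> events"
    by (intro sets.finite_UN) auto
  also have "(\<Union>e\<in>{..<dim_row (pinv T)}. \<Union>k\<in>{..<p}.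
      {\<omega>\<in>space M. noise_level < \<bar>\<Sum>i<n. pinv T $$ (e, i) * E \<omega> i k\<bar>}) = noisy T"
    by (auto simp: noisy_def)
  finally show ?thesis .
qed

text \<open>Both events are preimages, under the two jointly independent maps, of measurable sets
  \<open>XA\<close> and \<open>XB\<close> in the product spaces.\<close>

lemma config_event_indep:
  "{\<omega>\<in>space M. config \<omega> = T} \<in> events \<and>
   prob ({\<omega>\<in>space M. config \<omega> = T} \<inter> noisy T) = prob {\<omega>\<in>space M. config \<omega> = T} * prob (noisy T)"
proof -
  define MA where "MA = PiM ({..<n} \<times> {..<p}) (\<lambda>_. borel :: real measure)"
  define MB where "MB = PiM pairs (\<lambda>_. borel :: real measure)"
  define fA where "fA = (\<lambda>\<omega>. \<lambda>ik\<in>{..<n} \<times> {..<p}. E \<omega> (fst ik) (snd ik))"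
  define fB where "fB = (\<lambda>\<omega>. \<lambda>e\<in>pairs. \<Phi> \<omega> (fst e) (snd e))"
  have ind: "indep_var MA fA MB fB"
    unfolding MA_def MB_def fA_def fB_def pairs_def by (rule indep)
  define XA where "XA = {f\<in>space MA. \<exists>e\<in>{..<dim_row (pinv T)}. \<exists>k\<in>{..<p}.
      noise_level < \<bar>\<Sum>i<n. pinv T $$ (e, i) * f (i, k)\<bar>}"
  \<comment> \<open>A configuration always consists of pairs, so for any other \<open>T\<close> the
    event is empty; the conjunct \<open>T \<subseteq> pairs\<close> makes \<open>XB\<close> empty
    too.\<close>
  define XB where "XB = {f\<in>space MB. T \<subseteq> pairs \<and> (\<forall>e\<in>pairs. (f e = 1) = (e \<in> T))}"
  have rvA: "(\<lambda>f. f (i, k)) \<in> borel_measurable MA" if "i < n" "k < p" for i k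
    unfolding MA_def using that by (intro measurable_component_singleton) auto
  have "XA \<in> sets MA"
    unfolding XA_def
  proof (intro sets.sets_Collect_finite_Ex)
    fix e k assume "k \<in> {..<p}"
    then have "(\<lambda>f. \<bar>\<Sum>i<n. pinv T $$ (e, i) * f (i, k)\<bar>) \<in> borel_measurable MA"
      by (intro borel_measurable_abs borel_measurable_sum borel_measurable_times rvA) auto
    then show "{f\<in>space MA. noise_level < \<bar>\<Sum>i<n. pinv T $$ (e, i) * f (i, k)\<bar>} \<in> sets MA" by measurable
  qed auto
  moreover have "XB \<in> sets MB"
  proof -
    have rv: "(\<lambda>f. f e) \<in> borel_measurable MB" if "e \<in> pairs" for e
      unfolding MB_def using that by (rule measurable_component_singleton)
    have "{f\<in>space MB. (f e = 1) = (e \<in> T)} \<in> sets MB" if "e \<in> pairs" for e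
      using rv[OF that] by measurable
    then have "{f\<in>space MB. \<forall>e\<in>pairs. (f e = 1) = (e \<in> T)} \<in> sets MB"
      using finite_pairs by (intro sets.sets_Collect_finite_All) auto
    then show ?thesis by (cases "T \<subseteq> pairs") (auto simp: XB_def)
  qed
  ultimately have XAB: "XA \<in> sets MA" "XB \<in> sets MB" .
  have pA: "fA -` XA \<inter> space M = noisy T"
    by (auto simp: XA_def fA_def MA_def noisy_def space_PiM)
  have pB: "fB -` XB \<inter> space M = {\<omega>\<in>space M. config \<omega> = T}"
  proof -
    have "(config \<omega> = T) = (T \<subseteq> pairs \<and> (\<forall>e\<in>pairs. (\<Phi> \<omega> (fst e) (snd e) = 1) = (e \<in> T)))" for \<omega>
      unfolding config_def by blast
    then show ?thesis by (auto simp: XB_def fB_def MB_def space_PiM)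
  qed
  have "{\<omega>\<in>space M. config \<omega> = T} \<in> events"
    using ind XAB(2) unfolding pB[symmetric] by (auto intro: measurable_sets dest: indep_var_rv2)
  moreover have "(\<lambda>\<omega>. (fA \<omega>, fB \<omega>)) -` (XA \<times> XB) \<inter> space M = {\<omega>\<in>space M. config \<omega> = T} \<inter> noisy T"
    unfolding pA[symmetric] pB[symmetric] by auto
  ultimately show ?thesis using indep_varD[OF ind XAB] unfolding pA pB by (simp add: mult.commute)
qed

text \<open>The point \<open>\<omega>\<close> only witnesses that this edge set comes from a regular
  graph; the probability is over all noise. At most \<open>n^2\<close> rows and \<open>p\<close>
  columns, each failing with probability at most \<open>2 / n^4\<close>, make up the union
  bound.\<close>

lemma noisy_prob_le:
  assumes w: "\<omega> \<in> space M" and reg: "regular_graph h a b (\<Phi> \<omega>)"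
  shows "prob (noisy (config \<omega>)) \<le> 2 * p / n"
proof -
  define T where "T = config \<omega>"
  note row = pinv_row_norm_le[OF reg refl h ab_pos X_01[OF w] X_sym[OF w], unfolded pinv_config[OF w] T_def[symmetric] \<rho>_def[symmetric]]
  have len: "dim_row (pinv T) = length (edge_list n (\<Phi> \<omega>))" using row(1) by simp
  have n1: "1 \<le> real n" using h by simp
  define B where "B e k = {\<omega>\<in>space M. noise_level < \<bar>\<Sum>i<n. pinv T $$ (e, i) * E \<omega> i k\<bar>}" for e k
  have B: "B e k \<in> events \<and> prob (B e k) \<le> 2 / real n ^ 4" if "e < dim_row (pinv T)" "k < p" for e k
  proof
    have "random_variable borel (\<lambda>\<omega>. E \<omega> i k)" if "i < n" for i using E_mean[OF that \<open>k < p\<close>] by auto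
    then have "random_variable borel (\<lambda>\<omega>. \<bar>\<Sum>i<n. pinv T $$ (e, i) * E \<omega> i k\<bar>)"
      by (intro borel_measurable_abs borel_measurable_sum) auto
    then show "B e k \<in> events" unfolding B_def by measurable
    have "prob (B e k) \<le> 2 * exp (- (4 * ln n))"
      unfolding B_def noise_level_def using that n1
      by (intro noise_tail row(2) rho_pos ln_ge_zero) (auto simp: len)
    also have "exp (- (4 * ln n)) = 1 / real n ^ 4"
      using n1 h by (simp add: exp_minus exp_of_nat_mult[of 4, simplified] inverse_eq_divide)
    finally show "prob (B e k) \<le> 2 / real n ^ 4" by simp
  qed
  have "noisy T = (\<Union>(e, k)\<in>{..<dim_row (pinv T)} \<times> {..<p}. B e k)"
    by (auto simp: noisy_def B_def)
  also have "prob \<dots> \<le> (\<Sum>(e, k)\<in>{..<dim_row (pinv T)} \<times> {..<p}. prob (B e k))"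
    using finite_measure_subadditive_finite[of "{..<dim_row (pinv T)} \<times> {..<p}" "\<lambda>x. B (fst x) (snd x)"] B
    by (simp add: case_prod_beta image_subset_iff)
  also have "\<dots> \<le> (\<Sum>(e, k)\<in>{..<dim_row (pinv T)} \<times> {..<p}. 2 / real n ^ 4)"
    using B by (intro sum_mono) auto
  also have "\<dots> = real (dim_row (pinv T)) * (p * (2 / real n ^ 4))" by simp
  also have "\<dots> \<le> (real n)\<^sup>2 * (p * (2 / real n ^ 4))"
  proof (intro mult_right_mono)
    show "real (dim_row (pinv T)) \<le> (real n)\<^sup>2"
      unfolding len of_nat_power[symmetric] of_nat_le_iff by (rule length_edge_list_le)
  qed simp
  also have "\<dots> = 2 * p / (real n)\<^sup>2" using n1 by (simp add: field_simps power2_eq_square power4_eq_xxxx)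
  also have "\<dots> \<le> 2 * p / n"
    using n1 h by (intro divide_left_mono) (auto simp: power2_eq_square)
  finally show ?thesis by (simp add: T_def)
qed

lemma statistic_le:
  assumes w: "\<omega> \<in> space M" and reg: "regular_graph h a b (\<Phi> \<omega>)" and quiet: "\<omega> \<notin> noisy (config \<omega>)"
    and d: "0 \<le> d" and ab: "a + b \<le> 2"
  shows "max_abs_entry (mp_pinv (incidence_mat n (\<Phi> \<omega>)) * mat n p (\<lambda>(i, k). E \<omega> i k)) / n *
      (\<Sum>(i, j)\<in>set (edge_list n (\<Phi> \<omega>)). sqrt (\<Phi> \<omega> i j) * (if (i < h) = (j < h) then 0 else d))
    \<le> 2520000 * \<sigma> * d * (sqrt (ln n) * (b / (a + b) + 1 / (sqrt n * (a + b))))"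
proof -
  define T where "T = config \<omega>"
  have cP: "pinv T \<in> carrier_mat (length (edge_list n (\<Phi> \<omega>))) n"
    using pinv_row_norm_le(1)[OF reg refl h ab_pos X_01[OF w] X_sym[OF w]] by (simp add: pinv_config[OF w] T_def)
  have n1: "1 \<le> real n" using h by simp
  have lvl: "0 \<le> noise_level"
    unfolding noise_level_def using sigma_pos rho_pos n1 by (intro mult_nonneg_nonneg) auto
  have max_le: "max_abs_entry (pinv T * mat n p (\<lambda>(i, k). E \<omega> i k)) \<le> noise_level"
  proof (rule max_abs_entry_le[OF lvl])
    fix e k assume "e < dim_row (pinv T * mat n p (\<lambda>(i, k). E \<omega> i k))" "k < dim_col (pinv T * mat n p (\<lambda>(i, k). E \<omega> i k))"
    then have ek: "e < dim_row (pinv T)" "k < p" by auto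
    then have "(pinv T * mat n p (\<lambda>(i, k). E \<omega> i k)) $$ (e, k) = (\<Sum>i<n. pinv T $$ (e, i) * E \<omega> i k)"
      using cP by (simp add: scalar_prod_def atLeast0LessThan)
    moreover have "\<bar>\<Sum>i<n. pinv T $$ (e, i) * E \<omega> i k\<bar> \<le> noise_level"
      using quiet w ek unfolding noisy_def T_def not_less[symmetric] by blast
    ultimately show "\<bar>(pinv T * mat n p (\<lambda>(i, k). E \<omega> i k)) $$ (e, k)\<bar> \<le> noise_level" by simp
  qed
  define S where "S = (\<Sum>(i, j)\<in>set (edge_list n (\<Phi> \<omega>)). sqrt (\<Phi> \<omega> i j) * (if (i < h) = (j < h) then 0 else d))"
  have S: "S \<le> 3/4 * (real n)\<^sup>2 * b * d"
    unfolding S_def by (rule edge_jump_sum_le[OF reg refl d X_01[OF w]])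
  have S0: "0 \<le> S"
    unfolding S_def using d by (intro sum_nonneg) (auto simp: set_edge_list)
  have "max_abs_entry (pinv T * mat n p (\<lambda>(i, k). E \<omega> i k)) / n * S \<le>
      noise_level / n * (3/4 * (real n)\<^sup>2 * b * d)"
    using max_le S S0 lvl n1 by (intro mult_mono divide_right_mono divide_nonneg_nonneg) auto
  \<comment> \<open>\<open>12 * 3/4 = 9\<close> from noise level and edge sum, times the 140000 in
    \<open>\<rho>\<close>.\<close>
  also have "\<dots> = 1260000 * \<sigma> * d * sqrt (ln n) * (b / (a + b) + 1 / sqrt n)"
  proof -
    have "noise_level / n * (3/4 * (real n)\<^sup>2 * b * d) = 9 * \<sigma> * d * sqrt (ln n) * (n * b * \<rho>)"
      using n1 by (simp add: noise_level_def power2_eq_square field_simps)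
    also have "n * b * \<rho> = 140000 * (b / (a + b) + 1 / sqrt n)"
    proof -
      have "real n * b * (1 / (real n * (a + b))) = b / (a + b)" using n1 by simp
      moreover have "real n * b * (1 / (real n * sqrt n * b)) = 1 / sqrt n" using n1 ab_pos by simp
      ultimately show ?thesis unfolding \<rho>_def by (simp only: distrib_left mult.left_commute[of _ 140000])
    qed
    finally show ?thesis by simp
  qed
  \<comment> \<open>Since \<open>a + b \<le> 2\<close>, the term \<open>1 / sqrt n\<close> is at
    most twice \<open>1 / (sqrt n * (a + b))\<close>.\<close>
  also have "\<dots> \<le> 1260000 * \<sigma> * d * sqrt (ln n) * (2 * (b / (a + b) + 1 / (sqrt n * (a + b))))"
  proof (intro mult_left_mono)
    have "1 / sqrt n * (a + b) \<le> 1 / sqrt n * 2" using ab n1 by (intro mult_left_mono) auto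
    then have "1 / sqrt n * (a + b) / (a + b) \<le> 1 / sqrt n * 2 / (a + b)"
      using ab_pos by (intro divide_right_mono) auto
    moreover have "1 / sqrt n * (a + b) / (a + b) = 1 / sqrt n" using ab_pos by simp
    ultimately have "1 / sqrt n \<le> 2 / (sqrt n * (a + b))" by simp
    moreover have "0 \<le> b / (a + b)" using ab_pos by simp
    ultimately show "b / (a + b) + 1 / sqrt n \<le> 2 * (b / (a + b) + 1 / (sqrt n * (a + b)))" by simp
  qed (use sigma_pos d n1 in auto)
  finally show ?thesis unfolding pinv_config[OF w] S_def[symmetric] T_def[symmetric] by (simp add: mult_ac)
qed

lemma statistic_whp:
  assumes d: "0 \<le> d" and ab: "a + b \<le> 2"
  shows "\<exists>A\<in>events. prob A \<le> (8 + 2 * p) / n \<and> (\<forall>\<omega>\<in>space M - A.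
      max_abs_entry (mp_pinv (incidence_mat n (\<Phi> \<omega>)) * mat n p (\<lambda>(i, k). E \<omega> i k)) / n *
      (\<Sum>(i, j)\<in>set (edge_list n (\<Phi> \<omega>)). sqrt (\<Phi> \<omega> i j) * (if (i < h) = (j < h) then 0 else d))
    \<le> 2520000 * \<sigma> * d * (sqrt (ln n) * (b / (a + b) + 1 / (sqrt n * (a + b)))))"
proof -
  obtain A0 where A0: "A0 \<in> events" "prob A0 \<le> 8 / n"
    "\<And>\<omega>. \<omega> \<in> space M - A0 \<Longrightarrow> regular_graph h a b (\<Phi> \<omega>)"
    using regular_whp[OF refl h refl] a b by auto
  \<comment> \<open>Only configurations occurring outside \<open>A0\<close> are collected, so each
    belongs to a regular graph and \<open>noisy_prob_le\<close> applies.\<close>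
  define G where "G = config ` (space M - A0)"
  define C where "C T = {\<omega>\<in>space M. config \<omega> = T}" for T
  define A1 where "A1 = (\<Union>T\<in>G. C T \<inter> noisy T)"
  have finG: "finite G"
    by (rule finite_subset[of _ "Pow pairs"]) (auto simp: G_def config_def finite_pairs)
  have A1_ev: "A1 \<in> events"
    unfolding A1_def using finG config_event_indep noisy_event by (intro sets.finite_UN) (auto simp: C_def)
  have "prob A1 \<le> 2 * p / n"
    unfolding A1_def
  proof (rule prob_config_union_le[OF finG])
    show "disjoint_family_on C G" by (auto simp: disjoint_family_on_def C_def)
    show "prob (noisy T) \<le> 2 * p / n" if "T \<in> G" for T
      using that A0(3) noisy_prob_le by (auto simp: G_def)
  qed (use config_event_indep noisy_event in \<open>auto simp: C_def\<close>)
  moreover have "prob (A0 \<union> A1) \<le> prob A0 + prob A1" using A0(1) A1_ev by (intro measure_Un_le)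
  ultimately have "prob (A0 \<union> A1) \<le> (8 + 2 * p) / n" using A0(2) by (simp add: add_divide_distrib)
  moreover have "\<omega> \<notin> noisy (config \<omega>)" if "\<omega> \<in> space M - (A0 \<union> A1)" for \<omega>
    using that by (auto simp: A1_def G_def C_def)
  ultimately have *: "prob (A0 \<union> A1) \<le> (8 + 2 * p) / n"
    "\<And>\<omega>. \<omega> \<in> space M - (A0 \<union> A1) \<Longrightarrow> \<omega> \<notin> noisy (config \<omega>)" by blast+
  show ?thesis
  proof (intro bexI[of _ "A0 \<union> A1"] conjI ballI)
    show "A0 \<union> A1 \<in> events" using A0(1) A1_ev by (rule sets.Un)
    fix \<omega> assume w: "\<omega> \<in> space M - (A0 \<union> A1)"
    then have "\<omega> \<in> space M" "regular_graph h a b (\<Phi> \<omega>)" using A0(3) by auto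
    from statistic_le[OF this *(2)[OF w] d ab]
    show "max_abs_entry (mp_pinv (incidence_mat n (\<Phi> \<omega>)) * mat n p (\<lambda>(i, k). E \<omega> i k)) / n *
        (\<Sum>(i, j)\<in>set (edge_list n (\<Phi> \<omega>)). sqrt (\<Phi> \<omega> i j) * (if (i < h) = (j < h) then 0 else d))
      \<le> 2520000 * \<sigma> * d * (sqrt (ln n) * (b / (a + b) + 1 / (sqrt n * (a + b))))" .
  qed (rule *(1))
qed

end

section \<open>Passage to the limit along even sizes\<close>

lemma eventually_even_at_top:
  "eventually P even_at_top \<longleftrightarrow> eventually (\<lambda>n. even n \<longrightarrow> P n) at_top"
  by (simp add: even_at_top_def eventually_inf_principal)

lemma even_at_top_le: "even_at_top \<le> at_top"
  by (simp add: even_at_top_def)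

theorem theorem3p5:
  fixes M :: "nat \<Rightarrow> 'a measure"
    and E :: "nat \<Rightarrow> 'a \<Rightarrow> nat \<Rightarrow> nat \<Rightarrow> real"
    and Phi :: "nat \<Rightarrow> 'a \<Rightarrow> nat \<Rightarrow> nat \<Rightarrow> real"
    and c1 c2 :: "nat \<Rightarrow> real"
    and p :: nat and \<sigma> :: real
    and pw pb :: "nat \<Rightarrow> real"
    and U :: "nat \<Rightarrow> nat \<Rightarrow> nat \<Rightarrow> real"
  defines "U \<equiv> (\<lambda>n i. if i < n div 2 then c1 else c2)"
  assumes p_pos: "p > 0" and sigma_pos: "\<sigma> > 0"
    and prob: "\<And>n. even n \<Longrightarrow> prob_space (M n)"
    and E_indep_rows: "\<And>n. even n \<Longrightarrow> prob_space.indep_vars (M n) (\<lambda>_. PiM {..<p} (\<lambda>_. borel))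
          (\<lambda>i \<omega>. \<lambda>k\<in>{..<p}. E n \<omega> i k) {..<n}"
    and E_mean_zero: "\<And>n i k. even n \<Longrightarrow> i < n \<Longrightarrow> k < p \<Longrightarrow>
          integrable (M n) (\<lambda>\<omega>. E n \<omega> i k) \<and> (\<integral>\<omega>. E n \<omega> i k \<partial>M n) = 0"
    and E_subg: "\<And>n i. even n \<Longrightarrow> i < n \<Longrightarrow> subg_norm (M n) (\<lambda>\<omega>. E n \<omega> i) p = ereal \<sigma>"
    and Phi_01: "\<And>n \<omega> i j. even n \<Longrightarrow> \<omega> \<in> space (M n) \<Longrightarrow> i < n \<Longrightarrow> j < n \<Longrightarrow>
          Phi n \<omega> i j \<in> {0, 1}"
    and Phi_sym: "\<And>n \<omega> i j. even n \<Longrightarrow> \<omega> \<in> space (M n) \<Longrightarrow> i < n \<Longrightarrow> j < n \<Longrightarrow>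
          Phi n \<omega> i j = Phi n \<omega> j i"
    and Phi_diag: "\<And>n \<omega> i. even n \<Longrightarrow> \<omega> \<in> space (M n) \<Longrightarrow> i < n \<Longrightarrow> Phi n \<omega> i i = 0"
    and Phi_indep: "\<And>n. even n \<Longrightarrow> prob_space.indep_vars (M n) (\<lambda>_. borel)
          (\<lambda>e \<omega>. Phi n \<omega> (fst e) (snd e)) {(i, j). i < j \<and> j < n}"
    and Phi_bernoulli: "\<And>n i j. even n \<Longrightarrow> i < j \<Longrightarrow> j < n \<Longrightarrow>
          measure (M n) {\<omega> \<in> space (M n). Phi n \<omega> i j = 1} =
            (if (\<forall>k<p. U n i k = U n j k) then pw n else pb n)"
    and E_Phi_indep: "\<And>n. even n \<Longrightarrow> prob_space.indep_var (M n)
          (PiM ({..<n} \<times> {..<p}) (\<lambda>_. borel)) (\<lambda>\<omega>. \<lambda>ik\<in>{..<n} \<times> {..<p}. E n \<omega> (fst ik) (snd ik))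
          (PiM {(i, j). i < j \<and> j < n} (\<lambda>_. borel)) (\<lambda>\<omega>. \<lambda>e\<in>{(i, j). i < j \<and> j < n}. Phi n \<omega> (fst e) (snd e))"
    and pw_rate: "(\<lambda>n. ln (real n) / real n) \<in> o[even_at_top](pw)"
    and pb_rate: "(\<lambda>n. ln (real n) / real n) \<in> o[even_at_top](pb)"
    and ratio_rate: "(\<lambda>n. ln (real n)) \<in> o[even_at_top](\<lambda>n. real n * (pb n)\<^sup>2 / (pw n + pb n))"
  shows "bounded_in_prob even_at_top M
           (\<lambda>n \<omega>. max_abs_entry (mp_pinv (incidence_mat n (Phi n \<omega>)) * mat n p (\<lambda>(i, k). E n \<omega> i k))
                    / real n *
                  (\<Sum>(i, j) \<in> set (edge_list n (Phi n \<omega>)).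
                     sqrt (Phi n \<omega> i j) * sqrt (\<Sum>k<p. (U n i k - U n j k)\<^sup>2)))
           (\<lambda>n. sqrt (ln (real n)) * (pb n / (pw n + pb n) + 1 / (sqrt (real n) * (pw n + pb n))))
       \<and> (((\<lambda>n. sqrt (ln (real n) / real n)) \<in> o[even_at_top](pw) \<and>
            (\<lambda>n. pb n * sqrt (ln (real n))) \<in> o[even_at_top](pw)) \<longrightarrow>
          tendsto_zero_in_prob even_at_top M
           (\<lambda>n \<omega>. max_abs_entry (mp_pinv (incidence_mat n (Phi n \<omega>)) * mat n p (\<lambda>(i, k). E n \<omega> i k))
                    / real n *
                  (\<Sum>(i, j) \<in> set (edge_list n (Phi n \<omega>)).
                     sqrt (Phi n \<omega> i j) * sqrt (\<Sum>k<p. (U n i k - U n j k)\<^sup>2))))"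
proof -
  define d where "d = sqrt (\<Sum>k<p. (c1 k - c2 k)\<^sup>2)"
  have d0: "0 \<le> d" by (simp add: d_def sum_nonneg)
  define K where "K = 2520000 * \<sigma> * d"
  have K0: "0 \<le> K" using d0 sigma_pos by (simp add: K_def)
  define Z where "Z n \<omega> = max_abs_entry (mp_pinv (incidence_mat n (Phi n \<omega>)) * mat n p (\<lambda>(i, k). E n \<omega> i k)) / real n *
      (\<Sum>(i, j)\<in>set (edge_list n (Phi n \<omega>)). sqrt (Phi n \<omega> i j) * sqrt (\<Sum>k<p. (U n i k - U n j k)\<^sup>2))" for n \<omega>
  define r where "r n = sqrt (ln (real n)) * (pb n / (pw n + pb n) + 1 / (sqrt (real n) * (pw n + pb n)))" for n
  have dist: "sqrt (\<Sum>k<p. (U n i k - U n j k)\<^sup>2) = (if (i < n div 2) = (j < n div 2) then 0 else d)" for n i j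
    by (auto simp: U_def d_def power2_commute)
  have Z0: "0 \<le> Z n \<omega>" for n \<omega>
    unfolding Z_def using d0 max_abs_entry_nonneg
    by (intro mult_nonneg_nonneg divide_nonneg_nonneg sum_nonneg) (auto simp: set_edge_list dist)
  define G where "G n \<longleftrightarrow> 4 \<le> n \<and> 120 * ln (real n) \<le> real n * pw n \<and> 120 * ln (real n) \<le> real n * pb n" for n
  define T where "T \<longleftrightarrow> (\<lambda>n. sqrt (ln (real n) / real n)) \<in> o[even_at_top](pw) \<and>
      (\<lambda>n. pb n * sqrt (ln (real n))) \<in> o[even_at_top](pw)"
  have "bounded_in_prob even_at_top M Z r \<and> (T \<longrightarrow> tendsto_zero_in_prob even_at_top M Z)"
  proof (cases "\<forall>k<p. c1 k = c2 k")
    \<comment> \<open>With equal centres no pair has distinct rows, so the Bernoulli hypothesis says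
      nothing about \<open>pb\<close>, not even its sign; but then all jumps vanish and so does the
      statistic.\<close>
    case True
    then have "d = 0" by (simp add: d_def)
    then have "sqrt (\<Sum>k<p. (U n i k - U n j k)\<^sup>2) = 0" for n i j unfolding dist by (simp only: if_cancel)
    then have Z: "Z n \<omega> = 0" for n \<omega> by (simp add: Z_def)
    show ?thesis
      unfolding bounded_in_prob_def tendsto_zero_in_prob_def Z
      by (auto intro!: exI[of _ 0] always_eventually bexI[of _ "{}"])
  next
    case c12: False
    have main: "\<exists>A\<in>sets (M n). measure (M n) A \<le> (8 + 2 * p) / real n \<and> (\<forall>\<omega>\<in>space (M n) - A. Z n \<omega> \<le> K * r n)"
      and pos: "0 < pw n \<and> 0 < pb n"
      if "even n" "G n" for n
    proof -
      obtain h where n: "n = 2 * h" using \<open>even n\<close> by (rule evenE)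
      have ev: "even (2 * h)" by simp
      have h: "2 \<le> h" using \<open>G n\<close> by (simp add: G_def n)
      interpret prob_space "M (2 * h)" using prob[OF ev] .
      define a b where "a = pw (2 * h)" and "b = pb (2 * h)"
      have q: "prob {\<omega> \<in> space (M (2*h)). Phi (2*h) \<omega> i j = 1} = block_prob h a b i j"
        if "i < j" "j < 2 * h" for i j
        using Phi_bernoulli[OF ev that] c12 that
        by (cases "i < h"; cases "j < h") (simp_all add: block_prob_def U_def a_def b_def)
      \<comment> \<open>Both are probabilities of actual pairs: 0 and 1 share a community because
        \<open>h \<ge> 2\<close>, while 0 and \<open>h\<close> do not.\<close>
      have ab: "a \<le> 1" "b \<le> 1"
      proof -
        have "block_prob h a b i j \<le> 1" if "i < j" "j < 2 * h" for i j
          unfolding q[OF that, symmetric] by (rule prob_le_1)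
        from this[of 0 1] this[of 0 h] show "a \<le> 1" "b \<le> 1" using h by (simp_all add: block_prob_def)
      qed
      interpret noisy_block_model "M (2*h)" h p "Phi (2*h)" "E (2*h)" a b \<sigma>
      proof unfold_locales
        show "prob {\<omega> \<in> space (M (2*h)). Phi (2*h) \<omega> i j = 1} = block_prob h a b i j"
          if "i < 2 * h" "j < 2 * h" "i \<noteq> j" for i j
        proof (cases "i < j")
          case False
          have "{\<omega> \<in> space (M (2*h)). Phi (2*h) \<omega> i j = 1} = {\<omega> \<in> space (M (2*h)). Phi (2*h) \<omega> j i = 1}"
            using Phi_sym[OF ev] that by auto
          then show ?thesis using q[of j i] that False by (auto simp: block_prob_def)
        qed (use q that in auto)
        show "subg_norm (M (2*h)) (\<lambda>\<omega>. E (2*h) \<omega> i) p \<le> ereal \<sigma>" if "i < 2 * h" for i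
          using E_subg[OF ev that] by simp
        show "0 < h" using h by simp
        show "120 * ln (real (2 * h)) \<le> real (2 * h) * a" "120 * ln (real (2 * h)) \<le> real (2 * h) * b"
          using \<open>G n\<close> by (auto simp: G_def n a_def b_def)
      qed (fact Phi_01[OF ev] Phi_sym[OF ev] Phi_diag[OF ev] Phi_indep[OF ev] sigma_pos E_indep_rows[OF ev]
          E_mean_zero[OF ev] E_Phi_indep[OF ev])+
      show "0 < pw n \<and> 0 < pb n" using ab_pos by (simp add: n a_def b_def)
      have "a + b \<le> 2" using ab by simp
      from statistic_whp[OF d0 this]
      show "\<exists>A\<in>sets (M n). measure (M n) A \<le> (8 + 2 * p) / real n \<and> (\<forall>\<omega>\<in>space (M n) - A. Z n \<omega> \<le> K * r n)"
        unfolding n Z_def dist K_def r_def a_def b_def by simp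
    qed
    have ev_even: "eventually (\<lambda>n. even n \<and> 4 \<le> n) even_at_top"
      unfolding eventually_even_at_top by (rule eventually_mono[OF eventually_ge_at_top[of 4]]) simp
    have rate: "eventually (\<lambda>n. 120 * ln (real n) \<le> real n * q n) even_at_top"
      if o: "(\<lambda>n. ln (real n) / real n) \<in> o[even_at_top](q)" and q: "\<And>n. even n \<Longrightarrow> 4 \<le> n \<Longrightarrow> 0 \<le> q n" for q
    proof -
      have "eventually (\<lambda>n. norm (ln (real n) / real n) \<le> 1/120 * norm (q n)) even_at_top"
        using o by (rule landau_o.smallD) simp
      with ev_even show ?thesis
      proof eventually_elim
        case (elim n)
        then have "ln (real n) / real n \<le> 1/120 * q n" using q[of n] by auto
        then show ?case using elim by (simp add: field_simps)
      qed
    qed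
    \<comment> \<open>Little-o compares absolute values; as probabilities \<open>pw\<close> and
      \<open>pb\<close> are nonnegative, so the thresholds in \<open>G\<close> follow without
      them.\<close>
    have q0: "0 \<le> pw n" "0 \<le> pb n" if n: "even n" "4 \<le> n" for n
    proof -
      have "measure (M n) {\<omega> \<in> space (M n). Phi n \<omega> 0 1 = 1} = pw n"
        using Phi_bernoulli[of n 0 1] n by (auto simp: U_def)
      then show "0 \<le> pw n" by (metis measure_nonneg)
      have "measure (M n) {\<omega> \<in> space (M n). Phi n \<omega> 0 (n div 2) = 1} = pb n"
        using Phi_bernoulli[of n 0 "n div 2"] n c12 by (auto simp: U_def)
      then show "0 \<le> pb n" by (metis measure_nonneg)
    qed
    have ev_G: "eventually (\<lambda>n. even n \<and> G n) even_at_top"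
    proof -
      have "eventually (\<lambda>n. 120 * ln (real n) \<le> real n * pw n) even_at_top"
        by (rule rate[OF pw_rate]) (rule q0(1))
      moreover have "eventually (\<lambda>n. 120 * ln (real n) \<le> real n * pb n) even_at_top"
        by (rule rate[OF pb_rate]) (rule q0(2))
      ultimately show ?thesis using ev_even by eventually_elim (auto simp: G_def)
    qed
    have small: "eventually (\<lambda>n. (8 + 2 * p) / real n < \<epsilon>) even_at_top" if "\<epsilon> > 0" for \<epsilon> :: real
    proof -
      have "((\<lambda>n. (8 + 2 * p) / real n) \<longlongrightarrow> 0) at_top"
        by (intro tendsto_divide_0[OF tendsto_const] filterlim_at_top_imp_at_infinity filterlim_real_sequentially)
      then have "eventually (\<lambda>n. (8 + 2 * p) / real n < \<epsilon>) at_top" using that by (rule order_tendstoD)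
      then show ?thesis by (rule filter_leD[OF even_at_top_le])
    qed
    \<comment> \<open>One statement for both claims: \<open>t\<close> is \<open>K * |r n|\<close>
      for boundedness and the constant \<open>\<delta>\<close> for convergence.\<close>
    have exceed: "eventually (\<lambda>n. \<exists>A\<in>sets (M n). {\<omega> \<in> space (M n). \<bar>Z n \<omega>\<bar> > t n} \<subseteq> A \<and> measure (M n) A < \<epsilon>) even_at_top"
      if "\<epsilon> > 0" and t: "eventually (\<lambda>n. K * r n \<le> t n) even_at_top" for \<epsilon> :: real and t
      using ev_G small[OF \<open>\<epsilon> > 0\<close>] t
    proof eventually_elim
      case (elim n)
      then obtain A where A: "A \<in> sets (M n)" "measure (M n) A \<le> (8 + 2 * p) / real n"
        "\<And>\<omega>. \<omega> \<in> space (M n) - A \<Longrightarrow> Z n \<omega> \<le> K * r n" using main[of n] by blast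
      have "{\<omega> \<in> space (M n). \<bar>Z n \<omega>\<bar> > t n} \<subseteq> A"
      proof
        fix \<omega> assume w: "\<omega> \<in> {\<omega> \<in> space (M n). \<bar>Z n \<omega>\<bar> > t n}"
        show "\<omega> \<in> A"
        proof (rule ccontr)
          assume "\<omega> \<notin> A"
          then have "Z n \<omega> \<le> K * r n" using A(3)[of \<omega>] w by simp
          then show False using w elim Z0[of n \<omega>] by simp
        qed
      qed
      moreover have "measure (M n) A < \<epsilon>" using A(2) elim by simp
      ultimately show ?case using A(1) by blast
    qed
    show ?thesis
    proof (intro conjI impI)
      show "bounded_in_prob even_at_top M Z r"
        unfolding bounded_in_prob_def
      proof (intro allI impI exI)
        fix \<epsilon> :: real assume "\<epsilon> > 0"
        then show "eventually (\<lambda>n. \<exists>A\<in>sets (M n). {\<omega> \<in> space (M n). \<bar>Z n \<omega>\<bar> > K * \<bar>r n\<bar>} \<subseteq> A \<and>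
            measure (M n) A < \<epsilon>) even_at_top"
          using K0 by (intro exceed always_eventually allI mult_left_mono) auto
      qed
    next
      assume T
      show "tendsto_zero_in_prob even_at_top M Z"
        unfolding tendsto_zero_in_prob_def
      proof (intro allI impI)
        fix \<delta> \<epsilon> :: real assume \<delta>: "\<delta> > 0" and \<epsilon>: "\<epsilon> > 0"
        \<comment> \<open>Only \<open>K \<ge> 0\<close> is at hand, so the shift allows division.
          Both summands of \<open>r n\<close> will be at most \<open>c\<close>, whence
          \<open>K * r n \<le> 2 * c * L = \<delta>\<close>.\<close>
        define L where "L = K + 1"
        have L: "L > 0" "K \<le> L" using K0 by (simp_all add: L_def)
        define c where "c = \<delta> / (2 * L)"
        have c0: "c > 0" using \<delta> L by (simp add: c_def)
        have o1: "eventually (\<lambda>n. norm (sqrt (ln (real n) / real n)) \<le> c * norm (pw n)) even_at_top"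
          and o2: "eventually (\<lambda>n. norm (pb n * sqrt (ln (real n))) \<le> c * norm (pw n)) even_at_top"
          using \<open>T\<close> unfolding T_def by (auto simp only: intro!: landau_o.smallD c0)
        have "eventually (\<lambda>n. K * r n \<le> \<delta>) even_at_top"
          using ev_G o1 o2
        proof eventually_elim
          case (elim n)
          define s where "s = sqrt (ln (real n))"
          have n: "4 \<le> n" and w: "0 < pw n" and b: "0 < pb n" using elim pos[of n] by (auto simp: G_def)
          have s: "0 \<le> s" "s / sqrt n \<le> c * pw n" "pb n * s \<le> c * pw n"
            using elim n w b by (auto simp: s_def real_sqrt_divide)
          have le: "c * pw n \<le> c * (pw n + pb n)" using c0 b by simp
          have "r n = (pb n * s) / (pw n + pb n) + (s / sqrt n) / (pw n + pb n)"
            using w b n by (simp add: r_def s_def distrib_left mult.commute)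
          also have "\<dots> \<le> c * (pw n + pb n) / (pw n + pb n) + c * (pw n + pb n) / (pw n + pb n)"
            using s le w b by (intro add_mono divide_right_mono) auto
          also have "\<dots> = 2 * c" using w b by simp
          finally have "K * r n \<le> K * (2 * c)" using K0 by (rule mult_left_mono)
          also have "\<dots> \<le> L * (2 * c)" using c0 L by (intro mult_right_mono) auto
          also have "\<dots> = \<delta>" using L by (simp add: c_def)
          finally show ?case .
        qed
        with \<epsilon> show "eventually (\<lambda>n. \<exists>A\<in>sets (M n). {\<omega> \<in> space (M n). \<bar>Z n \<omega>\<bar> > \<delta>} \<subseteq> A \<and>
            measure (M n) A < \<epsilon>) even_at_top"
          by (rule exceed)
      qed
    qed
  qed
  then show ?thesis unfolding T_def Z_def[abs_def] r_def[abs_def] by simp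
qed

end
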